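(* Let $m_1+\dots+m_k=n$ with $n\geq 2$, let $v$ be a distinguished vertex of the product of simplices $\varDelta^{m_1}\times\dots\times\varDelta^{m_k}$, and let $Q^n$ be any simple polytope with distinguished vertex $w$. Then there is a combinatorial equivalence \[ (\varDelta^{m_1}\times\dots\times\varDelta^{m_k})\mathbin{\#}_{v,w}Q^n\equiv \varPi_{F_1}(\dots(\varPi_{F_k}(Q^n))\dots) \] for some sequence $F_1,\dots,F_k$ of products of simplices.
   Context: A simple $n$-polytope is a bounded intersection of $m>n$ closed halfspaces in $\mathbb{R}^n$ whose bounding hyperplanes are in general position (no $n+1$ of them meet), such that no halfspace is redundant. Facets are its intersections with bounding hyperplanes, faces are nonempty intersections of facets; each vertex lies in exactly $n$ facets. Polytopes are combinatorially equivalent, written $\equiv$, if their face lattices are isomorphic. $\varDelta^r$ is the standard $r$-simplex. Connected sum ($n\geq 2$). Let $P^n$, $Q^n$ be simple polytopes with distinguished vertices $v$, $w$, and with the facets meeting at $v$ ordered as $E_1,\dots,E_n$ and those meeting at $w$ ordered as $F_1,\dots,F_n$. Let $\mathcal{C}_v$, $\mathcal{C}_w$ be the sets of facets avoiding $v$, $w$ respectively. Embed $\varDelta^{n-1}$ in the hyperplane $\{x_1=0\}$ of $\mathbb{R}^n$, with facets $D_1,\dots,D_n$, and let $\varGamma^n$ be its product with the first coordinate axis, with facets $G_r=\mathbb{R}\times D_r$, divided into positive and negative halves by the sign of $x_1$. Choose a projective transformation $\phi_P$ mapping $v$ to $x_1=+\infty$ and embedding $P^n$ in $\varGamma^n$ so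 that the hyperplane defining $E_r$ is identified with that defining $G_r$ for each $r$, and the images of the hyperplanes defining $\mathcal{C}_v$ meet $\varGamma^n$ in its negative half. Choose $\phi_Q$ similarly, mapping $w$ to $x_1=-\infty$, identifying the hyperplanes of $F_r$ and $G_r$, with the images of the hyperplanes defining $\mathcal{C}_w$ meeting $\varGamma^n$ in its positive half. The connected sum $P^n\mathbin{\#}_{v,w}Q^n$ is the simple $n$-polytope determined by all these hyperplanes; it is defined up to combinatorial equivalence (and may depend on $v$, $w$ and the orderings). Pruning. For a face $F$ of a simple polytope $Q^n$, $\varPi_F(Q^n)$ is the polytope obtained by detaching $F$ from $Q^n$, i.e. by adding to the defining set of $Q^n$ a halfspace not containing $F$, whose bounding hyperplane separates the vertices of $F$ from all other vertices of $Q^n$; it is defined up to combinatorial equivalence. In the composite, each $F_i$ is a face of the polytope to which $\varPi_{F_i}$ is applied. *)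

theory Defs
  imports "HOL-Analysis.Analysis"
begin

definition closed_halfspace :: "(real^'n) set \<Rightarrow> bool" where
  "closed_halfspace h \<longleftrightarrow> (\<exists>a b. a \<noteq> 0 \<and> h = {x. a \<bullet> x \<le> b})"

(* The bounding hyperplane of a closed halfspace h is its frontier.  General position is
   required of the hyperplanes in the whole space, not only along P.  Together with
   nonemptiness it forces P to have dimension CARD('n). *)
definition simple_polytope :: "(real^'n) set \<Rightarrow> bool" where
  "simple_polytope P \<longleftrightarrow>
     (\<exists>H. finite H \<and> card H > CARD('n) \<and> (\<forall>h\<in>H. closed_halfspace h) \<and>
          P = \<Inter>H \<and> P \<noteq> {} \<and> bounded P \<and>
          (\<forall>K\<subseteq>H. card K = CARD('n) + 1 \<longrightarrow> \<Inter>(frontier ` K) = {}) \<and>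
          (\<forall>h\<in>H. \<Inter>(H - {h}) \<noteq> P))"

(* Isomorphism of face lattices; "face_of" includes the empty face and the polytope itself. *)
definition combinatorially_equivalent ::
    "('a::real_vector) set \<Rightarrow> ('b::real_vector) set \<Rightarrow> bool" (infix "\<simeq>\<^sub>c" 50) where
  "P \<simeq>\<^sub>c Q \<longleftrightarrow>
     (\<exists>f. bij_betw f {F. F face_of P} {G. G face_of Q} \<and>
          (\<forall>F G. F face_of P \<longrightarrow> G face_of P \<longrightarrow> (F \<subseteq> G \<longleftrightarrow> f F \<subseteq> f G)))"

(* For pairwise disjoint sets B 1, ..., B l of coordinates, this is the product of the
   standard simplices {x \<ge> 0, sum of the x_j \<le> 1} of the coordinate subspaces R^(B i);
   coordinates outside all the blocks vanish.  The i-th factor has dimension card (B i). *)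
definition simplex_product :: "nat \<Rightarrow> (nat \<Rightarrow> 'n set) \<Rightarrow> (real^'n) set" where
  "simplex_product l B =
     {x. (\<forall>j. 0 \<le> x $ j) \<and> (\<forall>i\<in>{1..l}. (\<Sum>j\<in>B i. x $ j) \<le> 1) \<and>
         (\<forall>j. j \<notin> (\<Union>i\<in>{1..l}. B i) \<longrightarrow> x $ j = 0)}"

(* A single point counts, as the product of no simplices (or of copies of the 0-simplex). *)
definition is_simplex_product :: "(real^'n) set \<Rightarrow> bool" where
  "is_simplex_product F \<longleftrightarrow>
     (\<exists>l (B :: nat \<Rightarrow> 'n set). disjoint_family_on B {1..l} \<and> F \<simeq>\<^sub>c simplex_product l B)"

(* A projective transformation is given by a linear automorphism T of homogeneous
   coordinates (x, t), the point x of the affine space being represented by (x, 1);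
   points with t = 0 lie at infinity. *)
definition proj_map :: "((real^'n) \<times> real \<Rightarrow> (real^'n) \<times> real) \<Rightarrow> real^'n \<Rightarrow> real^'n" where
  "proj_map T x = fst (T (x, 1)) /\<^sub>R snd (T (x, 1))"

(* The affine part of the image of the projective closure of an affine subspace A. *)
definition proj_flat ::
    "((real^'n) \<times> real \<Rightarrow> (real^'n) \<times> real) \<Rightarrow> (real^'n) set \<Rightarrow> (real^'n) set" where
  "proj_flat T A = {y. (y, 1) \<in> T ` span (A \<times> {1})}"

(* The product of S with the coordinate axis i. *)
definition cylinder :: "'n \<Rightarrow> (real^'n) set \<Rightarrow> (real^'n) set" where
  "cylinder i S = {x + t *\<^sub>R axis i 1 | x t. x \<in> S}"

(* The projective transformation T takes v to the end of sign s of the axis i (s = 1 or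
   s = -1) and embeds P - {v} in the cylinder over S, identifies the hyperplane of the
   facet E r with that of cylinder i (D r), and moves the hyperplanes of the facets
   avoiding v so that they meet the cylinder in the half of sign opposite to s.
   Positivity of the last homogeneous coordinate on P - {v} only normalises the sign of T;
   with it, proj_map T x tends to s * infinity along the axis as x tends to v in P. *)
definition polar_embedding ::
    "real \<Rightarrow> 'n \<Rightarrow> (real^'n) set \<Rightarrow> ('n \<Rightarrow> (real^'n) set) \<Rightarrow>
     (real^'n) set \<Rightarrow> real^'n \<Rightarrow> ('n \<Rightarrow> (real^'n) set) \<Rightarrow>
     ((real^'n) \<times> real \<Rightarrow> (real^'n) \<times> real) \<Rightarrow> bool" where
  "polar_embedding s i S D P v E T \<longleftrightarrow>
     linear T \<and> bij T \<and>
     (\<exists>c>0. T (v, 1) = ((c * s) *\<^sub>R axis i 1, 0)) \<and>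
     (\<forall>x\<in>P - {v}. snd (T (x, 1)) > 0 \<and> proj_map T x \<in> cylinder i S) \<and>
     (\<forall>r. proj_flat T (affine hull E r) = affine hull (cylinder i (D r))) \<and>
     (\<forall>C. C facet_of P \<longrightarrow> v \<notin> C \<longrightarrow>
        (\<forall>y \<in> proj_flat T (affine hull C) \<inter> cylinder i S. s * y $ i < 0))"

(* R is a connected sum of P and Q at v and w.  The facets at a vertex are ordered by
   indexing them with the n elements of 'n, and i plays the role of the first coordinate.
   As polytopes are intersections of their facet halfspaces, the image of P - {v} is the
   part of the cylinder cut out by the images of the hyperplanes avoiding v (this part is
   unbounded towards the pole), and likewise for Q - {w}.  So the polytope determined by
   all the hyperplanes is the intersection of the two images. *)
definition connected_sum ::
    "(real^'n) set \<Rightarrow> real^'n \<Rightarrow> ('n \<Rightarrow> (real^'n) set) \<Rightarrow>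
     (real^'n) set \<Rightarrow> real^'n \<Rightarrow> ('n \<Rightarrow> (real^'n) set) \<Rightarrow>
     (real^'n) set \<Rightarrow> bool" where
  "connected_sum P v E Q w F R \<longleftrightarrow>
     (\<exists>i S D T U.
        (int CARD('n) - 1) simplex S \<and> S \<subseteq> {x. x $ i = 0} \<and>
        bij_betw D UNIV {G. G facet_of S} \<and>
        polar_embedding 1 i S D P v E T \<and> polar_embedding (-1) i S D Q w F U \<and>
        R = proj_map T ` (P - {v}) \<inter> proj_map U ` (Q - {w}))"

(* R is obtained from the simple polytope Q by detaching the proper nonempty face F. *)
definition pruning :: "(real^'n) set \<Rightarrow> (real^'n) set \<Rightarrow> (real^'n) set \<Rightarrow> bool" where
  "pruning F Q R \<longleftrightarrow>
     simple_polytope Q \<and> F face_of Q \<and> F \<noteq> {} \<and> F \<noteq> Q \<and>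
     (\<exists>h. closed_halfspace h \<and>
          (\<forall>u. u extreme_point_of Q \<longrightarrow> (if u \<in> F then u \<notin> h else u \<in> interior h)) \<and>
          R = Q \<inter> h)"

end

theory Submission
  imports Defs
begin

text \<open>
  The combinatorial type of a polytope given by finitely many affine inequalities is determined by
  the sets of inequalities that are tight at its points.  Write y for the homogeneous coordinates at
  the vertex w of Q given by the n facets through w, and \<sigma> for their sum.  The image of
  the product of simplices minus v is cut out of the cylinder by one hyperplane per factor, and its
  tight sets depend only on the blocks of coordinates: in the face of the cylinder where exactly the
  coordinates in Z vanish, a nonempty set of these hyperplanes can be tight alone iff none of
  the corresponding blocks is contained in Z.  Since these hyperplanes lie below the axis position 0
  and those of Q above, they never interfere with each other.

  The same tight sets arise if Q is cut near w, one factor after the other, by the halfspaces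
  \<sigma> - (sum of y over the block C q) / 2 \<ge> l q with generic, slightly increasing levels l 1 < l 2 < \<dots>.
  The first cut removes only w.  The cut number p + 1 removes exactly the vertices in the face where
  cut p is tight and the coordinates of C p vanish, and this face is a product of the
  simplices of the blocks C 1, \<dots>, C (p - 1) and one simplex on all blocks not yet used.
\<close>

subsection \<open>Faces and tight constraints\<close>

text \<open>Both sides are reduced to one linear question: which cuts can be tight at once when some
  coordinates vanish. Subtracting only half of a block sum keeps the cuts near w; subtracting all of
  it would give hyperplanes parallel to the coordinate directions of the block. The price is that
  cuts of equal level do not meet at that level. If exactly n cuts at level l are tight and the
  other blocks vanish, their block sums are 2(\<sigma> - l) each, so \<sigma> = 2n l / (2n - 1),
  which is at least 2k l / (2k - 1). Levels between L and (1 + 1/(2k)) L stay below this value,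
  because (2k - 1)(2k + 1) < 4k^2, and the interval still has room to increase them strictly and to
  avoid the finitely many values that spoil general position. Strict increase is needed because
  pruned face p lies at \<sigma> = l p and has to be separated strictly by cut p + 1. An empty block
  yields a cut whose whole facet is removed by the next one, which is why the last block must be
  nonempty.\<close>

definition affine_form :: "('a::real_inner \<Rightarrow> real) \<Rightarrow> bool" where
  "affine_form f \<longleftrightarrow> (\<exists>a b. \<forall>x. f x = a \<bullet> x + b)"

lemma affine_form_shift:
  assumes "affine_form f"
  shows "f (x + t *\<^sub>R (a - b)) = f x + t * (f a - f b)"
  using assms unfolding affine_form_def
  by (auto simp: inner_add_right inner_diff_right algebra_simps)

lemma affine_form_convex_comb:
  assumes "affine_form f"
  shows "f ((1 - u) *\<^sub>R x + u *\<^sub>R y) = (1 - u) * f x + u * f y"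
  using assms unfolding affine_form_def
  by (auto simp: inner_add_right algebra_simps)

lemma affine_form_const [simp]: "affine_form (\<lambda>x. c)"
  unfolding affine_form_def by (rule exI[of _ 0]) auto

lemma affine_form_inner [simp]: "affine_form (\<lambda>x. a \<bullet> x)"
  unfolding affine_form_def by (rule exI[of _ a]) auto

lemma affine_form_add [intro]:
  "affine_form f \<Longrightarrow> affine_form g \<Longrightarrow> affine_form (\<lambda>x. f x + g x)"
  unfolding affine_form_def
  by (elim exE, rename_tac a a' b b', rule_tac x="a + a'" in exI, rule_tac x="b + b'" in exI)
    (auto simp: inner_add_left)

lemma affine_form_scale [intro]: "affine_form f \<Longrightarrow> affine_form (\<lambda>x. c * f x)"
  unfolding affine_form_def
  by (elim exE, rename_tac a b, rule_tac x="c *\<^sub>R a" in exI, rule_tac x="c * b" in exI)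
    (auto simp: algebra_simps)

lemma affine_form_diff [intro]:
  "affine_form f \<Longrightarrow> affine_form g \<Longrightarrow> affine_form (\<lambda>x. f x - g x)"
  using affine_form_add[of f "\<lambda>x. (-1) * g x"] affine_form_scale[of g "-1"] by simp

lemma affine_form_sum [intro]:
  "(\<And>i. i \<in> A \<Longrightarrow> affine_form (f i)) \<Longrightarrow> affine_form (\<lambda>x. \<Sum>i\<in>A. f i x)"
  by (induction A rule: infinite_finite_induct) (auto intro: affine_form_add)

lemma affine_form_nth [simp]: "affine_form (\<lambda>x::real^'n. x $ j)"
proof -
  have "(\<lambda>x::real^'n. x $ j) = (\<lambda>x. axis j 1 \<bullet> x)"
    by (auto simp: inner_axis')
  then show ?thesis by simp
qed

lemma affine_form_continuous:
  assumes "affine_form f" shows "continuous_on A f"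
proof -
  obtain a b where "f = (\<lambda>x. a \<bullet> x + b)" using assms unfolding affine_form_def by auto
  then show ?thesis by (auto intro!: continuous_intros)
qed

text \<open>Equations are kept in the ambient flat \<open>V\<close> and only inequalities are
  indexed. A pruned face, described inside the flat of its defining equations, then has an index set
  that can be matched with the facets of a product of simplices.\<close>

definition polyh :: "'a set \<Rightarrow> 'c set \<Rightarrow> ('c \<Rightarrow> 'a \<Rightarrow> real) \<Rightarrow> 'a set" where
  "polyh V J f = {x \<in> V. \<forall>c\<in>J. 0 \<le> f c x}"

definition tight :: "'c set \<Rightarrow> ('c \<Rightarrow> 'a \<Rightarrow> real) \<Rightarrow> 'a \<Rightarrow> 'c set" where
  "tight J f x = {c \<in> J. f c x = 0}"

locale polyhedral =
  fixes V :: "'a::euclidean_space set" and J :: "'c set" and f :: "'c \<Rightarrow> 'a \<Rightarrow> real"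
  assumes affV: "affine V" and finJ: "finite J"
    and form: "\<And>c. c \<in> J \<Longrightarrow> affine_form (f c)"
begin

text \<open>Moving away from \<open>y\<close> keeps tight constraints tight, since they vanish at
  both points, and a short step preserves the finitely many strict ones.\<close>

lemma extend_beyond:
  assumes x: "x \<in> polyh V J f" and y: "y \<in> V" "\<And>c. c \<in> tight J f x \<Longrightarrow> f c y = 0"
  shows "\<exists>e>0. x + e *\<^sub>R (x - y) \<in> polyh V J f"
proof -
  have ev: "\<forall>\<^sub>F e in at_right (0::real). 0 \<le> f c x + e * (f c x - f c y)" if c: "c \<in> J" for c
  proof (cases "f c x = 0")
    case True
    then have "c \<in> tight J f x" using c by (simp add: tight_def)
    then show ?thesis using y(2) True by simp
  next
    case False
    then have pos: "f c x > 0" using x c by (force simp: polyh_def)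
    have "((\<lambda>e. f c x + e * (f c x - f c y)) \<longlongrightarrow> f c x + 0 * (f c x - f c y)) (at_right 0)"
      by (intro tendsto_intros)
    then have "\<forall>\<^sub>F e in at_right (0::real). 0 < f c x + e * (f c x - f c y)"
      by (rule order_tendstoD) (use pos in simp)
    then show ?thesis by (rule eventually_mono) simp
  qed
  have "\<forall>\<^sub>F e in at_right (0::real). \<forall>c\<in>J. 0 \<le> f c x + e * (f c x - f c y)"
    using finJ ev by (simp add: eventually_ball_finite)
  then have "\<forall>\<^sub>F e in at_right (0::real). e > 0 \<and> (\<forall>c\<in>J. 0 \<le> f c x + e * (f c x - f c y))"
    by (intro eventually_conj eventually_at_right_less)
  then obtain e :: real where e: "e > 0" "\<forall>c\<in>J. 0 \<le> f c x + e * (f c x - f c y)"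
    using eventually_happens[OF _ ] trivial_limit_at_right_real by blast
  have "x \<in> V" using x by (simp add: polyh_def)
  then have "(1 + e) *\<^sub>R x + (- e) *\<^sub>R y \<in> V"
    using affV y(1) by (intro mem_affine) auto
  then have "x + e *\<^sub>R (x - y) \<in> V" by (simp add: algebra_simps)
  then show ?thesis
    using e form by (auto simp: polyh_def affine_form_shift)
qed

text \<open>If \<open>y\<close> differed from \<open>x\<close>, extending beyond \<open>x\<close>
  both from \<open>y\<close> and from its mirror image would put \<open>x\<close> inside an open
  segment. The criterion replaces rank computations: vertices are studied by exhibiting motions that
  keep all tight constraints tight.\<close>

lemma extreme_point_rigid:
  assumes x: "x extreme_point_of polyh V J f" and y: "y \<in> V" "\<And>c. c \<in> tight J f x \<Longrightarrow> f c y = 0"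
  shows "y = x"
proof (rule ccontr)
  assume ne: "y \<noteq> x"
  have xin: "x \<in> polyh V J f" using x by (simp add: extreme_point_of_def)
  obtain e where e: "e > 0" "x + e *\<^sub>R (x - y) \<in> polyh V J f"
    using extend_beyond[OF xin y] by blast
  define y' where "y' = 2 *\<^sub>R x - y"
  have xV: "x \<in> V" using xin by (simp add: polyh_def)
  then have "2 *\<^sub>R x + (-1) *\<^sub>R y \<in> V" using affV y(1) by (intro mem_affine) auto
  then have y'V: "y' \<in> V" by (simp add: y'_def)
  have "f c y' = 0" if "c \<in> tight J f x" for c
  proof -
    have "f c (x + 1 *\<^sub>R (x - y)) = f c x + 1 * (f c x - f c y)"
      using that form by (intro affine_form_shift) (auto simp: tight_def)
    moreover have "x + 1 *\<^sub>R (x - y) = y'" by (simp add: y'_def scaleR_2)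
    ultimately show ?thesis using that y(2) by (simp add: tight_def)
  qed
  then obtain e' where e': "e' > 0" "x + e' *\<^sub>R (x - y') \<in> polyh V J f"
    using extend_beyond[OF xin y'V] by blast
  have d: "x - y' = - (x - y)" by (simp add: y'_def scaleR_2)
  let ?p = "x + e *\<^sub>R (x - y)" and ?q = "x + e' *\<^sub>R (x - y')"
  have "?p \<noteq> ?q"
  proof
    assume "?p = ?q"
    then have "(e + e') *\<^sub>R (x - y) = 0" unfolding d by (simp add: algebra_simps)
    then show False using ne e e' by simp
  qed
  moreover have "x = (1 - e / (e + e')) *\<^sub>R ?p + (e / (e + e')) *\<^sub>R ?q"
  proof -
    have "(1 - e / (e + e')) *\<^sub>R ?p + (e / (e + e')) *\<^sub>R ?q
        = x + ((1 - e / (e + e')) * e - (e / (e + e')) * e') *\<^sub>R (x - y)"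
      unfolding d by (simp add: algebra_simps)
    also have "(1 - e / (e + e')) * e - (e / (e + e')) * e' = 0"
      using e e' by (simp add: field_simps)
    finally show ?thesis by simp
  qed
  moreover have "0 < e / (e + e')" "e / (e + e') < 1" using e e' by auto
  ultimately have "x \<in> open_segment ?p ?q"
    unfolding in_segment by blast
  then show False using x e e' unfolding extreme_point_of_def by blast
qed

lemma tight_face:
  assumes "K \<subseteq> J"
  shows "{x \<in> polyh V J f. K \<subseteq> tight J f x} face_of polyh V J f"
  unfolding face_of_def
proof (intro conjI ballI impI)
  show "convex {x \<in> polyh V J f. K \<subseteq> tight J f x}"
    unfolding convex_alt
  proof (intro ballI allI impI)
    fix x y and u :: real
    assume x: "x \<in> {x \<in> polyh V J f. K \<subseteq> tight J f x}" and y: "y \<in> {x \<in> polyh V J f. K \<subseteq> tight J f x}"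
      and u: "0 \<le> u \<and> u \<le> 1"
    have "(1 - u) *\<^sub>R x + u *\<^sub>R y \<in> V"
      using affV x y unfolding affine_def polyh_def by auto
    then show "(1 - u) *\<^sub>R x + u *\<^sub>R y \<in> {x \<in> polyh V J f. K \<subseteq> tight J f x}"
      using x y u form by (auto simp: polyh_def tight_def affine_form_convex_comb subset_eq)
  qed
next
  fix a b x
  assume a: "a \<in> polyh V J f" and b: "b \<in> polyh V J f"
    and x: "x \<in> {x \<in> polyh V J f. K \<subseteq> tight J f x}" and seg: "x \<in> open_segment a b"
  obtain u where u: "0 < u" "u < 1" "x = (1 - u) *\<^sub>R a + u *\<^sub>R b"
    using seg unfolding in_segment by blast
  have "f c a = 0 \<and> f c b = 0" if c: "c \<in> K" for c
  proof -
    have cJ: "c \<in> J" using c assms by blast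
    have "0 = (1 - u) * f c a + u * f c b"
      using x c u affine_form_convex_comb[OF form[OF cJ]] by (force simp: tight_def)
    moreover have "0 \<le> (1 - u) * f c a" "0 \<le> u * f c b"
      using a b u cJ by (auto simp: polyh_def)
    ultimately show ?thesis using u by (smt (verit) mult_eq_0_iff)
  qed
  then show "a \<in> {x \<in> polyh V J f. K \<subseteq> tight J f x}" "b \<in> {x \<in> polyh V J f. K \<subseteq> tight J f x}"
    using a b assms by (auto simp: tight_def)
qed auto

text \<open>The constraints tight at a relative interior point \<open>x\<close> of \<open>G\<close>
  are tight on all of \<open>G\<close>. Conversely, from a point where they are tight, the segment
  to \<open>x\<close> extends beyond \<open>x\<close> within the polyhedron, so that point lies in
  the face.\<close>

lemma face_tight:
  assumes G: "G face_of polyh V J f" "G \<noteq> {}"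
  shows "\<exists>K\<subseteq>J. G = {x \<in> polyh V J f. K \<subseteq> tight J f x}"
proof -
  have cG: "convex G" using G face_of_imp_convex by blast
  then obtain x where x: "x \<in> rel_interior G" using G rel_interior_eq_empty by blast
  then have xG: "x \<in> G" using rel_interior_subset by blast
  then have xin: "x \<in> polyh V J f" using G face_of_imp_subset by blast
  have "G = {y \<in> polyh V J f. tight J f x \<subseteq> tight J f y}"
  proof (intro equalityI subsetI)
    fix y assume y: "y \<in> G"
    then have yin: "y \<in> polyh V J f" using G face_of_imp_subset by blast
    obtain e where e: "e > 1" "(1 - e) *\<^sub>R y + e *\<^sub>R x \<in> G"
      using convex_rel_interior_iff[OF cG G(2)] x y by blast
    have "f c y = 0" if c: "c \<in> tight J f x" for c
    proof -
      have cJ: "c \<in> J" and fx: "f c x = 0" using c by (auto simp: tight_def)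
      have "(1 - e) *\<^sub>R y + e *\<^sub>R x \<in> polyh V J f" using e G face_of_imp_subset by blast
      then have "0 \<le> (1 - e) * f c y + e * f c x"
        using cJ affine_form_convex_comb[OF form[OF cJ], of e y x] by (auto simp: polyh_def)
      then have "f c y \<le> 0" using e fx by (simp add: zero_le_mult_iff)
      then show ?thesis using yin cJ by (force simp: polyh_def)
    qed
    then show "y \<in> {y \<in> polyh V J f. tight J f x \<subseteq> tight J f y}"
      using yin by (auto simp: tight_def)
  next
    fix y assume y: "y \<in> {y \<in> polyh V J f. tight J f x \<subseteq> tight J f y}"
    then have "y \<in> V" "\<And>c. c \<in> tight J f x \<Longrightarrow> f c y = 0"
      by (auto simp: polyh_def tight_def)
    then obtain e where e: "e > 0" "x + e *\<^sub>R (x - y) \<in> polyh V J f"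
      using extend_beyond[OF xin] by blast
    show "y \<in> G"
    proof (cases "y = x")
      case False
      let ?p = "x + e *\<^sub>R (x - y)"
      have "?p - y = (1 + e) *\<^sub>R (x - y)" by (simp add: algebra_simps)
      then have "y \<noteq> ?p" using False e by force
      moreover have "x = (1 - 1 / (1 + e)) *\<^sub>R y + (1 / (1 + e)) *\<^sub>R ?p"
      proof -
        have "(1 - 1 / (1 + e)) *\<^sub>R y + (1 / (1 + e)) *\<^sub>R ?p = y + (1 / (1 + e)) *\<^sub>R (?p - y)"
          by (simp add: algebra_simps)
        also have "\<dots> = x" unfolding \<open>?p - y = _\<close> using e by simp
        finally show ?thesis by simp
      qed
      moreover have "0 < 1 / (1 + e)" "1 / (1 + e) < 1" using e by auto
      ultimately have "x \<in> open_segment y ?p" unfolding in_segment by blast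
      then show ?thesis using G y e xG unfolding face_of_def by blast
    qed (use xG in simp)
  qed
  then show ?thesis by (intro exI[of _ "tight J f x"]) (auto simp: tight_def)
qed

text \<open>Whether a point belongs to a face depends only on its tight set; this makes the transfer
  maps between two polyhedra mutually inverse.\<close>

lemma face_saturated:
  assumes "G face_of polyh V J f"
  shows "G = {x \<in> polyh V J f. tight J f x \<in> tight J f ` G}"
proof (cases "G = {}")
  case False
  then obtain K where "G = {x \<in> polyh V J f. K \<subseteq> tight J f x}" using face_tight assms by blast
  then show ?thesis by auto
qed simp

end

text \<open>The set \<open>K\<close> that cuts out \<open>G\<close> also cuts out \<open>G'\<close>,
  because every tight set of the second polyhedron occurs on the first.\<close>

lemma transfer_face:
  assumes "polyhedral V J f" "polyhedral W J g"
    and eq: "tight J f ` polyh V J f = tight J g ` polyh W J g" and G: "G face_of polyh V J f"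
  defines "G' \<equiv> {y \<in> polyh W J g. tight J g y \<in> tight J f ` G}"
  shows "G' face_of polyh W J g" and "tight J g ` G' = tight J f ` G"
proof -
  interpret f: polyhedral V J f by fact
  interpret g: polyhedral W J g by fact
  have sub: "G \<subseteq> polyh V J f" using G face_of_imp_subset by blast
  show "tight J g ` G' = tight J f ` G"
  proof -
    have "tight J f ` G \<subseteq> tight J g ` polyh W J g" using sub eq by blast
    show ?thesis
    proof (intro equalityI subsetI)
      fix A assume A: "A \<in> tight J f ` G"
      then obtain y where "y \<in> polyh W J g" "A = tight J g y"
        using \<open>tight J f ` G \<subseteq> _\<close> by blast
      then show "A \<in> tight J g ` G'" using A unfolding G'_def by blast
    qed (auto simp: G'_def)
  qed
  show "G' face_of polyh W J g"
  proof (cases "G = {}")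
    case True
    then show ?thesis unfolding G'_def by simp
  next
    case False
    then obtain K where K: "K \<subseteq> J" "G = {x \<in> polyh V J f. K \<subseteq> tight J f x}"
      using f.face_tight G by blast
    have "G' = {y \<in> polyh W J g. K \<subseteq> tight J g y}"
    proof (intro equalityI subsetI)
      fix y assume "y \<in> {y \<in> polyh W J g. K \<subseteq> tight J g y}"
      moreover from this obtain x where "x \<in> polyh V J f" "tight J f x = tight J g y"
        using eq by (metis (no_types, lifting) imageE imageI mem_Collect_eq)
      ultimately show "y \<in> G'" unfolding G'_def K(2) by (auto simp: image_iff) 
    qed (auto simp: G'_def K(2))
    then show ?thesis using g.tight_face[OF K(1)] by simp
  qed
qed

text \<open>No map between the points is constructed: by \<open>face_saturated\<close>, inclusion of
  faces amounts to inclusion of their families of tight sets, and these live in a common index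
  set.\<close>

lemma combinatorially_equivalent_polyh:
  assumes "polyhedral V J f" "polyhedral W J g"
    and eq: "tight J f ` polyh V J f = tight J g ` polyh W J g"
  shows "polyh V J f \<simeq>\<^sub>c polyh W J g"
proof -
  interpret f: polyhedral V J f by fact
  interpret g: polyhedral W J g by fact
  define \<phi> where "\<phi> G = {y \<in> polyh W J g. tight J g y \<in> tight J f ` G}" for G
  define \<psi> where "\<psi> G = {y \<in> polyh V J f. tight J f y \<in> tight J g ` G}" for G
  note tf = transfer_face[OF assms, folded \<phi>_def]
  note tg = transfer_face[OF assms(2,1) eq[symmetric], folded \<psi>_def]
  have "bij_betw \<phi> {F. F face_of polyh V J f} {G. G face_of polyh W J g}"
  proof (rule bij_betwI[where g = \<psi>])
    show "\<psi> (\<phi> G) = G" if "G \<in> {F. F face_of polyh V J f}" for G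
      using that f.face_saturated[of G] tf(2)[of G] unfolding \<psi>_def by simp
    show "\<phi> (\<psi> G) = G" if "G \<in> {F. F face_of polyh W J g}" for G
      using that g.face_saturated[of G] tg(2)[of G] unfolding \<phi>_def by simp
  qed (use tf tg in auto)
  moreover have "F \<subseteq> G \<longleftrightarrow> \<phi> F \<subseteq> \<phi> G" if "F face_of polyh V J f" "G face_of polyh V J f" for F G
  proof
    assume "\<phi> F \<subseteq> \<phi> G"
    then have "tight J f ` F \<subseteq> tight J f ` G" using tf(2) that by (metis image_mono)
    then have "{x \<in> polyh V J f. tight J f x \<in> tight J f ` F}
        \<subseteq> {x \<in> polyh V J f. tight J f x \<in> tight J f ` G}" by blast
    then show "F \<subseteq> G"
      by (simp only: f.face_saturated[OF that(1), symmetric] f.face_saturated[OF that(2), symmetric])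
  next
    assume "F \<subseteq> G"
    then show "\<phi> F \<subseteq> \<phi> G" unfolding \<phi>_def by blast
  qed
  ultimately show ?thesis unfolding combinatorially_equivalent_def by blast
qed

subsection \<open>General position\<close>

lemma bounded_ray_imp_zero:
  fixes x d :: "'a::real_normed_vector"
  assumes "bounded S" "\<And>t. 0 \<le> t \<Longrightarrow> x + t *\<^sub>R d \<in> S"
  shows "d = 0"
proof (rule ccontr)
  assume d: "d \<noteq> 0"
  obtain B where B: "\<And>y. y \<in> S \<Longrightarrow> norm y \<le> B" using assms(1) bounded_iff by blast
  define t where "t = (B + norm x + 1) / norm d"
  have "norm x \<le> B" using B[of x] assms(2)[of 0] by simp
  then have "0 \<le> B + norm x + 1" by (smt (verit) norm_ge_zero)
  then have "t \<ge> 0" unfolding t_def by simp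
  have "norm (t *\<^sub>R d) = B + norm x + 1"
    using d \<open>0 \<le> B + norm x + 1\<close> by (simp add: t_def)
  moreover have "norm (t *\<^sub>R d) \<le> norm (x + t *\<^sub>R d) + norm x"
    using norm_triangle_ineq4[of "x + t *\<^sub>R d" x] by simp
  ultimately show False using B[OF assms(2)[OF \<open>t \<ge> 0\<close>]] by simp
qed

lemma closed_halfspaces_choose:
  assumes "\<forall>h\<in>H. closed_halfspace h"
  obtains a b where "\<And>h. h \<in> H \<Longrightarrow> a h \<noteq> 0 \<and> h = {x. a h \<bullet> x \<le> b h}"
proof -
  have "\<forall>h\<in>H. \<exists>p. fst p \<noteq> 0 \<and> h = {x. fst p \<bullet> x \<le> snd p}"
    using assms unfolding closed_halfspace_def by fastforce
  then obtain p where "\<forall>h\<in>H. fst (p h) \<noteq> 0 \<and> h = {x. fst (p h) \<bullet> x \<le> snd (p h)}"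
    using bchoice by meson
  then show thesis using that[of "\<lambda>h. fst (p h)" "\<lambda>h. snd (p h)"] by blast
qed

text \<open>At most n normals leave a direction of recession: one orthogonal to all of them if they
  do not span, and otherwise, since they form a basis, one having inner product -1 with
  each.\<close>

lemma card_closed_halfspaces_gt:
  fixes H :: "(real^'n) set set"
  assumes fin: "finite H" and hs: "\<forall>h\<in>H. closed_halfspace h"
    and ne: "\<Inter>H \<noteq> {}" and bd: "bounded (\<Inter>H)"
  shows "card H > CARD('n)"
proof (rule ccontr)
  assume le: "\<not> card H > CARD('n)"
  obtain a b where ab: "\<And>h. h \<in> H \<Longrightarrow> a h \<noteq> 0 \<and> h = {x. a h \<bullet> x \<le> b h}"
    using closed_halfspaces_choose[OF hs] by metis
  have "\<exists>d. d \<noteq> 0 \<and> (\<forall>h\<in>H. a h \<bullet> d \<le> 0)"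
  proof (cases "span (a ` H) = UNIV")
    case False
    then obtain d where "d \<noteq> 0" "\<forall>x\<in>span (a ` H). d \<bullet> x = 0"
      using span_not_UNIV_orthogonal by blast
    then show ?thesis by (metis image_eqI inner_commute order_refl span_base)
  next
    case True
    have "card (a ` H) \<le> dim (UNIV :: (real^'n) set)"
      using card_image_le[OF fin, of a] le by simp
    then have "independent (a ` H)"
      using fin True by (intro card_le_dim_spanning[of _ UNIV]) auto
    then obtain g :: "real^'n \<Rightarrow> real" where g: "linear g" "\<forall>x\<in>a ` H. g x = -1"
      using linear_independent_extend[of "a ` H" "\<lambda>_. -1"] by auto
    have gi: "g x = x \<bullet> adjoint g 1" for x
      using adjoint_works[OF g(1), of x 1] by simp
    have "H \<noteq> {}"
    proof
      assume "H = {}"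
      then have "(UNIV :: (real^'n) set) = {0}" using True by simp
      then show False by (metis UNIV_I axis_eq_0_iff singletonD zero_neq_one)
    qed
    then obtain h where "h \<in> H" by blast
    then have "adjoint g 1 \<noteq> 0" using g(2) gi by (metis imageI inner_zero_right neg_equal_0_iff_equal zero_neq_one)
    moreover have "\<forall>h\<in>H. a h \<bullet> adjoint g 1 \<le> 0" using g(2) gi by (metis imageI neg_le_0_iff_le zero_le_one)
    ultimately show ?thesis by blast
  qed
  then obtain d where d: "d \<noteq> 0" "\<forall>h\<in>H. a h \<bullet> d \<le> 0" by blast
  obtain x where x: "x \<in> \<Inter>H" using ne by blast
  have "x + t *\<^sub>R d \<in> \<Inter>H" if t: "0 \<le> t" for t
  proof
    fix h assume h: "h \<in> H"
    then have "a h \<bullet> x \<le> b h" using x ab by blast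
    moreover have "t * (a h \<bullet> d) \<le> 0" using d(2) h t by (simp add: mult_nonneg_nonpos)
    ultimately have "x + t *\<^sub>R d \<in> {x. a h \<bullet> x \<le> b h}" by (simp add: inner_add_right)
    then show "x + t *\<^sub>R d \<in> h" using ab[OF h] by blast
  qed
  then show False using bounded_ray_imp_zero[OF bd] d by blast
qed

definition general_position :: "(real^'n) set set \<Rightarrow> bool" where
  "general_position H \<longleftrightarrow> (\<forall>K\<subseteq>H. card K = CARD('n) + 1 \<longrightarrow> \<Inter>(frontier ` K) = {})"

lemma general_position_subset: "general_position H \<Longrightarrow> K \<subseteq> H \<Longrightarrow> general_position K"
  unfolding general_position_def by blast

text \<open>Irredundancy can be achieved afterwards: a smallest subfamily with the same intersection
  is irredundant and stays in general position. Hence the stages of the truncation may be presented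
  by redundant families.\<close>

lemma simple_polytopeI:
  fixes H :: "(real^'n) set set"
  assumes fin: "finite H" and hs: "\<forall>h\<in>H. closed_halfspace h" and gp: "general_position H"
    and ne: "\<Inter>H \<noteq> {}" and bd: "bounded (\<Inter>H)"
  shows "simple_polytope (\<Inter>H)"
proof -
  define P where "P K \<longleftrightarrow> K \<subseteq> H \<and> \<Inter>K = \<Inter>H" for K
  have "P H" by (simp add: P_def)
  then obtain K where K: "P K" "\<And>L. P L \<Longrightarrow> card K \<le> card L"
    using ex_has_least_nat[of P H card] by blast
  have finK: "finite K" using K(1) fin finite_subset unfolding P_def by blast
  have "\<Inter>(K - {h}) \<noteq> \<Inter>H" if "h \<in> K" for h
  proof
    assume "\<Inter>(K - {h}) = \<Inter>H"
    then have "P (K - {h})" using K(1) unfolding P_def by blast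
    then show False using K(2)[of "K - {h}"] that finK card_Diff1_less[OF finK that] by simp
  qed
  moreover have "card K > CARD('n)"
    using K(1) hs ne bd by (intro card_closed_halfspaces_gt[OF finK]) (auto simp: P_def)
  moreover have "general_position K"
    using gp K(1) general_position_subset unfolding P_def by blast
  ultimately show ?thesis
    unfolding simple_polytope_def using K(1) finK hs ne bd
    by (intro exI[of _ K]) (auto simp: P_def general_position_def)
qed

text \<open>If two common points differed by \<open>d\<close>, a further hyperplane transverse to
  \<open>d\<close> would meet their line and give n + 1 concurrent hyperplanes. So all normals are
  orthogonal to \<open>d\<close>, and the bounded intersection would contain a line.\<close>

lemma general_position_unique_point:
  fixes H :: "(real^'n) set set"
  assumes hs: "\<forall>h\<in>H. closed_halfspace h" and gp: "general_position H" and fin: "finite H"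
    and ne: "\<Inter>H \<noteq> {}" and bd: "bounded (\<Inter>H)"
    and K: "K \<subseteq> H" "card K = CARD('n)"
    and x: "x \<in> \<Inter>(frontier ` K)" and y: "y \<in> \<Inter>(frontier ` K)"
  shows "x = y"
proof -
  obtain a b where ab: "\<And>h. h \<in> H \<Longrightarrow> a h \<noteq> 0 \<and> h = {x. a h \<bullet> x \<le> b h}"
    using closed_halfspaces_choose[OF hs] by metis
  have fr: "frontier h = {x. a h \<bullet> x = b h}" if "h \<in> H" for h
    using ab[OF that] frontier_halfspace_le[of "a h" "b h"] by metis
  define d where "d = y - x"
  have K0: "a h \<bullet> x = b h \<and> a h \<bullet> d = 0" if "h \<in> K" for h
  proof -
    have "h \<in> H" using that K(1) by blast
    then have "x \<in> {x. a h \<bullet> x = b h}" "y \<in> {x. a h \<bullet> x = b h}"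
      using x y that fr[of h] by blast+
    then show ?thesis by (simp add: d_def inner_diff_right)
  qed
  have orth: "a h \<bullet> d = 0" if h: "h \<in> H" for h
  proof (rule ccontr)
    assume nz: "a h \<bullet> d \<noteq> 0"
    then have "h \<notin> K" using K0 by blast
    then have c: "card (insert h K) = CARD('n) + 1"
      using K fin by (simp add: finite_subset)
    define z where "z = x + ((b h - a h \<bullet> x) / (a h \<bullet> d)) *\<^sub>R d"
    have "z \<in> frontier g" if "g \<in> insert h K" for g
    proof (cases "g = h")
      case True
      then show ?thesis using fr[OF h] nz by (simp add: z_def inner_add_right)
    next
      case False
      then have "g \<in> K" using that by blast
      then have "g \<in> H" "z \<in> {x. a g \<bullet> x = b g}"
        using K(1) K0[of g] by (auto simp: z_def inner_add_right)
      then show ?thesis using fr[of g] by blast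
    qed
    then have "\<Inter>(frontier ` insert h K) \<noteq> {}" by blast
    then show False using gp c h K(1) unfolding general_position_def by (metis insert_subset)
  qed
  obtain p where p: "p \<in> \<Inter>H" using ne by blast
  have "p + t *\<^sub>R d \<in> \<Inter>H" for t
  proof
    fix h assume h: "h \<in> H"
    then have "a h \<bullet> p \<le> b h" using p ab by blast
    then have "p + t *\<^sub>R d \<in> {x. a h \<bullet> x \<le> b h}" using orth[OF h] by (simp add: inner_add_right)
    then show "p + t *\<^sub>R d \<in> h" using ab[OF h] by blast
  qed
  then have "d = 0" using bounded_ray_imp_zero[OF bd] by blast
  then show ?thesis by (simp add: d_def)
qed

text \<open>Each n-subset of \<open>H\<close> has at most one common point, so a new hyperplane with
  fixed normal is bad only when it passes through one of finitely many points.\<close>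

lemma general_position_insert_generic:
  fixes H :: "(real^'n) set set"
  assumes hs: "\<forall>h\<in>H. closed_halfspace h" and gp: "general_position H" and fin: "finite H"
    and ne: "\<Inter>H \<noteq> {}" and bd: "bounded (\<Inter>H)" and c: "c \<noteq> 0"
  shows "finite {b. \<not> general_position (insert {x. c \<bullet> x \<le> b} H)}"
proof -
  define \<K> where "\<K> = {K. K \<subseteq> H \<and> card K = CARD('n)}"
  have "finite (\<Inter>(frontier ` K))" if "K \<in> \<K>" for K
  proof -
    have K: "K \<subseteq> H" "card K = CARD('n)" using that by (auto simp: \<K>_def)
    have "\<Inter>(frontier ` K) \<subseteq> {p}" if "p \<in> \<Inter>(frontier ` K)" for p
      using general_position_unique_point[OF hs gp fin ne bd K that] by blast
    then show ?thesis by (metis finite.emptyI finite_insert finite_subset subset_emptyI)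
  qed
  moreover have "finite \<K>" unfolding \<K>_def using fin by simp
  ultimately have "finite ((\<lambda>x. c \<bullet> x) ` (\<Union>K\<in>\<K>. \<Inter>(frontier ` K)))" by blast
  moreover have "{b. \<not> general_position (insert {x. c \<bullet> x \<le> b} H)}
      \<subseteq> (\<lambda>x. c \<bullet> x) ` (\<Union>K\<in>\<K>. \<Inter>(frontier ` K))"
  proof
    fix b assume "b \<in> {b. \<not> general_position (insert {x. c \<bullet> x \<le> b} H)}"
    then obtain K x where K: "K \<subseteq> insert {x. c \<bullet> x \<le> b} H" "card K = CARD('n) + 1"
        and x: "x \<in> \<Inter>(frontier ` K)"
      unfolding general_position_def by blast
    let ?h = "{x. c \<bullet> x \<le> b}"
    have "?h \<in> K"
    proof (rule ccontr)
      assume "?h \<notin> K"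
      then have "K \<subseteq> H" using K by blast
      then show False using gp K x unfolding general_position_def by blast
    qed
    moreover have "finite K" using K fin finite_subset by blast
    ultimately have "K - {?h} \<in> \<K>" using K unfolding \<K>_def by auto
    moreover have "x \<in> frontier ?h" using x \<open>?h \<in> K\<close> by blast
    then have "c \<bullet> x = b" using frontier_halfspace_le[OF disjI1[OF c], of b] by simp
    ultimately show "b \<in> (\<lambda>x. c \<bullet> x) ` (\<Union>K\<in>\<K>. \<Inter>(frontier ` K))" using x by blast
  qed
  ultimately show ?thesis by (rule finite_subset[rotated])
qed

subsection \<open>Coordinates on the cylinder\<close>

text \<open>The vectors (x, t) for which x - t a is a direction of \<open>A\<close> form a subspace
  that contains A x {1} and whose slice at height 1 is \<open>A\<close> itself.\<close>

lemma mem_span_times_one_iff: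
  fixes A :: "'a::real_vector set"
  assumes "affine A"
  shows "(x, 1::real) \<in> span (A \<times> {1}) \<longleftrightarrow> x \<in> A"
proof
  assume x: "(x, 1::real) \<in> span (A \<times> {1})"
  show "x \<in> A"
  proof (cases "A = {}")
    case True
    then show ?thesis using x by (simp add: zero_prod_def)
  next
    case False
    then obtain a where a: "a \<in> A" by blast
    define W where "W = (\<lambda>y. y - a) ` A"
    have W: "subspace W" unfolding W_def using affine_diffs_subspace_subtract[OF assms a] by simp
    define X where "X = {(x, t) | x t. x - t *\<^sub>R a \<in> W}"
    have "subspace X"
    proof (rule subspaceI)
      show "0 \<in> X" using subspace_0[OF W] by (simp add: X_def zero_prod_def)
      fix p q c assume "p \<in> X" "q \<in> X"
      then obtain x t y s where p: "p = (x, t)" "x - t *\<^sub>R a \<in> W" and q: "q = (y, s)" "y - s *\<^sub>R a \<in> W"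
        unfolding X_def by blast
      have "(x - t *\<^sub>R a) + (y - s *\<^sub>R a) \<in> W" using subspace_add[OF W] p q by blast
      then show "p + q \<in> X" using p q by (simp add: X_def algebra_simps)
      have "c *\<^sub>R (x - t *\<^sub>R a) \<in> W" for c using subspace_scale[OF W] p by blast
      then show "c *\<^sub>R p \<in> X" for c using p by (simp add: X_def algebra_simps)
    qed
    moreover have "A \<times> {1} \<subseteq> X" unfolding X_def W_def by auto
    ultimately have "(x, 1) \<in> X" using x span_minimal by blast
    then show ?thesis unfolding X_def W_def by auto
  qed
qed (simp add: span_base)

text \<open>A zero \<open>a\<close> at height 1 excludes the hyperplane at infinity, and adding
  multiples of (a, 1) brings every vector of the kernel to height 1.\<close>

lemma span_hyperplane_times_one:
  fixes g :: "'a::real_vector \<times> real \<Rightarrow> real"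
  assumes g: "linear g" and a: "g (a, 1) = 0"
  shows "span ({x. g (x, 1) = 0} \<times> {1}) = {Z. g Z = 0}"
proof (intro equalityI subsetI)
  fix Z :: "'a \<times> real" assume "Z \<in> span ({x. g (x, 1) = 0} \<times> {1})"
  moreover have "subspace {Z. g Z = 0}" using linear_subspace_kernel[OF g] .
  ultimately show "Z \<in> {Z. g Z = 0}"
    using span_minimal[of "{x. g (x, 1) = 0} \<times> {1}" "{Z. g Z = 0}"] by auto
next
  fix Z :: "'a \<times> real" assume Z: "Z \<in> {Z. g Z = 0}"
  let ?p = "((1::real) - snd Z) *\<^sub>R (a, 1::real)"
  have sum1: "Z + ?p = (fst Z + (1 - snd Z) *\<^sub>R a, 1)"
    by (cases Z) simp
  have "g (Z + ?p) = 0" using Z a by (simp only: linear_add[OF g] linear_scale[OF g]) simp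
  then have "Z + ?p \<in> span ({x. g (x, 1) = 0} \<times> {1})"
    unfolding sum1 by (intro span_base) simp
  moreover have "?p \<in> span ({x. g (x, 1) = 0} \<times> {1})"
    using a by (intro span_scale span_base) simp
  ultimately show "Z \<in> span ({x. g (x, 1) = 0} \<times> {1})"
    using span_diff by fastforce
qed

lemma convex_hull_image_inj:
  fixes p :: "'i \<Rightarrow> 'a::real_vector"
  assumes "finite R" "inj_on p R"
  shows "convex hull (p ` R)
      = {\<Sum>r\<in>R. b r *\<^sub>R p r | b. (\<forall>r\<in>R. 0 \<le> b r) \<and> sum b R = (1::real)}"
proof (intro equalityI subsetI)
  fix x assume "x \<in> convex hull (p ` R)"
  then obtain u where u: "\<forall>y\<in>p ` R. 0 \<le> u y" "sum u (p ` R) = 1" "(\<Sum>y\<in>p ` R. u y *\<^sub>R y) = x"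
    using assms(1) by (auto simp: convex_hull_finite)
  then show "x \<in> {\<Sum>r\<in>R. b r *\<^sub>R p r | b. (\<forall>r\<in>R. 0 \<le> b r) \<and> sum b R = 1}"
    using assms(2) by (auto simp: sum.reindex intro!: exI[of _ "u \<circ> p"])
next
  fix x assume "x \<in> {\<Sum>r\<in>R. b r *\<^sub>R p r | b. (\<forall>r\<in>R. 0 \<le> b r) \<and> sum b R = 1}"
  then obtain b where b: "x = (\<Sum>r\<in>R. b r *\<^sub>R p r)" "\<forall>r\<in>R. 0 \<le> b r" "sum b R = 1" by blast
  show "x \<in> convex hull (p ` R)"
    unfolding b(1) using assms(1) b by (intro convex_sum) (auto intro: hull_inc)
qed

text \<open>Each facet omits one vertex, so the indexing of the facets indexes the opposite
  vertices; a count shows that all vertices are reached.\<close>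

lemma simplex_facet_enumeration:
  fixes S :: "(real^'n) set"
  assumes n2: "CARD('n) \<ge> 2" and S: "(int CARD('n) - 1) simplex S"
    and D: "bij_betw D UNIV {G. G facet_of S}"
  obtains p :: "'n \<Rightarrow> real^'n" where "inj p" "\<not> affine_dependent (range p)"
    "S = convex hull (range p)" "\<And>r. D r = convex hull (p ` (- {r}))"
proof -
  obtain C where C: "\<not> affine_dependent C" "int (card C) = int CARD('n)" "S = convex hull C"
    using S unfolding simplex_def by auto
  have finC: "finite C" using C n2 by (metis card.infinite not_numeral_le_zero of_nat_eq_iff)
  have "\<exists>u\<in>C. D r = convex hull (C - {u})" for r
  proof -
    have "D r facet_of convex hull C" using D C(3) bij_betwE by blast
    then show ?thesis using facet_of_convex_hull_affine_independent[OF C(1)] by blast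
  qed
  then obtain p where p: "\<And>r. p r \<in> C" "\<And>r. D r = convex hull (C - {p r})" by metis
  have injp: "inj p"
    using D p(2) unfolding bij_betw_def inj_on_def by metis
  then have ran: "range p = C"
    using p(1) C(2) finC by (intro card_subset_eq) (auto simp: card_image)
  have "C - {p r} = p ` (- {r})" for r
    using ran injp by (auto simp: inj_def)
  then show thesis using that[of p] injp ran C p(2) by simp
qed

text \<open>\<open>\<beta>\<close> are the homogeneous barycentric coordinates of the projection
  along the axis to the simplex \<open>S\<close>. The later arguments refer to the cylinder only
  through these properties.\<close>

locale cylinder_frame =
  fixes i :: "'n::finite" and S :: "(real^'n) set" and D :: "'n \<Rightarrow> (real^'n) set"
    and \<beta> :: "'n \<Rightarrow> (real^'n) \<times> real \<Rightarrow> real"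
  assumes n2: "CARD('n) \<ge> 2" and lin\<beta>: "\<And>r. linear (\<beta> r)" and sum\<beta>: "\<And>Z. (\<Sum>r\<in>UNIV. \<beta> r Z) = snd Z"
    and axis\<beta>: "\<And>r. \<beta> r (axis i 1, 0) = 0"
    and cyl\<beta>: "cylinder i S = {z. \<forall>r. 0 \<le> \<beta> r (z, 1)}"
    and hull\<beta>: "\<And>r. affine hull (cylinder i (D r)) = {z. \<beta> r (z, 1) = 0}"
    and inj\<beta>: "\<And>Z. (\<And>r. \<beta> r Z = 0) \<Longrightarrow> fst Z $ i = 0 \<Longrightarrow> Z = 0"

lemma cylinder_frame_exists:
  fixes S :: "(real^'n) set"
  assumes n2: "CARD('n) \<ge> 2" and S: "(int CARD('n) - 1) simplex S" and S0: "S \<subseteq> {x. x $ i = 0}"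
    and D: "bij_betw D UNIV {G. G facet_of S}"
  shows "\<exists>\<beta>. cylinder_frame i S D \<beta>"
proof -
  obtain p where p: "inj p" "\<not> affine_dependent (range p)" "S = convex hull (range p)"
    "\<And>r. D r = convex hull (p ` (- {r}))"
    using simplex_facet_enumeration[OF n2 S D] by metis
  have pi0: "p r $ i = 0" for r
    using S0 p(3) hull_inc[of "p r" "range p"] by auto
  \<comment> \<open>Sends barycentric coordinates and the axis position to homogeneous coordinates.
    Affine independence of the vertices makes it injective, and both sides have dimension n + 1, so
    its inverse yields \<open>\<beta>\<close>.\<close>
  define \<Phi> :: "(real^'n) \<times> real \<Rightarrow> (real^'n) \<times> real"
    where "\<Phi> = (\<lambda>(b, t). ((\<Sum>r\<in>UNIV. (b $ r) *\<^sub>R p r) + t *\<^sub>R axis i 1, \<Sum>r\<in>UNIV. b $ r))"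
  have lin: "linear \<Phi>"
    by (rule linearI)
      (auto simp: \<Phi>_def split_beta sum.distrib scaleR_add_left scaleR_add_right scaleR_sum_right sum_distrib_left algebra_simps)
  have \<Phi>i: "fst (\<Phi> (b, t)) $ i = t" for b t
    by (simp add: \<Phi>_def pi0)
  have "inj \<Phi>"
  proof (subst linear_injective_0[OF lin], intro allI impI)
    fix Z assume Z: "\<Phi> Z = 0"
    obtain b t where bt: "Z = (b, t)" by (cases Z)
    have t: "t = 0" using \<Phi>i[of b t] Z bt by simp
    then have s: "(\<Sum>r\<in>UNIV. (b $ r) *\<^sub>R p r) = 0" "(\<Sum>r\<in>UNIV. b $ r) = 0"
      using Z bt by (auto simp: \<Phi>_def zero_prod_def)
    define u where "u v = b $ (inv p v)" for v
    have up: "u (p r) = b $ r" for r using p(1) by (simp add: u_def)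
    have "sum u (range p) = 0" "(\<Sum>v\<in>range p. u v *\<^sub>R v) = 0"
      using s by (simp_all add: sum.reindex[OF p(1)] up)
    then have "\<forall>v\<in>range p. u v = 0"
      using p(2) affine_dependent_explicit_finite[of "range p"] by auto
    then have "b = 0" using up by (simp add: vec_eq_iff)
    then show "Z = 0" using bt t by (simp add: zero_prod_def)
  qed
  define G where "G = inv \<Phi>"
  have linG: "linear G" unfolding G_def by (rule inj_linear_imp_inv_linear) fact+
  have G\<Phi>: "G (\<Phi> Z) = Z" for Z unfolding G_def using \<open>inj \<Phi>\<close> by simp
  have \<Phi>G: "\<Phi> (G Z) = Z" for Z unfolding G_def
    using linear_injective_imp_surjective[OF lin \<open>inj \<Phi>\<close>] by (simp add: surj_f_inv_f)
  define \<beta> where "\<beta> r Z = fst (G Z) $ r" for r Z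
  have ez: "\<exists>t. (z, 1) = \<Phi> (b, t)" if "b = fst (G (z, 1))" for z b
    using \<Phi>G[of "(z, 1)"] that by (metis prod.collapse)
  have \<beta>\<Phi>: "\<beta> r (\<Phi> (b, t)) = b $ r" for r b t by (simp add: \<beta>_def G\<Phi>)
  have sum\<beta>: "(\<Sum>r\<in>UNIV. \<beta> r Z) = snd Z" for Z
    using \<Phi>G[of Z] unfolding \<beta>_def \<Phi>_def by (auto simp: split_beta dest: arg_cong[of _ _ snd])
  have hull: "convex hull (p ` R)
      = {\<Sum>r\<in>R. b r *\<^sub>R p r | b. (\<forall>r\<in>R. 0 \<le> b r) \<and> sum b R = 1}" for R
    using p(1) by (intro convex_hull_image_inj) (auto intro: inj_on_subset)
  have cyl: "cylinder i (convex hull (p ` R)) = {z. (\<forall>r\<in>R. 0 \<le> \<beta> r (z, 1)) \<and> (\<forall>r\<in>-R. \<beta> r (z, 1) = 0)}" for R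
  proof (intro equalityI subsetI)
    fix z assume "z \<in> cylinder i (convex hull (p ` R))"
    then obtain b t where b: "z = (\<Sum>r\<in>R. b r *\<^sub>R p r) + t *\<^sub>R axis i 1" "\<forall>r\<in>R. 0 \<le> b r" "sum b R = 1"
      unfolding cylinder_def hull by blast
    define c where "c = (\<chi> r. if r \<in> R then b r else 0)"
    have "(z, 1) = \<Phi> (c, t)"
      using b by (simp add: \<Phi>_def c_def if_distrib[of "\<lambda>a. a *\<^sub>R _"] sum.If_cases cong: if_cong)
    then have "\<beta> r (z, 1) = c $ r" for r by (simp add: \<beta>\<Phi>)
    then show "z \<in> {z. (\<forall>r\<in>R. 0 \<le> \<beta> r (z, 1)) \<and> (\<forall>r\<in>-R. \<beta> r (z, 1) = 0)}"
      using b by (simp add: c_def)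
  next
    fix z assume z: "z \<in> {z. (\<forall>r\<in>R. 0 \<le> \<beta> r (z, 1)) \<and> (\<forall>r\<in>-R. \<beta> r (z, 1) = 0)}"
    define b where "b = fst (G (z, 1))"
    obtain t where t: "(z, 1) = \<Phi> (b, t)" using ez b_def by blast
    have b0: "b $ r = 0" if "r \<notin> R" for r using z that by (simp add: b_def \<beta>_def)
    have "z = (\<Sum>r\<in>UNIV. (b $ r) *\<^sub>R p r) + t *\<^sub>R axis i 1" "(\<Sum>r\<in>UNIV. b $ r) = 1"
      using t by (auto simp: \<Phi>_def)
    moreover have "(\<Sum>r\<in>UNIV. (b $ r) *\<^sub>R p r) = (\<Sum>r\<in>R. (b $ r) *\<^sub>R p r)"
      "(\<Sum>r\<in>UNIV. b $ r) = (\<Sum>r\<in>R. b $ r)"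
      using b0 by (auto intro!: sum.mono_neutral_right)
    moreover have "\<forall>r\<in>R. 0 \<le> b $ r" using z by (simp add: b_def \<beta>_def)
    ultimately show "z \<in> cylinder i (convex hull (p ` R))"
      unfolding cylinder_def hull by auto
  qed
  have affcyl: "affine hull (cylinder i (D r)) = {z. \<beta> r (z, 1) = 0}" for r
  proof (rule hull_unique)
    show "cylinder i (D r) \<subseteq> {z. \<beta> r (z, 1) = 0}"
      unfolding p(4) cyl by auto
    have comb: "\<beta> r (u *\<^sub>R x + v *\<^sub>R y, 1) = u * \<beta> r (x, 1) + v * \<beta> r (y, 1)" if "u + v = 1" for u v x y
    proof -
      have "(u *\<^sub>R x + v *\<^sub>R y, 1::real) = u *\<^sub>R (x, 1) + v *\<^sub>R (y, 1::real)"
        using that by (simp add: real_scaleR_def)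
      then have "G (u *\<^sub>R x + v *\<^sub>R y, 1) = u *\<^sub>R G (x, 1) + v *\<^sub>R G (y, 1)"
        by (simp only: linear_add[OF linG] linear_scale[OF linG])
      then show ?thesis by (simp add: \<beta>_def)
    qed
    show "affine {z. \<beta> r (z, 1) = 0}"
      unfolding affine_def by (auto simp: comb)
    fix A assume A: "cylinder i (D r) \<subseteq> A" "affine A"
    show "{z. \<beta> r (z, 1) = 0} \<subseteq> A"
    proof
      fix z assume z: "z \<in> {z. \<beta> r (z, 1) = 0}"
      define b where "b = fst (G (z, 1))"
      obtain t where t: "(z, 1) = \<Phi> (b, t)" using ez b_def by blast
      have br: "b $ r = 0" using z by (simp add: b_def \<beta>_def)
      \<comment> \<open>The vertices of the facet are lifted to the axis position \<open>t\<close>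
        of \<open>z\<close>; then \<open>z\<close> is an affine combination of them.\<close>
      define q where "q s = p s + t *\<^sub>R axis i 1" for s
      have injq: "inj_on q (- {r})" using p(1) by (auto simp: q_def inj_def inj_on_def)
      have "q s \<in> cylinder i (D r)" if "s \<noteq> r" for s
        unfolding cylinder_def p(4) q_def using that hull_inc[of "p s" "p ` (- {r})"] by blast
      then have sub: "q ` (- {r}) \<subseteq> A" using A by blast
      have zs: "z = (\<Sum>s\<in>UNIV. (b $ s) *\<^sub>R p s) + t *\<^sub>R axis i 1" and b1: "(\<Sum>s\<in>UNIV. b $ s) = 1"
        using t by (auto simp: \<Phi>_def)
      have "z = (\<Sum>s\<in>UNIV. (b $ s) *\<^sub>R q s)"
        using zs b1 by (simp add: q_def scaleR_add_right sum.distrib scaleR_left.sum[symmetric] sum_distrib_right[symmetric])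
      also have "\<dots> = (\<Sum>s\<in>-{r}. (b $ s) *\<^sub>R q s)"
        using br by (intro sum.mono_neutral_right) auto
      also have "\<dots> = (\<Sum>v\<in>q ` (- {r}). (b $ (inv_into (- {r}) q v)) *\<^sub>R v)"
        using injq by (simp add: sum.reindex)
      finally have z2: "z = (\<Sum>v\<in>q ` (- {r}). (b $ (inv_into (- {r}) q v)) *\<^sub>R v)" .
      have "(\<Sum>v\<in>q ` (- {r}). b $ (inv_into (- {r}) q v)) = (\<Sum>s\<in>-{r}. b $ s)"
        using injq by (simp add: sum.reindex)
      also have "\<dots> = 1" using b1 br by (subst b1[symmetric], intro sum.mono_neutral_left) auto
      finally have s1: "(\<Sum>v\<in>q ` (- {r}). b $ (inv_into (- {r}) q v)) = 1" .
      then have "q ` (- {r}) \<noteq> {}" by force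
      then show "z \<in> A"
        unfolding z2 using A(2)[unfolded affine, rule_format,
          of "q ` (- {r})" "\<lambda>v. b $ (inv_into (- {r}) q v)"] sub s1 by simp
    qed
  qed
  have "cylinder_frame i S D \<beta>"
  proof (rule cylinder_frame.intro[OF n2])
    show "linear (\<beta> r)" for r
      unfolding \<beta>_def by (rule linearI) (simp_all add: linear_add[OF linG] linear_scale[OF linG])
    have "\<Phi> (0, 1) = (axis i 1, 0)" by (simp add: \<Phi>_def)
    then show "\<beta> r (axis i 1, 0) = 0" for r using \<beta>\<Phi>[of r 0 1] by simp
    show "cylinder i S = {z. \<forall>r. 0 \<le> \<beta> r (z, 1)}" using cyl[of UNIV] p(3) by simp
    fix Z assume Z: "\<And>r. \<beta> r Z = 0" "fst Z $ i = 0"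
    have "fst (G Z) = 0" using Z(1) by (simp add: \<beta>_def vec_eq_iff)
    moreover have "snd (G Z) = 0" using Z(2) \<Phi>i[of "fst (G Z)" "snd (G Z)"] \<Phi>G[of Z] by simp
    ultimately have "G Z = 0" by (simp add: prod_eq_iff)
    then show "Z = 0" using \<Phi>G[of Z] linear_0[OF lin] by simp
  qed (use sum\<beta> affcyl in auto)
  then show ?thesis by blast
qed

subsection \<open>Polar embeddings\<close>

lemma affine_form_homogeneous:
  fixes g :: "'a::euclidean_space \<times> real \<Rightarrow> real"
  assumes "linear g"
  shows "affine_form (\<lambda>x. g (x, 1))"
  unfolding affine_form_def
proof (intro exI allI)
  fix x :: 'a
  have "g (x, 1) = (x, 1) \<bullet> adjoint g 1"
    using adjoint_works[OF assms, of "(x, 1)" 1] by simp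
  then show "g (x, 1) = fst (adjoint g 1) \<bullet> x + snd (adjoint g 1)"
    by (simp add: inner_prod_def inner_commute)
qed

context cylinder_frame
begin

lemma \<beta>_eq_0_iff: "(\<forall>r. \<beta> r Z = 0) \<longleftrightarrow> Z = (fst Z $ i) *\<^sub>R (axis i 1, 0)"
proof
  assume Z: "\<forall>r. \<beta> r Z = 0"
  have "Z - (fst Z $ i) *\<^sub>R (axis i 1, 0) = 0"
  proof (rule inj\<beta>)
    show "\<beta> r (Z - (fst Z $ i) *\<^sub>R (axis i 1, 0)) = 0" for r
      using Z axis\<beta>[of r] by (simp only: linear_diff[OF lin\<beta>] linear_scale[OF lin\<beta>]) simp
    show "fst (Z - (fst Z $ i) *\<^sub>R (axis i 1, 0)) $ i = 0" by simp
  qed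
  then show "Z = (fst Z $ i) *\<^sub>R (axis i 1, 0)" by simp
next
  assume "Z = (fst Z $ i) *\<^sub>R (axis i 1, 0)"
  then show "\<forall>r. \<beta> r Z = 0" using axis\<beta> linear_scale[OF lin\<beta>] by (metis scaleR_zero_right)
qed

lemma \<beta>_shift: "\<beta> r (z + t *\<^sub>R axis i 1, u) = \<beta> r (z, u)"
proof -
  have "(z + t *\<^sub>R axis i 1, u) = (z, u) + t *\<^sub>R (axis i 1, 0)" by simp
  then show ?thesis using axis\<beta>[of r]
    by (simp only: linear_add[OF lin\<beta>] linear_scale[OF lin\<beta>]) simp
qed

end

locale polar = cylinder_frame i S D \<beta>
  for i :: "'n::finite" and S :: "(real^'n) set" and D :: "'n \<Rightarrow> (real^'n) set"
    and \<beta> :: "'n \<Rightarrow> (real^'n) \<times> real \<Rightarrow> real" +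
  fixes s :: real and P :: "(real^'n) set" and v :: "real^'n" and E :: "'n \<Rightarrow> (real^'n) set"
    and T :: "(real^'n) \<times> real \<Rightarrow> (real^'n) \<times> real"
  assumes s1: "s = 1 \<or> s = -1" and emb: "polar_embedding s i S D P v E T"
begin

lemma linT: "linear T" and bijT: "bij T"
  using emb unfolding polar_embedding_def by blast+

lemma pole: obtains c where "c > 0" "T (v, 1) = (c * s) *\<^sub>R (axis i 1, 0)"
  using emb unfolding polar_embedding_def by (auto simp: scaleR_prod_def)

text \<open>\<open>y r\<close> is the numerator of a barycentric coordinate of the image point, and
  \<sigma> is the common denominator. That \<sigma> is also the sum of the \<open>y r\<close>
  reflects that barycentric coordinates add up to 1.\<close>

definition y :: "'n \<Rightarrow> real^'n \<Rightarrow> real" where "y r x = \<beta> r (T (x, 1))"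

definition \<sigma> :: "real^'n \<Rightarrow> real" where "\<sigma> x = snd (T (x, 1))"

lemma lin_\<beta>T: "linear (\<lambda>Z. \<beta> r (T Z))"
  using linear_compose[OF linT lin\<beta>] by (simp add: o_def)

lemma sum_y: "(\<Sum>r\<in>UNIV. y r x) = \<sigma> x"
  unfolding y_def \<sigma>_def by (rule sum\<beta>)

lemma y_pole: "y r v = 0"
proof -
  obtain c where "T (v, 1) = (c * s) *\<^sub>R (axis i 1, 0)" using pole by metis
  then show ?thesis unfolding y_def using axis\<beta>[of r] by (simp only: linear_scale[OF lin\<beta>]) simp
qed

lemma \<sigma>_pos: "x \<in> P \<Longrightarrow> x \<noteq> v \<Longrightarrow> \<sigma> x > 0"
  using emb unfolding polar_embedding_def \<sigma>_def by blast

lemma \<sigma>_pole: "\<sigma> v = 0"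
  using sum_y[of v] by (simp add: y_pole)

lemma T_proj: "\<sigma> x \<noteq> 0 \<Longrightarrow> T (x, 1) = \<sigma> x *\<^sub>R (proj_map T x, 1)"
  unfolding \<sigma>_def proj_map_def by (simp add: prod_eq_iff)

lemma \<beta>_proj: "\<sigma> x \<noteq> 0 \<Longrightarrow> y r x = \<sigma> x * \<beta> r (proj_map T x, 1)"
  using linear_scale[OF lin\<beta>, of r "\<sigma> x" "(proj_map T x, 1)"] T_proj[of x] unfolding y_def by simp

lemma y_nonneg: "x \<in> P \<Longrightarrow> 0 \<le> y r x"
proof (cases "x = v")
  case False
  assume x: "x \<in> P"
  then have "proj_map T x \<in> cylinder i S"
    using emb False unfolding polar_embedding_def by blast
  then have "0 \<le> \<beta> r (proj_map T x, 1)" using cyl\<beta> by blast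
  then show ?thesis using \<beta>_proj[of x r] \<sigma>_pos[OF x False] by simp
qed (simp add: y_pole)

lemma affine_form_y: "affine_form (y r)"
  unfolding y_def[abs_def] by (rule affine_form_homogeneous[OF lin_\<beta>T])

lemma y_shift: "y r (v + d) = \<beta> r (T (d, 0))"
proof -
  have "(v + d, 1) = (v, 1) + (d, 0::real)" by simp
  then show ?thesis using y_pole[of r] unfolding y_def
    by (simp only: linear_add[OF lin_\<beta>T] add_0)
qed

text \<open>A vector on which all \<open>\<beta>\<close> vanish is a multiple of the pole, hence of
  \<open>T (v, 1)\<close>. By injectivity of \<open>T\<close>, (d, 0) is a multiple of (v, 1), and
  comparing last entries shows that it is zero.\<close>

lemma coordinates_inj:
  assumes "\<And>r. \<beta> r (T (d, 0)) = 0"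
  shows "d = 0"
proof -
  obtain c where c: "c > 0" "T (v, 1) = (c * s) *\<^sub>R (axis i 1, 0)" using pole by metis
  define \<tau> where "\<tau> = fst (T (d, 0)) $ i"
  have "T (d, 0) = \<tau> *\<^sub>R (axis i 1, 0)" using assms \<beta>_eq_0_iff unfolding \<tau>_def by blast
  also have "\<dots> = (\<tau> / (c * s)) *\<^sub>R T (v, 1)" using c s1 by auto
  also have "\<dots> = T ((\<tau> / (c * s)) *\<^sub>R (v, 1))" by (simp only: linear_scale[OF linT])
  finally have eq: "(d, 0) = (\<tau> / (c * s)) *\<^sub>R (v, 1::real)" using bijT by (simp add: bij_def inj_eq)
  then have "\<tau> / (c * s) = 0" by simp
  then show "d = 0" using eq by simp
qed

text \<open>From here on, points are constructed by prescribing their coordinates \<open>y\<close>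
  freely.\<close>

lemma coordinates_surj: "\<exists>x. \<forall>r. y r x = \<eta> r"
proof -
  define L where "L d = (\<chi> r. \<beta> r (T (d, 0)))" for d
  have "linear L"
  proof (rule linearI)
    fix a b :: "real^'n" and c :: real
    have "(a + b, 0::real) = (a, 0) + (b, 0)" by simp
    then show "L (a + b) = L a + L b"
      by (simp only: L_def vec_eq_iff linear_add[OF lin_\<beta>T]) simp
    have "(c *\<^sub>R a, 0::real) = c *\<^sub>R (a, 0)" by simp
    then show "L (c *\<^sub>R a) = c *\<^sub>R L a"
      by (simp only: L_def vec_eq_iff linear_scale[OF lin_\<beta>T]) simp
  qed
  moreover have "inj L"
    unfolding linear_injective_0[OF \<open>linear L\<close>]
  proof (intro allI impI)
    fix d assume "L d = 0"
    then show "d = 0" by (intro coordinates_inj) (simp add: L_def vec_eq_iff)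
  qed
  ultimately have "surj L" by (rule linear_injective_imp_surjective) simp
  then obtain d where "L d = (\<chi> r. \<eta> r)" by (metis surjD)
  then have "\<beta> r (T (d, 0)) = \<eta> r" for r by (simp add: L_def vec_eq_iff)
  then show ?thesis using y_shift by metis
qed

lemma coordinates_eqI: "(\<And>r. y r x = y r x') \<Longrightarrow> x = x'"
proof -
  assume eq: "\<And>r. y r x = y r x'"
  have "\<beta> r (T (x - x', 0)) = 0" for r
  proof -
    have "(x - x', 0) = (x, 1) - (x', 1::real)" by simp
    then show ?thesis using eq[of r] unfolding y_def
      by (simp only: linear_diff[OF lin_\<beta>T] diff_self)
  qed
  then show ?thesis using coordinates_inj[of "x - x'"] by simp
qed

text \<open>\<open>proj_flat\<close> shows only the finite points of the image, so the equality is
  first lifted to homogeneous coordinates. This takes a finite point \<open>a\<close> on the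
  hyperplane, found by giving weight to a coordinate other than \<open>r\<close>, which exists
  because n \<ge> 2.\<close>

lemma hyperplane_facet: "affine hull (E r) = {x. y r x = 0}"
proof -
  let ?A = "affine hull (E r)" and ?W = "span ((affine hull (E r)) \<times> {1::real})"
  have flat: "{z. (z, 1) \<in> T ` ?W} = {z. \<beta> r (z, 1) = 0}"
    using emb hull\<beta>[of r] unfolding polar_embedding_def proj_flat_def by simp
  obtain q where q: "q \<noteq> r"
  proof -
    have "\<exists>q. q \<noteq> r"
    proof (rule ccontr)
      assume "\<not> (\<exists>q. q \<noteq> r)"
      then have "(UNIV :: 'n set) = {r}" by blast
      then have "CARD('n) = card {r}" by (simp only:)
      then show False using n2 by simp
    qed
    then show thesis using that by blast
  qed
  obtain x0 where x0: "\<forall>p. y p x0 = (if p = q then 1 else 0)"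
    using coordinates_surj[of "\<lambda>p. if p = q then 1 else 0"] by blast
  have "\<sigma> x0 = 1" using x0 sum_y[of x0] by simp
  then have a0: "\<beta> r (proj_map T x0, 1) = 0"
    using \<beta>_proj[of x0 r] x0 q by simp
  define a where "a = proj_map T x0"
  note a0 = a0[folded a_def]
  have sub: "subspace (T ` ?W)" by (rule linear_subspace_image[OF linT subspace_span])
  have aW: "(a, 1) \<in> T ` ?W" using flat a0 by blast
  have img: "T ` ?W = {Z. \<beta> r Z = 0}"
  proof (intro equalityI)
    have "{Z. \<beta> r Z = 0} = span ({z. \<beta> r (z, 1) = 0} \<times> {1})"
      using span_hyperplane_times_one[OF lin\<beta> a0] by simp
    also have "\<dots> \<subseteq> T ` ?W" using flat sub by (intro span_minimal) auto
    finally show "{Z. \<beta> r Z = 0} \<subseteq> T ` ?W" .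
    show "T ` ?W \<subseteq> {Z. \<beta> r Z = 0}"
    proof
      fix Z assume Z: "Z \<in> T ` ?W"
      define Z' where "Z' = Z + (1 - snd Z) *\<^sub>R (a, 1)"
      have "Z' \<in> T ` ?W"
        unfolding Z'_def using sub aW Z by (intro subspace_add subspace_scale)
      moreover have "Z' = (fst Z', 1)" unfolding Z'_def by (simp add: prod_eq_iff)
      ultimately have "fst Z' \<in> {z. (z, 1) \<in> T ` ?W}" by simp
      then have "\<beta> r Z' = 0" using flat \<open>Z' = (fst Z', 1)\<close> by (metis (mono_tags) mem_Collect_eq)
      then show "Z \<in> {Z. \<beta> r Z = 0}"
        unfolding Z'_def using a0 by (simp only: linear_add[OF lin\<beta>] linear_scale[OF lin\<beta>]) simp
    qed
  qed
  show ?thesis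
  proof (intro set_eqI)
    fix x
    have "x \<in> ?A \<longleftrightarrow> (x, 1) \<in> ?W" using mem_span_times_one_iff[OF affine_affine_hull, of x] by simp
    also have "\<dots> \<longleftrightarrow> T (x, 1) \<in> T ` ?W" using bijT by (simp add: bij_def inj_image_mem_iff)
    also have "\<dots> \<longleftrightarrow> y r x = 0" unfolding img y_def by simp
    finally show "x \<in> ?A \<longleftrightarrow> x \<in> {x. y r x = 0}" by simp
  qed
qed

end

section \<open>The image of a polytope under its polar embedding\<close>

locale polar_polytope = polar i S D \<beta> s P v E T
  for i :: "'n::finite" and S :: "(real^'n) set" and D :: "'n \<Rightarrow> (real^'n) set"
    and \<beta> :: "'n \<Rightarrow> (real^'n) \<times> real \<Rightarrow> real" and s :: real
    and P :: "(real^'n) set" and v :: "real^'n" and E :: "'n \<Rightarrow> (real^'n) set"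
    and T :: "(real^'n) \<times> real \<Rightarrow> (real^'n) \<times> real" +
  fixes J :: "'c set" and m :: "'c \<Rightarrow> (real^'n) \<times> real \<Rightarrow> real"
  assumes linm: "\<And>c. c \<in> J \<Longrightarrow> linear (m c)"
    and vP: "v \<in> P" and bdP: "bounded P"
    and P_eq: "P = {x. (\<forall>r. 0 \<le> y r x) \<and> (\<forall>c\<in>J. 0 \<le> m c (x, 1))}"
    and m_pole: "\<And>c. c \<in> J \<Longrightarrow> 0 < m c (v, 1)"
    and m_facet: "\<And>c. c \<in> J \<Longrightarrow> \<exists>C. C facet_of P \<and> v \<notin> C \<and> affine hull C = {x. m c (x, 1) = 0}"
begin

definition T' :: "(real^'n) \<times> real \<Rightarrow> (real^'n) \<times> real" where "T' = inv T"

lemma linT': "linear T'"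
  unfolding T'_def using linT bijT by (intro inj_linear_imp_inv_linear) (auto simp: bij_def)

lemma T'_T: "T' (T Z) = Z" and T_T': "T (T' Z) = Z"
  unfolding T'_def using bijT by (auto simp: bij_def surj_f_inv_f)

definition slack :: "'c \<Rightarrow> real^'n \<Rightarrow> real" where "slack c z = m c (T' (z, 1))"

lemma lin_mT': "c \<in> J \<Longrightarrow> linear (\<lambda>Z. m c (T' Z))"
  using linear_compose[OF linT' linm] by (simp add: o_def)

lemma affine_form_slack: "c \<in> J \<Longrightarrow> affine_form (slack c)"
  unfolding slack_def[abs_def] by (intro affine_form_homogeneous lin_mT')

lemma m_proj:
  assumes "c \<in> J" "\<sigma> x \<noteq> 0"
  shows "m c (x, 1) = \<sigma> x * slack c (proj_map T x)"
proof -
  have "m c (x, 1) = m c (T' (\<sigma> x *\<^sub>R (proj_map T x, 1)))"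
    using T_proj[OF assms(2)] T'_T by metis
  then show ?thesis unfolding slack_def
    by (simp only: linear_scale[OF lin_mT'[OF assms(1)]]) simp
qed

lemma slack_sign:
  assumes c: "c \<in> J" and z: "z \<in> cylinder i S" "slack c z = 0"
  shows "s * z $ i < 0"
proof -
  obtain C where C: "C facet_of P" "v \<notin> C" "affine hull C = {x. m c (x, 1) = 0}"
    using m_facet[OF c] by blast
  obtain a where "a \<in> C" using C(1) unfolding facet_of_def by blast
  then have "m c (a, 1) = 0" using C(3) hull_inc[of a C affine] by blast
  then have "span ((affine hull C) \<times> {1}) = {Z. m c Z = 0}"
    using span_hyperplane_times_one[OF linm[OF c], of a] C(3) by simp
  then have "T' (z, 1) \<in> span ((affine hull C) \<times> {1})" using z(2) by (simp add: slack_def)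
  then have "z \<in> proj_flat T (affine hull C)"
    unfolding proj_flat_def using T_T' by (metis (mono_tags) imageI mem_Collect_eq)
  then show ?thesis using emb C(1,2) z(1) unfolding polar_embedding_def by blast
qed

lemma cylinder_shift: "z + t *\<^sub>R axis i 1 \<in> cylinder i S \<longleftrightarrow> z \<in> cylinder i S"
  unfolding cyl\<beta> by (simp add: \<beta>_shift)

text \<open>Along the axis the slack changes with a slope of sign \<open>s\<close>, because
  \<open>m c\<close> is positive at the pole. A nonpositive value would force a zero at
  \<open>z\<close> or further towards the pole, on the side where the hyperplane must not meet the
  cylinder.\<close>

lemma slack_pos:
  assumes c: "c \<in> J" and z: "z \<in> cylinder i S" "0 \<le> s * z $ i"
  shows "0 < slack c z"
proof (rule ccontr)
  assume le: "\<not> 0 < slack c z"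
  obtain k where k: "k > 0" "T (v, 1) = (k * s) *\<^sub>R (axis i 1, 0)" using pole by metis
  define q where "q = m c (v, 1)"
  have q: "q > 0" using m_pole[OF c] by (simp add: q_def)
  have "(v, 1) = (k * s) *\<^sub>R T' (axis i 1, 0)"
    using k(2) T'_T[of "(v, 1)"] by (simp only: linear_scale[OF linT'])
  then have "q = (k * s) * m c (T' (axis i 1, 0))"
    unfolding q_def by (simp only: linear_scale[OF linm[OF c]]) simp
  then have ax: "m c (T' (axis i 1, 0)) = s * q / k" using k s1 by (auto simp: field_simps)
  have sh: "slack c (z + t *\<^sub>R axis i 1) = slack c z + t * (s * q / k)" for t
  proof -
    have "(z + t *\<^sub>R axis i 1, 1) = (z, 1) + t *\<^sub>R (axis i 1, 0::real)" by simp
    then show ?thesis unfolding slack_def ax[symmetric]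
      by (simp only: linear_add[OF lin_mT'[OF c]] linear_scale[OF lin_mT'[OF c]]) simp
  qed
  define t where "t = - slack c z * k * s / q"
  have ss: "s * s = 1" using s1 by auto
  have "slack c (z + t *\<^sub>R axis i 1) = slack c z - slack c z * (s * s)"
    unfolding sh t_def using k q by (simp add: field_simps)
  then have "slack c (z + t *\<^sub>R axis i 1) = 0" using ss by simp
  then have "s * (z + t *\<^sub>R axis i 1) $ i < 0"
    using slack_sign[OF c] cylinder_shift z(1) by blast
  then have "s * z $ i + s * t < 0" by (simp add: algebra_simps)
  moreover have "s * t = (- slack c z) * k * (s * s) / q" unfolding t_def by simp
  then have "s * t \<ge> 0" using le k q ss by (simp add: divide_nonpos_pos mult_nonpos_nonneg)
  ultimately show False using z(2) by linarith
qed

text \<open>The point is that every \<open>z\<close> on the right has a finite preimage, of positive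
  height \<open>t\<close>. For t \<le> 0 the vector X - t v would be a direction of recession of the
  bounded polytope, hence 0, and all barycentric coordinates of \<open>z\<close> would vanish
  although they sum to 1.\<close>

lemma image_eq:
  "proj_map T ` (P - {v}) = {z \<in> cylinder i S. \<forall>c\<in>J. 0 \<le> slack c z}"
proof (intro equalityI subsetI)
  fix z assume "z \<in> proj_map T ` (P - {v})"
  then obtain x where x: "x \<in> P" "x \<noteq> v" "z = proj_map T x" by blast
  note pos = \<sigma>_pos[OF x(1,2)]
  have "0 \<le> \<beta> r (z, 1)" for r
    using y_nonneg[OF x(1), of r] \<beta>_proj[of x r] pos x(3) by (simp add: zero_le_mult_iff)
  moreover have "0 \<le> slack c z" if "c \<in> J" for c
    using m_proj[OF that, of x] pos x(1,3) that unfolding P_eq by (auto simp: zero_le_mult_iff)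
  ultimately show "z \<in> {z \<in> cylinder i S. \<forall>c\<in>J. 0 \<le> slack c z}" unfolding cyl\<beta> by simp
next
  fix z assume z: "z \<in> {z \<in> cylinder i S. \<forall>c\<in>J. 0 \<le> slack c z}"
  define X t where "X = fst (T' (z, 1))" and "t = snd (T' (z, 1))"
  have Xt: "T' (z, 1) = (X, t)" by (simp add: X_def t_def)
  then have TX: "T (X, t) = (z, 1)" using T_T' by metis
  have no_ray: "d = 0" if "\<And>r. 0 \<le> \<beta> r (T (d, 0))" "\<And>c. c \<in> J \<Longrightarrow> 0 \<le> m c (d, 0)" for d
  proof (rule bounded_ray_imp_zero[OF bdP])
    fix u :: real assume u: "0 \<le> u"
    have e: "(v + u *\<^sub>R d, 1) = (v, 1) + u *\<^sub>R (d, 0::real)" by simp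
    have "0 \<le> y r (v + u *\<^sub>R d)" for r
    proof -
      have "y r (v + u *\<^sub>R d) = y r v + u * \<beta> r (T (d, 0))"
        unfolding y_def e by (simp only: linear_add[OF lin_\<beta>T] linear_scale[OF lin_\<beta>T]) simp
      then show ?thesis using that u y_pole by simp
    qed
    moreover have "0 \<le> m c (v + u *\<^sub>R d, 1)" if c: "c \<in> J" for c
    proof -
      have "m c (v + u *\<^sub>R d, 1) = m c (v, 1) + u * m c (d, 0)"
        unfolding e by (simp only: linear_add[OF linm[OF c]] linear_scale[OF linm[OF c]]) simp
      then show ?thesis using \<open>c \<in> J \<Longrightarrow> 0 \<le> m c (d, 0)\<close> c u m_pole[OF c] by simp
    qed
    ultimately show "v + u *\<^sub>R d \<in> P" unfolding P_eq by simp
  qed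
  have "t > 0"
  proof (rule ccontr)
    assume t: "\<not> t > 0"
    define d where "d = X - t *\<^sub>R v"
    have e: "(d, 0) = (X, t) + (- t) *\<^sub>R (v, 1)" by (simp add: d_def)
    have bd: "\<beta> r (T (d, 0)) = \<beta> r (z, 1)" for r
    proof -
      have "\<beta> r (T (d, 0)) = \<beta> r (T (X, t)) + (- t) * y r v"
        unfolding y_def e by (simp only: linear_add[OF lin_\<beta>T] linear_scale[OF lin_\<beta>T]) simp
      then show ?thesis using TX y_pole by simp
    qed
    have "d = 0"
    proof (rule no_ray)
      show "0 \<le> \<beta> r (T (d, 0))" for r using z bd unfolding cyl\<beta> by simp
      fix c assume c: "c \<in> J"
      have "m c (d, 0) = m c (X, t) + (- t) * m c (v, 1)"
        unfolding e by (simp only: linear_add[OF linm[OF c]] linear_scale[OF linm[OF c]]) simp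
      moreover have "0 \<le> m c (X, t)" using z c Xt unfolding slack_def by auto
      moreover have "0 \<le> (- t) * m c (v, 1)" using t m_pole[OF c] by (intro mult_nonneg_nonneg) auto
      ultimately show "0 \<le> m c (d, 0)" by simp
    qed
    then have "(\<Sum>r\<in>UNIV. \<beta> r (z, 1)) = 0"
      using bd linear_0[OF lin_\<beta>T] by (metis (no_types, lifting) sum.neutral zero_prod_def)
    then show False using sum\<beta>[of "(z, 1)"] by simp
  qed
  define x where "x = X /\<^sub>R t"
  have "t *\<^sub>R (x, 1) = (X, t)" using \<open>t > 0\<close> by (simp add: x_def)
  then have Tx: "t *\<^sub>R T (x, 1) = (z, 1)" using TX linear_scale[OF linT] by metis
  then have sx: "t * \<sigma> x = 1" unfolding \<sigma>_def by (metis snd_conv snd_scaleR real_scaleR_def)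
  then have pos: "\<sigma> x > 0" using \<open>t > 0\<close> by (metis zero_less_mult_pos zero_less_one)
  have "T (x, 1) = \<sigma> x *\<^sub>R (t *\<^sub>R T (x, 1))" using sx by (simp add: mult.commute)
  then have "\<sigma> x *\<^sub>R (proj_map T x, 1) = \<sigma> x *\<^sub>R (z, 1)" using T_proj[of x] pos Tx by simp
  then have pz: "proj_map T x = z" using pos by simp
  have "0 \<le> y r x" for r using \<beta>_proj[of x r] pos z pz unfolding cyl\<beta> by simp
  moreover have "0 \<le> m c (x, 1)" if "c \<in> J" for c
    using m_proj[OF that, of x] pos z pz that by simp
  ultimately have "x \<in> P" unfolding P_eq by simp
  moreover have "x \<noteq> v" using pos \<sigma>_pole by auto
  ultimately show "z \<in> proj_map T ` (P - {v})" using pz by blast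
qed

definition patterns :: "('n set \<times> 'c set) set" where
  "patterns = (\<lambda>x. ({r. y r x = 0}, {c \<in> J. m c (x, 1) = 0})) ` (P - {v})"

lemma patterns_eq:
  "patterns = (\<lambda>z. ({r. \<beta> r (z, 1) = 0}, {c \<in> J. slack c z = 0})) ` {z \<in> cylinder i S. \<forall>c\<in>J. 0 \<le> slack c z}"
proof -
  have "{r. y r x = 0} = {r. \<beta> r (proj_map T x, 1) = 0}"
    "{c \<in> J. m c (x, 1) = 0} = {c \<in> J. slack c (proj_map T x) = 0}" if "x \<in> P - {v}" for x
  proof -
    have "\<sigma> x \<noteq> 0" using \<sigma>_pos[of x] that by auto
    then show "{r. y r x = 0} = {r. \<beta> r (proj_map T x, 1) = 0}"
      "{c \<in> J. m c (x, 1) = 0} = {c \<in> J. slack c (proj_map T x) = 0}"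
      using \<beta>_proj[of x] m_proj[of _ x] by auto
  qed
  then show ?thesis
    unfolding patterns_def image_eq[symmetric] image_image by (intro image_cong) auto
qed

end

text \<open>Around \<open>x\<close> only the constraint \<open>c\<close> is active, so the face
  contains an open piece of its hyperplane and spans it; \<open>z\<close> shows that the polyhedron
  is not contained in this hyperplane. The lemma supplies the facets demanded by
  \<open>m_facet\<close>.\<close>

lemma (in polyhedral) facet_of_unique_tight:
  assumes V: "V = UNIV" and x: "x \<in> polyh V J f" "tight J f x = {c}"
    and z: "z \<in> polyh V J f" "f c z > 0"
  shows "{x \<in> polyh V J f. f c x = 0} facet_of polyh V J f"
    and "affine hull {x \<in> polyh V J f. f c x = 0} = {x. f c x = 0}"
proof -
  let ?F = "{x \<in> polyh V J f. f c x = 0}"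
  have c: "c \<in> J" "f c x = 0" using x(2) by (auto simp: tight_def)
  obtain a b where ab: "f c = (\<lambda>x. a \<bullet> x + b)" using form[OF c(1)] unfolding affine_form_def by blast
  have a0: "a \<noteq> 0"
  proof
    assume "a = 0"
    then show False using ab c(2) z(2) by simp
  qed
  have hyp: "{x. f c x = 0} = {x. a \<bullet> x = - b}" unfolding ab by (auto simp: algebra_simps)
  define U where "U = (\<Inter>d\<in>J - {c}. {y. 0 < f d y})"
  have "open U" unfolding U_def using finJ
    by (intro open_INT) (auto intro!: open_Collect_less affine_form_continuous form continuous_on_const)
  have "x \<in> U"
  proof -
    have "0 < f d x" if "d \<in> J - {c}" for d
    proof -
      have "d \<notin> tight J f x" using x(2) that by blast
      then have "f d x \<noteq> 0" using that by (auto simp: tight_def)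
      then show ?thesis using x(1) that by (force simp: polyh_def)
    qed
    then show ?thesis by (simp add: U_def)
  qed
  have sub: "{x. f c x = 0} \<inter> U \<subseteq> ?F"
    unfolding U_def polyh_def V by (force intro: less_imp_le)
  have affH: "affine {x. f c x = 0}" unfolding hyp by (rule affine_hyperplane)
  have "affine hull ({x. f c x = 0} \<inter> U) = affine hull {x. f c x = 0}"
    using \<open>x \<in> U\<close> c(2) by (intro affine_hull_affine_Int_open affH \<open>open U\<close>) blast
  also have "\<dots> = {x. f c x = 0}" using affH by (simp add: affine_hull_eq)
  finally have "affine hull ({x. f c x = 0} \<inter> U) = {x. f c x = 0}" .
  then have "{x. f c x = 0} \<subseteq> affine hull ?F" using hull_mono[OF sub, of affine] by simp
  moreover have "affine hull ?F \<subseteq> {x. f c x = 0}"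
    by (rule hull_minimal) (use affH in auto)
  ultimately show aff: "affine hull ?F = {x. f c x = 0}" by blast
  have "?F = {x \<in> polyh V J f. {c} \<subseteq> tight J f x}" using c(1) by (auto simp: tight_def)
  then have face: "?F face_of polyh V J f" using tight_face[of "{c}"] c(1) by simp
  have dim: "aff_dim ?F = DIM('a) - 1"
    using aff_dim_hyperplane[OF a0, of "-b"] aff_dim_affine_hull[of ?F] unfolding aff hyp by simp
  have "convex (polyh V J f)"
    using tight_face[of "{}"] face_of_imp_convex by force
  moreover have "?F \<noteq> polyh V J f" using z by force
  ultimately have "aff_dim ?F < aff_dim (polyh V J f)"
    using face by (intro face_of_aff_dim_lt)
  then have "aff_dim (polyh V J f) = DIM('a)"
    using dim aff_dim_le_DIM[of "polyh V J f"] by simp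
  then show "?F facet_of polyh V J f"
    unfolding facet_of_def using face dim c(2) x(1) by auto
qed

text \<open>Facets given abstractly have to be matched with given inequalities. Some constraint
  vanishes on \<open>E r\<close>, hence on its hyperplane, so it is a multiple of
  \<open>y r\<close>; the factor is positive because both are nonnegative on \<open>P\<close> and
  \<open>P\<close> is not contained in the hyperplane.\<close>

lemma (in polar) facet_functional:
  assumes poly: "polyhedral UNIV J g" and P: "P = polyh UNIV J g"
    and nz: "\<And>c. c \<in> J \<Longrightarrow> \<exists>x. g c x \<noteq> 0"
    and E: "E r facet_of P" "v \<in> E r"
  shows "\<exists>c\<in>J. g c v = 0 \<and> (\<exists>l>0. \<forall>x. g c x = l * y r x)"
proof -
  interpret polyhedral UNIV J g by fact
  have Er: "E r face_of polyh UNIV J g" "E r \<noteq> {}"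
    using E P by (auto simp: facet_of_def)
  then obtain K where K: "K \<subseteq> J" "E r = {x \<in> polyh UNIV J g. K \<subseteq> tight J g x}"
    using face_tight[OF Er] by auto
  have "K \<noteq> {}"
  proof
    assume "K = {}"
    then have "E r = P" using K(2) P by auto
    then show False using E(1) by simp
  qed
  then obtain c where c: "c \<in> K" by blast
  then have cJ: "c \<in> J" using K(1) by blast
  have Ec: "E r \<subseteq> {x. g c x = 0}" unfolding K(2) using c by (auto simp: tight_def)
  obtain a b where ab: "g c = (\<lambda>x. a \<bullet> x + b)" using form[OF cJ] unfolding affine_form_def by blast
  have "affine {x. g c x = 0}"
  proof -
    have "{x. g c x = 0} = {x. a \<bullet> x = - b}" unfolding ab by (auto simp: algebra_simps)
    then show ?thesis by (simp add: affine_hyperplane)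
  qed
  then have sub: "{x. y r x = 0} \<subseteq> {x. g c x = 0}"
    unfolding hyperplane_facet[symmetric] using Ec by (intro hull_minimal)
  have gv: "g c v = 0" using Ec E(2) by blast
  obtain e where e: "\<forall>q. y q e = (if q = r then 1 else 0)"
    using coordinates_surj[of "\<lambda>q. if q = r then 1 else 0"] by blast
  define l where "l = g c e"
  have gl: "g c x = l * y r x" for x
  proof -
    \<comment> \<open>\<open>x'\<close> is \<open>x\<close> with its r-th coordinate set to 0. The
      remaining displacement points towards the unit point \<open>e\<close>, so \<open>l\<close> is
      the factor of proportionality.\<close>
    obtain x' where x': "\<forall>q. y q x' = (if q = r then 0 else y q x)"
      using coordinates_surj[of "\<lambda>q. if q = r then 0 else y q x"] by blast
    have "x = x' + y r x *\<^sub>R (e - v)"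
    proof (rule coordinates_eqI)
      fix q
      show "y q x = y q (x' + y r x *\<^sub>R (e - v))"
        unfolding affine_form_shift[OF affine_form_y] using x' e y_pole by simp
    qed
    then have "g c x = g c x' + y r x * (g c e - g c v)"
      using affine_form_shift[OF form[OF cJ], of x' "y r x" e v] by simp
    moreover have "x' \<in> {x. y r x = 0}" using x' by simp
    then have "g c x' = 0" using sub by blast
    ultimately show ?thesis using gv by (simp add: l_def mult.commute)
  qed
  have "l \<noteq> 0" using nz[OF cJ] gl by auto
  have "\<exists>x\<in>P. g c x \<noteq> 0"
  proof (rule ccontr)
    assume "\<not> (\<exists>x\<in>P. g c x \<noteq> 0)"
    then have "P \<subseteq> affine hull E r" unfolding hyperplane_facet using gl \<open>l \<noteq> 0\<close> by auto
    then have "aff_dim P \<le> aff_dim (E r)" using aff_dim_subset[of P "affine hull E r"] by simp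
    then show False using E(1) unfolding facet_of_def by simp
  qed
  then obtain x where x: "x \<in> P" "g c x \<noteq> 0" by blast
  then have "g c x > 0" using cJ unfolding P polyh_def by force
  then have "l > 0" using gl[of x] y_nonneg[OF x(1), of r] by (simp add: zero_less_mult_iff)
  then show ?thesis using cJ gv gl by blast
qed

text \<open>The main source of witnesses for tight sets. The total of a block is spread evenly over
  its coordinates outside \<open>Z\<close>, which works because a total is zero exactly for blocks
  inside \<open>Z\<close>; \<open>\<kappa>\<close> accounts for the scaling of the coordinates of
  the product.\<close>

lemma block_totals:
  fixes C :: "'i \<Rightarrow> 'n::finite set" and \<kappa> :: "'n \<Rightarrow> real"
  assumes dis: "disjoint_family_on C X" and \<kappa>: "\<And>r. \<kappa> r > 0"
    and t: "\<And>i. i \<in> X \<Longrightarrow> 0 \<le> t i" "\<And>i. i \<in> X \<Longrightarrow> t i = 0 \<longleftrightarrow> C i \<subseteq> Z"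
  shows "\<exists>\<eta>. (\<forall>r. 0 \<le> \<eta> r) \<and> (\<forall>r. \<eta> r = 0 \<longleftrightarrow> r \<in> Z \<or> r \<notin> (\<Union>i\<in>X. C i)) \<and>
    (\<forall>i\<in>X. (\<Sum>r\<in>C i. \<eta> r / \<kappa> r) = t i)"
proof -
  define blk where "blk r = (SOME i. i \<in> X \<and> r \<in> C i)" for r
  have blk: "blk r = i" if "i \<in> X" "r \<in> C i" for r i
  proof -
    have "blk r \<in> X \<and> r \<in> C (blk r)" unfolding blk_def by (rule someI[of _ i]) (use that in blast)
    then show ?thesis using dis that unfolding disjoint_family_on_def by blast
  qed
  define \<eta> where "\<eta> r = (if r \<in> Z \<or> r \<notin> (\<Union>i\<in>X. C i) then 0
      else \<kappa> r * (t (blk r) / card (C (blk r) - Z)))" for r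
  have pos: "0 < \<eta> r" if "r \<notin> Z" "i \<in> X" "r \<in> C i" for r i
  proof -
    have "blk r = i" using blk that by blast
    moreover have "t i > 0" using t[OF that(2)] that by (metis less_eq_real_def subsetD)
    moreover have "card (C i - Z) > 0" using that by (simp add: card_gt_0_iff) blast
    ultimately show ?thesis using that \<kappa>[of r] by (auto simp: \<eta>_def)
  qed
  have zero: "\<eta> r = 0 \<longleftrightarrow> r \<in> Z \<or> r \<notin> (\<Union>i\<in>X. C i)" for r
  proof (cases "r \<in> Z \<or> r \<notin> (\<Union>i\<in>X. C i)")
    case False
    then obtain i where "i \<in> X" "r \<in> C i" "r \<notin> Z" by blast
    then show ?thesis using pos[of r i] False by simp
  qed (simp add: \<eta>_def)
  moreover have "0 \<le> \<eta> r" for r using pos[of r] zero[of r] by (metis UN_E less_eq_real_def)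
  moreover have "(\<Sum>r\<in>C i. \<eta> r / \<kappa> r) = t i" if i: "i \<in> X" for i
  proof -
    have "(\<Sum>r\<in>C i. \<eta> r / \<kappa> r) = (\<Sum>r\<in>C i - Z. t i / card (C i - Z))"
    proof (rule sum.mono_neutral_cong_right)
      fix r assume r: "r \<in> C i - Z"
      then have "\<eta> r = \<kappa> r * (t i / card (C i - Z))" using i blk[OF i, of r] by (auto simp: \<eta>_def)
      then show "\<eta> r / \<kappa> r = t i / card (C i - Z)" using \<kappa>[of r] by simp
    qed (auto simp: \<eta>_def)
    also have "\<dots> = t i"
    proof (cases "C i \<subseteq> Z")
      case True
      then show ?thesis using t(2)[OF i] by simp
    next
      case False
      then have "card (C i - Z) \<noteq> 0" by auto
      then show ?thesis by simp
    qed
    finally show ?thesis .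
  qed
  ultimately show ?thesis by blast
qed

text \<open>A common index type for three kinds of constraints: coordinates, blocks, and hyperplanes
  of \<open>Q\<close> avoiding the vertex. It allows tight sets of different polytopes to be
  literally equal.\<close>

definition join_form :: "('a \<Rightarrow> 'x \<Rightarrow> real) \<Rightarrow> ('b \<Rightarrow> 'x \<Rightarrow> real) \<Rightarrow> ('c \<Rightarrow> 'x \<Rightarrow> real)
    \<Rightarrow> 'a + ('b + 'c) \<Rightarrow> 'x \<Rightarrow> real" where
  "join_form f g h = case_sum f (case_sum g h)"

lemma tight_join_form:
  "tight (A <+> (B <+> C)) (join_form f g h) x
    = {a \<in> A. f a x = 0} <+> ({b \<in> B. g b x = 0} <+> {c \<in> C. h c x = 0})"
  unfolding tight_def join_form_def by auto

lemma polyh_join_form: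
  "polyh V (A <+> (B <+> C)) (join_form f g h)
    = {x \<in> V. (\<forall>a\<in>A. 0 \<le> f a x) \<and> (\<forall>b\<in>B. 0 \<le> g b x) \<and> (\<forall>c\<in>C. 0 \<le> h c x)}"
  by (auto simp: polyh_def join_form_def Plus_def ball_Un)

lemma polyhedral_join_form:
  fixes f :: "'a \<Rightarrow> 'x::euclidean_space \<Rightarrow> real"
  assumes "affine V" "finite A" "finite B" "finite C"
    "\<And>a. a \<in> A \<Longrightarrow> affine_form (f a)" "\<And>b. b \<in> B \<Longrightarrow> affine_form (g b)"
    "\<And>c. c \<in> C \<Longrightarrow> affine_form (h c)"
  shows "polyhedral V (A <+> (B <+> C)) (join_form f g h)"
  using assms by unfold_locales (auto simp: join_form_def)

text \<open>The condition \<open>I \<noteq> {}\<close> avoids listing faces of the cylinder twice: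
  patterns without a tight hyperplane occur for both polytopes and are counted with those of
  \<open>Q\<close>.\<close>

lemma connected_sum_patterns:
  assumes A: "polar_polytope i S D \<beta> 1 P v E T J m"
    and B: "polar_polytope i S D \<beta> (-1) Q w F U K q" and fin: "finite J" "finite K"
  shows "\<exists>f. polyhedral UNIV (UNIV <+> (J <+> K)) f \<and>
    proj_map T ` (P - {v}) \<inter> proj_map U ` (Q - {w}) = polyh UNIV (UNIV <+> (J <+> K)) f \<and>
    tight (UNIV <+> (J <+> K)) f ` polyh UNIV (UNIV <+> (J <+> K)) f
      = {Z <+> (I <+> {}) | Z I. (Z, I) \<in> polar_polytope.patterns \<beta> P v T J m \<and> I \<noteq> {}}
      \<union> {Z <+> ({} <+> L) | Z L. (Z, L) \<in> polar_polytope.patterns \<beta> Q w U K q}"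
proof -
  interpret A: polar_polytope i S D \<beta> 1 P v E T J m by fact
  interpret B: polar_polytope i S D \<beta> "-1" Q w F U K q by fact
  define f where "f = join_form (\<lambda>r z. \<beta> r (z, 1)) A.slack B.slack"
  let ?I = "UNIV <+> (J <+> K)"
  let ?Z = "\<lambda>z. {r. \<beta> r (z, 1) = 0}" and ?A = "\<lambda>z. {c \<in> J. A.slack c z = 0}"
    and ?B = "\<lambda>z. {c \<in> K. B.slack c z = 0}"
  have poly: "polyhedral UNIV ?I f"
    unfolding f_def using fin A.affine_form_slack B.affine_form_slack affine_form_homogeneous[OF A.lin\<beta>]
    by (intro polyhedral_join_form) auto
  have R: "proj_map T ` (P - {v}) \<inter> proj_map U ` (Q - {w}) = polyh UNIV ?I f"
    unfolding A.image_eq B.image_eq f_def polyh_join_form A.cyl\<beta> by auto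
  have tz: "tight ?I f z = ?Z z <+> (?A z <+> ?B z)" for z
    unfolding f_def tight_join_form by simp
  have Rz: "z \<in> polyh UNIV ?I f \<longleftrightarrow>
      z \<in> cylinder i S \<and> (\<forall>c\<in>J. 0 \<le> A.slack c z) \<and> (\<forall>c\<in>K. 0 \<le> B.slack c z)" for z
    unfolding f_def polyh_join_form A.cyl\<beta> by auto
  have Alow: "z $ i < 0" if "z \<in> cylinder i S" "c \<in> J" "A.slack c z \<le> 0" for z c
    using A.slack_pos[of c z] that by force
  have Bhigh: "z $ i > 0" if "z \<in> cylinder i S" "c \<in> K" "B.slack c z \<le> 0" for z c
    using B.slack_pos[of c z] that by force
  have "tight ?I f ` polyh UNIV ?I f
      = {Z <+> (I <+> {}) | Z I. (Z, I) \<in> A.patterns \<and> I \<noteq> {}}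
      \<union> {Z <+> ({} <+> L) | Z L. (Z, L) \<in> B.patterns}" (is "_ = ?L1 \<union> ?L2")
  proof (intro equalityI subsetI)
    fix t assume "t \<in> tight ?I f ` polyh UNIV ?I f"
    then obtain z where z: "z \<in> polyh UNIV ?I f" "t = ?Z z <+> (?A z <+> ?B z)" using tz by auto
    note zc = z(1)[unfolded Rz]
    show "t \<in> ?L1 \<union> ?L2"
    proof (cases "?A z = {}")
      case True
      have "(?Z z, ?B z) \<in> B.patterns" unfolding B.patterns_eq using zc by blast
      then have "t \<in> ?L2" unfolding z(2) True by blast
      then show ?thesis by blast
    next
      case False
      then have "z $ i < 0" using Alow zc by auto
      then have B0: "?B z = {}" using Bhigh[of z] zc by force
      moreover have "(?Z z, ?A z) \<in> A.patterns" unfolding A.patterns_eq using zc by blast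
      ultimately have "t \<in> ?L1" unfolding z(2) B0 using False by blast
      then show ?thesis by blast
    qed
  next
    fix t assume "t \<in> ?L1 \<union> ?L2"
    then consider (1) Z I where "t = Z <+> (I <+> {})" "(Z, I) \<in> A.patterns" "I \<noteq> {}"
      | (2) Z L where "t = Z <+> ({} <+> L)" "(Z, L) \<in> B.patterns" by blast
    then show "t \<in> tight ?I f ` polyh UNIV ?I f"
    proof cases
      case 1
      then obtain z where z: "z \<in> cylinder i S" "\<forall>c\<in>J. 0 \<le> A.slack c z" "Z = ?Z z" "I = ?A z"
        unfolding A.patterns_eq by blast
      have "z $ i < 0" using 1(3) Alow z by auto
      then have Bp: "0 < B.slack c z" if "c \<in> K" for c using Bhigh[OF z(1) that] by force
      then have "z \<in> polyh UNIV ?I f" unfolding Rz using z by force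
      moreover have "t = tight ?I f z" unfolding tz 1 z(3,4) using Bp by force
      ultimately show ?thesis by blast
    next
      case 2
      then obtain z where z: "z \<in> cylinder i S" "\<forall>c\<in>K. 0 \<le> B.slack c z" "Z = ?Z z" "L = ?B z"
        unfolding B.patterns_eq by blast
      show ?thesis
      proof (cases "L = {}")
        case False
        then have "z $ i > 0" using Bhigh z by auto
        then have Ap: "0 < A.slack c z" if "c \<in> J" for c using Alow[OF z(1) that] by force
        then have "z \<in> polyh UNIV ?I f" unfolding Rz using z by force
        moreover have "t = tight ?I f z" unfolding tz 2 z(3,4) using Ap by force
        ultimately show ?thesis by blast
      next
        case True
        \<comment> \<open>No hyperplane of \<open>Q\<close> avoiding \<open>w\<close> is tight, so
          \<open>z\<close> may slide along the axis to position 0. This keeps its vanishing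
          coordinates and makes every slack positive.\<close>
        define z' where "z' = z + (- z $ i) *\<^sub>R axis i 1"
        have z': "z' \<in> cylinder i S" "z' $ i = 0" "?Z z' = ?Z z"
          using z(1) unfolding z'_def A.cylinder_shift A.\<beta>_shift by simp_all
        have Ap: "0 < A.slack c z'" if "c \<in> J" for c using Alow[OF z'(1) that] z'(2) by force
        have Bp: "0 < B.slack c z'" if "c \<in> K" for c using Bhigh[OF z'(1) that] z'(2) by force
        have "z' \<in> polyh UNIV ?I f" unfolding Rz using z' Ap Bp by (auto intro: less_imp_le)
        moreover have "t = tight ?I f z'" unfolding tz 2 z(3) z'(3) True using Ap Bp by force
        ultimately show ?thesis by blast
      qed
    qed
  qed
  then show ?thesis using poly R by blast
qed

subsection \<open>Products of simplices in polar position\<close>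

text \<open>The inequalities are regrouped as seen from \<open>v\<close>, which in each block is 0
  or a unit vector: \<open>\<xi>\<close> belongs to the facets through \<open>v\<close>, one for
  each coordinate, and \<open>\<mu>\<close> to the facet of each factor opposite to
  \<open>v\<close>. Matching the ordering \<open>E\<close> with \<open>\<xi>\<close> gives the
  permutation \<open>\<pi>\<close> and the scales \<open>\<kappa>\<close>.\<close>

lemma (in polar) simplex_product_polar:
  fixes B :: "nat \<Rightarrow> 'n set" and k :: nat
  assumes s: "s = 1" and P: "P = simplex_product k B"
    and dis: "disjoint_family_on B {1..k}" and cover: "(\<Union>l\<in>{1..k}. B l) = UNIV"
    and v: "v extreme_point_of P" and E: "bij_betw E UNIV {G. G facet_of P \<and> v \<in> G}"
  obtains \<pi> :: "'n \<Rightarrow> 'n" and \<kappa> :: "'n \<Rightarrow> real" where "bij \<pi>" "\<forall>r. \<kappa> r > 0"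
    "polar_polytope i S D \<beta> s P v E T {l \<in> {1..k}. B l \<noteq> {}}
      (\<lambda>l Z. snd Z - (\<Sum>r\<in>\<pi> -` B l. \<beta> r (T Z) / \<kappa> r))"
proof -
  define f where "f = case_sum (\<lambda>j (x :: real^'n). x $ j) (\<lambda>l x. 1 - (\<Sum>j\<in>B l. x $ j))"
  define I where "I = (UNIV :: 'n set) <+> {1..k}"
  have Pf: "P = polyh UNIV I f"
    unfolding P simplex_product_def cover by (auto simp: polyh_def f_def I_def Plus_def ball_Un)
  interpret F: polyhedral UNIV I f
    by unfold_locales
      (auto simp: I_def f_def intro!: affine_form_diff affine_form_sum)
  have vP: "v \<in> P" using v by (simp add: extreme_point_of_def)
  obtain b where b: "\<And>j. b j \<in> {1..k}" "\<And>j. j \<in> B (b j)"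
    using cover by (metis UNIV_I UN_iff)
  have b_eq: "b j = l" if "l \<in> {1..k}" "j \<in> B l" for j l
    using dis b that unfolding disjoint_family_on_def by blast
  have v_pos: "v $ j = 1 \<and> (\<forall>r\<in>B (b j) - {j}. v $ r = 0)" if nz: "v $ j \<noteq> 0" for j
  proof -
    \<comment> \<open>\<open>u\<close> replaces the block of \<open>j\<close> in \<open>v\<close> by
      the unit vector at \<open>j\<close>. Every constraint tight at \<open>v\<close> remains tight,
      so rigidity of the vertex gives u = v.\<close>
    define u where "u = (\<chi> r. if r \<in> B (b j) then (if r = j then 1 else 0) else v $ r)"
    have "u = v"
    proof (rule F.extreme_point_rigid)
      show "v extreme_point_of polyh UNIV I f" using v Pf by simp
      fix c assume c: "c \<in> tight I f v"
      show "f c u = 0"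
      proof (cases c)
        case (Inl r)
        then have "v $ r = 0" using c by (simp add: tight_def f_def)
        then show ?thesis using Inl nz by (auto simp: u_def f_def)
      next
        case (Inr l)
        then have l: "l \<in> {1..k}" "(\<Sum>r\<in>B l. v $ r) = 1" using c by (auto simp: tight_def f_def I_def)
        have "(\<Sum>r\<in>B l. u $ r) = 1"
        proof (cases "l = b j")
          case True
          then have "(\<Sum>r\<in>B l. u $ r) = (\<Sum>r\<in>B l. if r = j then 1 else 0)"
            by (simp add: u_def cong: sum.cong)
          also have "\<dots> = 1" using b(2)[of j] True by simp
          finally show ?thesis .
        next
          case False
          then have "B l \<inter> B (b j) = {}"
            using dis l(1) b(1)[of j] unfolding disjoint_family_on_def by blast
          then have "(\<Sum>r\<in>B l. u $ r) = (\<Sum>r\<in>B l. v $ r)"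
            by (intro sum.cong) (auto simp: u_def)
          then show ?thesis using l(2) by simp
        qed
        then show ?thesis using Inr by (simp add: f_def)
      qed
    qed simp
    then have uv: "(if r \<in> B (b j) then (if r = j then 1 else 0) else v $ r) = v $ r" for r
      unfolding u_def vec_eq_iff by simp
    show ?thesis
    proof (intro conjI ballI)
      show "v $ j = 1" using uv[of j] b(2)[of j] by simp
      show "v $ r = 0" if "r \<in> B (b j) - {j}" for r using uv[of r] that by simp
    qed
  qed
  \<comment> \<open>If \<open>v\<close> is the unit vector at \<open>j\<close> within the block, the
    facet of coordinate \<open>j\<close> avoids \<open>v\<close> and the facet of the sum passes
    through it; the two exchange their roles.\<close>
  define \<xi> where "\<xi> j x = (if v $ j = 1 then 1 - (\<Sum>r\<in>B (b j). x $ r) else x $ j)"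
    for j and x :: "real^'n"
  have aff\<xi>: "affine_form (\<xi> j)" for j
    by (cases "v $ j = 1") (auto simp: \<xi>_def[abs_def] intro!: affine_form_diff affine_form_sum)
  have \<xi>v: "\<xi> j v = 0" for j
  proof (cases "v $ j = 1")
    case True
    then have "(\<Sum>r\<in>B (b j). v $ r) = (\<Sum>r\<in>B (b j). if r = j then 1 else 0)"
      using v_pos[of j] by (intro sum.cong) auto
    also have "\<dots> = 1" using b(2)[of j] by simp
    finally show ?thesis using True by (simp add: \<xi>_def)
  next
    case False
    then show ?thesis using v_pos[of j] by (auto simp: \<xi>_def)
  qed
  define \<mu> where "\<mu> l x = 1 - (\<Sum>j\<in>B l. \<xi> j x)" for l x
  have \<mu>0: "\<mu> l x = 1 - (\<Sum>j\<in>B l. x $ j)" if "l \<in> {1..k}" "\<forall>j\<in>B l. v $ j \<noteq> 1" for l x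
    using that by (auto simp: \<mu>_def \<xi>_def)
  have \<mu>1: "\<mu> l x = x $ j" if l: "l \<in> {1..k}" "j \<in> B l" "v $ j = 1" for l x j
  proof -
    have bj: "b j = l" using b_eq l by blast
    have "(\<Sum>r\<in>B l - {j}. \<xi> r x) = (\<Sum>r\<in>B l - {j}. x $ r)"
      using v_pos[of j] l bj by (intro sum.cong) (auto simp: \<xi>_def)
    moreover have "\<xi> j x = 1 - (\<Sum>r\<in>B l. x $ r)" using l bj by (simp add: \<xi>_def)
    ultimately show ?thesis
      using l unfolding \<mu>_def
      by (simp add: sum.remove[of "B l" j])
  qed
  define g where "g = case_sum \<xi> \<mu>"
  have aff\<mu>: "affine_form (\<mu> l)" for l
    unfolding \<mu>_def[abs_def] by (intro affine_form_diff affine_form_sum aff\<xi>) simp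
  interpret G: polyhedral UNIV I g
    by unfold_locales (auto simp: I_def g_def aff\<xi> aff\<mu>)
  have Pin: "x \<in> P \<longleftrightarrow> (\<forall>j. 0 \<le> x $ j) \<and> (\<forall>l\<in>{1..k}. 0 \<le> 1 - (\<Sum>j\<in>B l. x $ j))" for x
    unfolding P simplex_product_def cover by auto
  have Gin: "x \<in> polyh UNIV I g \<longleftrightarrow> (\<forall>j. 0 \<le> \<xi> j x) \<and> (\<forall>l\<in>{1..k}. 0 \<le> \<mu> l x)" for x
    by (auto simp: polyh_def g_def I_def Plus_def ball_Un)
  have Pg: "P = polyh UNIV I g"
  proof (intro set_eqI iffI)
    fix x assume x: "x \<in> P"
    have "0 \<le> \<xi> j x" for j using x b(1)[of j] unfolding Pin by (auto simp: \<xi>_def)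
    moreover have "0 \<le> \<mu> l x" if "l \<in> {1..k}" for l
    proof (cases "\<exists>j\<in>B l. v $ j = 1")
      case True
      then show ?thesis using \<mu>1[OF that] x unfolding Pin by auto
    next
      case False
      then show ?thesis using \<mu>0[OF that] x that unfolding Pin by auto
    qed
    ultimately show "x \<in> polyh UNIV I g" unfolding Gin by blast
  next
    fix x assume x: "x \<in> polyh UNIV I g"
    have "0 \<le> x $ j" for j
    proof (cases "v $ j = 1")
      case True
      then show ?thesis using \<mu>1[OF b(1) b(2) True] x b(1)[of j] unfolding Gin by metis
    next
      case False
      then have "\<xi> j x = x $ j" by (simp add: \<xi>_def)
      then show ?thesis using x unfolding Gin by metis
    qed
    moreover have "0 \<le> 1 - (\<Sum>j\<in>B l. x $ j)" if l: "l \<in> {1..k}" for l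
    proof (cases "\<exists>j\<in>B l. v $ j = 1")
      case True
      then obtain j where j: "j \<in> B l" "v $ j = 1" by blast
      then have "\<xi> j x = 1 - (\<Sum>j\<in>B l. x $ j)" using b_eq[OF l j(1)] by (simp add: \<xi>_def)
      then show ?thesis using x unfolding Gin by metis
    next
      case False
      then have "\<mu> l x = 1 - (\<Sum>j\<in>B l. x $ j)" using \<mu>0[OF l] by blast
      then show ?thesis using x l unfolding Gin by metis
    qed
    ultimately show "x \<in> P" unfolding Pin by blast
  qed
  have gnz: "\<exists>x. g c x \<noteq> 0" if "c \<in> I" for c
  proof (cases c)
    case (Inl j)
    then show ?thesis
      by (cases "v $ j = 1") (auto simp: g_def \<xi>_def intro: exI[of _ 0] exI[of _ "axis j 1"])
  next
    case (Inr l)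
    then show ?thesis using \<xi>v by (auto simp: g_def \<mu>_def intro!: exI[of _ v])
  qed
  have "\<exists>j l. l > 0 \<and> (\<forall>x. \<xi> j x = l * y r x)" for r
  proof -
    have "E r facet_of P" "v \<in> E r" using E bij_betwE by blast+
    then obtain c l where c: "c \<in> I" "g c v = 0" "l > 0" "\<forall>x. g c x = l * y r x"
      using facet_functional[OF G.polyhedral_axioms Pg gnz] by blast
    show ?thesis
    proof (cases c)
      case (Inl j)
      then show ?thesis using c by (auto simp: g_def)
    next
      case (Inr l)
      then show ?thesis using c(2) \<xi>v by (simp add: g_def \<mu>_def)
    qed
  qed
  then obtain \<pi> l where \<pi>: "\<And>r. l r > (0::real)" "\<And>r x. \<xi> (\<pi> r) x = l r * y r x"
    by metis
  have "inj \<pi>"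
  proof (rule injI)
    fix r q assume eq: "\<pi> r = \<pi> q"
    obtain e where e: "\<forall>p. y p e = (if p = r then 1 else 0)"
      using coordinates_surj[of "\<lambda>p. if p = r then 1 else 0"] by blast
    show "r = q"
    proof (rule ccontr)
      assume "r \<noteq> q"
      then have "y r e = 1" "y q e = 0" using e by auto
      then have "l r = 0" using \<pi>(2)[of r e] \<pi>(2)[of q e] unfolding eq by simp
      then show False using \<pi>(1)[of r] by simp
    qed
  qed
  then have bij: "bij \<pi>" by (simp add: bij_def finite_UNIV_inj_surj)
  define \<kappa> where "\<kappa> r = 1 / l r" for r
  have \<kappa>: "\<kappa> r > 0" for r using \<pi>(1) by (simp add: \<kappa>_def)
  have \<xi>y: "\<xi> (\<pi> r) x = y r x / \<kappa> r" for r x using \<pi>(2) by (simp add: \<kappa>_def mult.commute)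
  define m where "m l Z = snd Z - (\<Sum>r\<in>\<pi> -` B l. \<beta> r (T Z) / \<kappa> r)" for l Z
  have linm: "linear (m l)" for l
    unfolding m_def[abs_def]
    by (rule linearI)
      (simp_all add: linear_add[OF lin_\<beta>T] linear_scale[OF lin_\<beta>T] add_divide_distrib
        sum.distrib sum_distrib_left right_diff_distrib)
  have m\<mu>: "m l (x, 1) = \<mu> l x" for l x
  proof -
    have "(\<Sum>j\<in>B l. \<xi> j x) = (\<Sum>r\<in>\<pi> -` B l. \<xi> (\<pi> r) x)"
      using bij by (intro sum.reindex_bij_betw[symmetric] bij_betw_imageI)
        (auto simp: bij_def inj_on_def surj_image_vimage_eq)
    then show ?thesis by (simp add: \<mu>_def m_def \<xi>y y_def)
  qed
  \<comment> \<open>For an empty block \<open>\<mu>\<close> is constantly 1, so a 0-simplex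
    contributes no facet.\<close>
  let ?J = "{l \<in> {1..k}. B l \<noteq> {}}"
  have disC: "disjoint_family_on (\<lambda>l. \<pi> -` B l) {1..k}"
    using dis unfolding disjoint_family_on_def by blast
  have "polar_polytope i S D \<beta> s P v E T ?J m"
  proof unfold_locales
    show "m c (a + b) = m c a + m c b" for c a b by (rule linear_add[OF linm])
    show "m c (a *\<^sub>R b) = a *\<^sub>R m c b" for c a b by (rule linear_scale[OF linm])
    show "v \<in> P" by (rule vP)
    have "P \<subseteq> cbox 0 1"
    proof
      fix x assume x: "x \<in> P"
      have "x $ j \<le> 1" for j
      proof -
        have "x $ j \<le> (\<Sum>r\<in>B (b j). x $ r)"
          using x b(2)[of j] unfolding Pin by (intro member_le_sum) auto
        then show ?thesis using x b(1)[of j] unfolding Pin by force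
      qed
      then show "x \<in> cbox 0 1" using x unfolding Pin by (simp add: mem_box_cart)
    qed
    then show "bounded P" using bounded_cbox bounded_subset by blast
    show "P = {x. (\<forall>r. 0 \<le> y r x) \<and> (\<forall>c\<in>?J. 0 \<le> m c (x, 1))}"
    proof (intro set_eqI)
      fix x
      have "(\<forall>j. 0 \<le> \<xi> j x) \<longleftrightarrow> (\<forall>r. 0 \<le> \<xi> (\<pi> r) x)"
        using bij by (metis bij_pointE)
      also have "\<dots> \<longleftrightarrow> (\<forall>r. 0 \<le> y r x)"
        unfolding \<xi>y using \<kappa> by (simp add: zero_le_divide_iff less_imp_le not_le[symmetric])
      finally have 1: "(\<forall>j. 0 \<le> \<xi> j x) \<longleftrightarrow> (\<forall>r. 0 \<le> y r x)" .
      have "\<mu> l x = 1" if "B l = {}" for l using that by (simp add: \<mu>_def)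
      then have 2: "(\<forall>l\<in>{1..k}. 0 \<le> \<mu> l x) \<longleftrightarrow> (\<forall>l\<in>?J. 0 \<le> \<mu> l x)"
        by (smt (verit) mem_Collect_eq)
      show "x \<in> P \<longleftrightarrow> x \<in> {x. (\<forall>r. 0 \<le> y r x) \<and> (\<forall>c\<in>?J. 0 \<le> m c (x, 1))}"
        unfolding Pg Gin m\<mu> mem_Collect_eq[of x] 1 2 by simp
    qed
    show "0 < m c (v, 1)" for c unfolding m\<mu> by (simp add: \<mu>_def \<xi>v)
    fix c assume c: "c \<in> ?J"
    \<comment> \<open>Block totals of a point in the relative interior of facet \<open>c\<close>:
      all coordinates are positive and only this block is full.\<close>
    define t where "t l = (if B l = {} then 0 else if l = c then 1 else 1/2 :: real)" for l
    have "t l = 0 \<longleftrightarrow> \<pi> -` B l \<subseteq> {}" for l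
      using bij by (auto simp: t_def bij_def surj_vimage_empty)
    moreover have "0 \<le> t l" for l by (simp add: t_def)
    ultimately obtain \<eta> where \<eta>0: "(\<forall>r. 0 \<le> \<eta> r) \<and>
        (\<forall>r. \<eta> r = 0 \<longleftrightarrow> r \<in> {} \<or> r \<notin> (\<Union>l\<in>{1..k}. \<pi> -` B l)) \<and>
        (\<forall>l\<in>{1..k}. (\<Sum>r\<in>\<pi> -` B l. \<eta> r / \<kappa> r) = t l)"
      using block_totals[OF disC, of \<kappa> t "{}"] \<kappa> by auto
    note \<eta> = \<eta>0[THEN conjunct2, THEN conjunct1] \<eta>0[THEN conjunct1]
      \<eta>0[THEN conjunct2, THEN conjunct2]
    obtain x where x: "\<forall>r. y r x = \<eta> r" using coordinates_surj[of \<eta>] by blast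
    have ypos: "0 < y r x" for r
    proof -
      have "r \<in> (\<Union>l\<in>{1..k}. \<pi> -` B l)" using b[of "\<pi> r"] by blast
      then have "\<eta> r \<noteq> 0" using \<eta>(1) by blast
      then show ?thesis using \<eta>(2) x by (simp add: less_le)
    qed
    have \<mu>x: "\<mu> l x = 1 - t l" if "l \<in> {1..k}" for l
    proof -
      have "\<mu> l x = 1 - (\<Sum>r\<in>\<pi> -` B l. y r x / \<kappa> r)"
        unfolding m\<mu>[symmetric] m_def y_def by simp
      then show ?thesis using \<eta>(3) x that by simp
    qed
    have \<xi>pos: "0 < \<xi> j x" for j
    proof -
      obtain r where "j = \<pi> r" using bij by (metis bij_pointE)
      then show ?thesis using \<xi>y ypos \<kappa> by simp
    qed
    have "x \<in> polyh UNIV I g"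
      unfolding Gin using \<xi>pos \<mu>x by (auto simp: t_def less_imp_le)
    moreover have "tight I g x = {Inr c}"
    proof -
      have "d \<in> tight I g x \<longleftrightarrow> d = Inr c" for d
        using \<xi>pos \<mu>x c
        by (cases d) (auto simp: tight_def g_def I_def t_def less_imp_neq[symmetric] order_less_imp_not_eq2 split: if_splits)
      then show ?thesis by blast
    qed
    moreover have "v \<in> polyh UNIV I g" "0 < g (Inr c) v"
      using vP Pg by (auto simp: g_def \<mu>_def \<xi>v)
    ultimately have "{x \<in> P. \<mu> c x = 0} facet_of P" "affine hull {x \<in> P. \<mu> c x = 0} = {x. \<mu> c x = 0}"
      using G.facet_of_unique_tight[of x "Inr c" v] unfolding Pg[symmetric] by (auto simp: g_def)
    then show "\<exists>C. C facet_of P \<and> v \<notin> C \<and> affine hull C = {x. m c (x, 1) = 0}"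
      unfolding m\<mu> by (intro exI[of _ "{x \<in> P. \<mu> c x = 0}"]) (auto simp: \<mu>_def \<xi>v)
  qed
  then show thesis
    using that[of \<pi> \<kappa>] bij \<kappa> unfolding m_def[abs_def] by blast
qed

subsection \<open>Simple polytopes in polar position\<close>

text \<open>A further halfspace with \<open>v\<close> on its boundary would give n + 1 hyperplanes
  through \<open>v\<close>, against general position. So the halfspaces other than those of the
  \<open>E r\<close> contain \<open>v\<close> in their interior and form \<open>K\<close>.\<close>

lemma (in polar) simple_polytope_polar:
  assumes simple: "simple_polytope P" and vP: "v \<in> P"
    and E: "bij_betw E UNIV {G. G facet_of P \<and> v \<in> G}"
  obtains H :: "(real^'n) set set" and K m where "finite H" "\<forall>h\<in>H. closed_halfspace h" "\<Inter>H = P"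
    "general_position H" "K \<subseteq> H" "polar_polytope i S D \<beta> s P v E T K m"
proof -
  obtain H :: "(real^'n) set set" where finH: "finite H" and hs: "\<forall>h\<in>H. closed_halfspace h" and PH: "P = \<Inter>H"
    and bd: "bounded P" and gp: "general_position H" and irr: "\<forall>h\<in>H. \<Inter>(H - {h}) \<noteq> P"
    using simple unfolding simple_polytope_def general_position_def by metis
  obtain a b where ab: "\<And>h. h \<in> H \<Longrightarrow> a h \<noteq> 0 \<and> h = {x. a h \<bullet> x \<le> b h}"
    using closed_halfspaces_choose[OF hs] by metis
  define m :: "(real^'n) set \<Rightarrow> (real^'n) \<times> real \<Rightarrow> real"
    where "m h Z = b h * snd Z - a h \<bullet> fst Z" for h Z
  have linm: "linear (m h)" for h
    by (rule linearI) (simp_all add: m_def inner_add_right algebra_simps)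
  define g where "g h x = m h (x, 1)" for h x
  have g: "g h x = b h - a h \<bullet> x" for h x by (simp add: g_def m_def)
  have aff: "affine_form (g h)" for h
    unfolding g_def[abs_def] by (rule affine_form_homogeneous[OF linm])
  interpret G: polyhedral UNIV H g
    by unfold_locales (auto simp: finH aff)
  have mem: "x \<in> h \<longleftrightarrow> 0 \<le> g h x" if "h \<in> H" for x h
  proof -
    have "x \<in> h \<longleftrightarrow> x \<in> {x. a h \<bullet> x \<le> b h}" using ab[OF that] by simp
    then show ?thesis by (simp add: g)
  qed
  have Pg: "P = polyh UNIV H g" unfolding PH polyh_def using mem by blast
  have gnz: "\<exists>x. g h x \<noteq> 0" if "h \<in> H" for h
  proof (rule ccontr)
    assume "\<not> (\<exists>x. g h x \<noteq> 0)"
    then have z: "a h \<bullet> x = b h" for x by (auto simp: g)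
    then have "a h \<bullet> a h = 0" using z[of 0] z[of "a h"] by simp
    then show False using ab[OF that] by simp
  qed
  have "\<exists>h l. h \<in> H \<and> g h v = 0 \<and> l > 0 \<and> (\<forall>x. g h x = l * y r x)" for r
  proof -
    have "E r facet_of P" "v \<in> E r" using E bij_betwE by blast+
    then show ?thesis
      using facet_functional[OF G.polyhedral_axioms Pg gnz] by blast
  qed
  then obtain hf l where hf: "\<And>r. hf r \<in> H" "\<And>r. g (hf r) v = 0" "\<And>r. l r > (0::real)"
    "\<And>r x. g (hf r) x = l r * y r x" by metis
  have inj: "inj hf"
  proof (rule injI, rule ccontr)
    fix r q assume eq: "hf r = hf q" and ne: "r \<noteq> q"
    obtain e where "\<forall>p. y p e = (if p = r then 1 else 0)"
      using coordinates_surj[of "\<lambda>p. if p = r then 1 else 0"] by blast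
    then have "y r e = 1" "y q e = 0" using ne by auto
    then have "l r = 0" using hf(4)[of r e] hf(4)[of q e] unfolding eq by simp
    then show False using hf(3)[of r] by simp
  qed
  define K where "K = {h \<in> H. 0 < g h v}"
  have notK: "h \<in> range hf" if h: "h \<in> H" "h \<notin> K" for h
  proof (rule ccontr)
    assume new: "h \<notin> range hf"
    have "g h v = 0" using h vP mem[OF h(1)] unfolding PH K_def by force
    have c: "card (insert h (range hf)) = CARD('n) + 1"
      using new inj by (simp add: card_image)
    have "v \<in> frontier d" if d: "d \<in> insert h (range hf)" for d
    proof -
      have dH: "d \<in> H" and "g d v = 0" using d h hf(1,2) \<open>g h v = 0\<close> by auto
      then have "v \<in> {x. a d \<bullet> x = b d}" by (simp add: g)
      also have "\<dots> = frontier d"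
        using ab[OF dH] frontier_halfspace_le[of "a d" "b d"] by metis
      finally show ?thesis .
    qed
    then have "\<Inter>(frontier ` insert h (range hf)) \<noteq> {}" by blast
    moreover have "insert h (range hf) \<subseteq> H" using h(1) hf(1) by blast
    ultimately show False using gp c unfolding general_position_def by blast
  qed
  have Py: "P = {x. (\<forall>r. 0 \<le> y r x) \<and> (\<forall>h\<in>K. 0 \<le> m h (x, 1))}"
  proof (intro set_eqI iffI)
    fix x assume x: "x \<in> P"
    then show "x \<in> {x. (\<forall>r. 0 \<le> y r x) \<and> (\<forall>h\<in>K. 0 \<le> m h (x, 1))}"
      using y_nonneg[OF x] unfolding Pg K_def polyh_def g_def by blast
  next
    fix x assume x: "x \<in> {x. (\<forall>r. 0 \<le> y r x) \<and> (\<forall>h\<in>K. 0 \<le> m h (x, 1))}"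
    have "0 \<le> g h x" if h: "h \<in> H" for h
    proof (cases "h \<in> K")
      case False
      then obtain r where "h = hf r" using notK h by blast
      then show ?thesis using hf(3)[of r] hf(4)[of r x] x by simp
    qed (use x in \<open>simp add: g_def\<close>)
    then show "x \<in> P" unfolding Pg polyh_def by simp
  qed
  \<comment> \<open>The facet \<open>E r\<close> spans a hyperplane, so \<open>P\<close> has full
    dimension and hence an interior point.\<close>
  obtain x0 where x0: "\<And>h. h \<in> H \<Longrightarrow> 0 < g h x0"
  proof -
    obtain r :: 'n where True by blast
    have Er: "E r facet_of P" using E bij_betwE by blast
    have "{x. y r x = 0} = {x. a (hf r) \<bullet> x = b (hf r)}"
    proof (intro set_eqI)
      fix x
      have "y r x = 0 \<longleftrightarrow> g (hf r) x = 0" using hf(3)[of r] hf(4)[of r x] by simp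
      then show "x \<in> {x. y r x = 0} \<longleftrightarrow> x \<in> {x. a (hf r) \<bullet> x = b (hf r)}" by (auto simp: g)
    qed
    then have "aff_dim (E r) = int CARD('n) - 1"
      using hyperplane_facet[of r] aff_dim_affine_hull[of "E r"] ab[OF hf(1)[of r]]
        aff_dim_hyperplane[of "a (hf r)" "b (hf r)"] by simp
    then have "aff_dim P = int (DIM(real^'n))" using Er unfolding facet_of_def by simp
    then have "affine hull P = UNIV" by (simp add: affine_hull_UNIV[symmetric] aff_dim_eq_full)
    moreover have "convex P" using G.tight_face[of "{}"] face_of_imp_convex unfolding Pg by force
    ultimately have "interior P \<noteq> {}"
      using rel_interior_eq_empty[of P] rel_interior_interior[of P] vP by auto
    then obtain x0 where x0: "x0 \<in> interior P" by blast
    have "0 < g h x0" if h: "h \<in> H" for h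
    proof -
      have "x0 \<in> interior h" using x0 h interior_mono[of P h] unfolding PH by blast
      also have "interior h = {x. a h \<bullet> x < b h}"
        using ab[OF h] interior_halfspace_le[of "a h" "b h"] by metis
      finally show ?thesis by (simp add: g)
    qed
    then show thesis using that by blast
  qed
  have fac: "\<exists>C. C facet_of P \<and> v \<notin> C \<and> affine hull C = {x. m h (x, 1) = 0}" if hK: "h \<in> K" for h
  proof -
    have h: "h \<in> H" "0 < g h v" using hK by (auto simp: K_def)
    have "\<Inter>(H - {h}) \<noteq> P" using irr h by blast
    moreover have "P \<subseteq> \<Inter>(H - {h})" unfolding PH by blast
    ultimately obtain x1 where x1: "x1 \<in> \<Inter>(H - {h})" "x1 \<notin> P" by blast
    then have neg: "g h x1 < 0" using mem[OF h(1), of x1] unfolding PH by force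
    have others: "0 \<le> g d x1" if "d \<in> H - {h}" for d using x1 mem[of d x1] that by blast
    \<comment> \<open>The parameter at which the segment from the interior point \<open>x0\<close>
      to \<open>x1\<close>, which violates only \<open>h\<close>, crosses the hyperplane of
      \<open>h\<close>.\<close>
    define u where "u = g h x0 / (g h x0 - g h x1)"
    have u: "0 < u" "u < 1" using neg x0[OF h(1)] unfolding u_def by (auto simp: field_simps)
    define x where "x = (1 - u) *\<^sub>R x0 + u *\<^sub>R x1"
    have gx: "g d x = (1 - u) * g d x0 + u * g d x1" for d
      unfolding x_def by (rule affine_form_convex_comb[OF aff])
    have "g h x = g h x0 - u * (g h x0 - g h x1)" unfolding gx by (simp add: algebra_simps)
    then have 0: "g h x = 0" using neg x0[OF h(1)] unfolding u_def by simp
    have pos: "0 < g d x" if "d \<in> H - {h}" for d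
      unfolding gx using u x0[of d] others[OF that] that by (intro add_pos_nonneg) auto
    have xP: "x \<in> polyh UNIV H g"
    proof -
      have "0 \<le> g d x" if "d \<in> H" for d using 0 pos[of d] that by (cases "d = h") auto
      then show ?thesis by (simp add: polyh_def)
    qed
    have xt: "tight H g x = {h}" unfolding tight_def using 0 pos h(1) by force
    have vP': "v \<in> polyh UNIV H g" using vP Pg by simp
    note fac = G.facet_of_unique_tight[OF refl xP xt vP' h(2)]
    then have "{x \<in> P. g h x = 0} facet_of P" "affine hull {x \<in> P. g h x = 0} = {x. g h x = 0}"
      unfolding Pg[symmetric] by blast+
    then show ?thesis
      using h(2) by (intro exI[of _ "{x \<in> P. g h x = 0}"]) (auto simp: g_def)
  qed
  have "polar_polytope i S D \<beta> s P v E T K m"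
  proof unfold_locales
    show "m h (p + q) = m h p + m h q" for h p q by (rule linear_add[OF linm])
    show "m h (c *\<^sub>R p) = c *\<^sub>R m h p" for h c p by (rule linear_scale[OF linm])
    show "0 < m h (v, 1)" if "h \<in> K" for h using that by (simp add: K_def g_def)
  qed (use vP bd Py fac in auto)
  moreover have "K \<subseteq> H" by (auto simp: K_def)
  ultimately show thesis by (intro that[OF finH hs PH[symmetric] gp])
qed

subsection \<open>Truncation near a vertex\<close>

lemma affine_form_shift_sum:
  assumes "affine_form f"
  shows "f (x + (\<Sum>i\<in>A. t i *\<^sub>R (a i - b))) = f x + (\<Sum>i\<in>A. t i * (f (a i) - f b))"
  using assms unfolding affine_form_def
  by (auto simp: inner_add_right inner_diff_right inner_sum_right)

lemma affine_form_halfspace: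
  fixes f :: "real^'n \<Rightarrow> real"
  assumes f: "affine_form f" and nc: "f p \<noteq> f q"
  obtains a b where "a \<noteq> 0" "\<And>c. {x. c \<le> f x} = {x. a \<bullet> x \<le> b - c}"
    "\<And>c. interior {x. c \<le> f x} = {x. c < f x}"
proof -
  obtain a b where ab: "f = (\<lambda>x. a \<bullet> x + b)" using f unfolding affine_form_def by auto
  have a: "- a \<noteq> 0" using nc ab by auto
  have 1: "{x. c \<le> f x} = {x. (- a) \<bullet> x \<le> b - c}" for c using ab by auto
  have "interior {x. c \<le> f x} = {x. c < f x}" for c
  proof -
    have "{x. c < f x} = {x. (- a) \<bullet> x < b - c}" using ab by auto
    then show ?thesis using interior_halfspace_le[OF a, of "b - c"] 1[of c] by (simp only:)
  qed
  then show thesis by (rule that[OF a 1])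
qed

context polar_polytope
begin

text \<open>In the cone of nonnegative coordinates each \<open>m c\<close> decreases at most at a
  fixed rate relative to \<sigma>, so it stays positive close to the pole. All cuts will take place
  in this region.\<close>

lemma pole_margin:
  assumes fin: "finite J"
  obtains \<rho> where "\<rho> > 0"
    "\<And>x c. (\<And>r. 0 \<le> y r x) \<Longrightarrow> \<sigma> x \<le> \<rho> \<Longrightarrow> c \<in> J \<Longrightarrow> 0 < m c (x, 1)"
proof -
  have "\<exists>e. \<forall>r. y r e = (if r = q then 1 else 0)" for q
    by (rule coordinates_surj)
  then obtain e where e: "\<And>q r. y r (e q) = (if r = q then 1 else 0)" by metis
  define G where "G c = (\<Sum>q\<in>UNIV. \<bar>m c (e q, 1) - m c (v, 1)\<bar>)" for c
  have G0: "0 \<le> G c" for c unfolding G_def by (simp add: sum_nonneg)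
  have lower: "m c (v, 1) - \<sigma> x * G c \<le> m c (x, 1)" if c: "c \<in> J" and x: "\<And>r. 0 \<le> y r x" for c x
  proof -
    have "x = v + (\<Sum>q\<in>UNIV. y q x *\<^sub>R (e q - v))"
    proof (rule coordinates_eqI)
      fix r
      have "y r (v + (\<Sum>q\<in>UNIV. y q x *\<^sub>R (e q - v))) = (\<Sum>q\<in>UNIV. y q x * (if r = q then 1 else 0))"
        unfolding affine_form_shift_sum[OF affine_form_y] by (simp add: y_pole e)
      also have "\<dots> = y r x" by (simp add: if_distrib cong: if_cong)
      finally show "y r x = y r (v + (\<Sum>q\<in>UNIV. y q x *\<^sub>R (e q - v)))" by simp
    qed
    then have "m c (x, 1) = m c (v + (\<Sum>q\<in>UNIV. y q x *\<^sub>R (e q - v)), 1)" by simp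
    also have "\<dots> = m c (v, 1) + (\<Sum>q\<in>UNIV. y q x * (m c (e q, 1) - m c (v, 1)))"
      using affine_form_shift_sum[OF affine_form_homogeneous[OF linm[OF c]]] .
    finally have eq: "m c (x, 1) = m c (v, 1) + (\<Sum>q\<in>UNIV. y q x * (m c (e q, 1) - m c (v, 1)))" .
    have "- (\<Sum>q\<in>UNIV. y q x * (m c (e q, 1) - m c (v, 1))) \<le> (\<Sum>q\<in>UNIV. \<sigma> x * \<bar>m c (e q, 1) - m c (v, 1)\<bar>)"
      unfolding sum_negf[symmetric]
    proof (rule sum_mono)
      fix q
      have "y q x \<le> \<sigma> x" using member_le_sum[of q UNIV "\<lambda>r. y r x"] x by (simp add: sum_y)
      have "- (y q x * (m c (e q, 1) - m c (v, 1))) \<le> y q x * \<bar>m c (e q, 1) - m c (v, 1)\<bar>"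
        using x[of q] by (metis abs_ge_minus_self mult_left_mono mult_minus_right)
      also have "\<dots> \<le> \<sigma> x * \<bar>m c (e q, 1) - m c (v, 1)\<bar>"
        using \<open>y q x \<le> \<sigma> x\<close> by (rule mult_right_mono) simp
      finally show "- (y q x * (m c (e q, 1) - m c (v, 1))) \<le> \<sigma> x * \<bar>m c (e q, 1) - m c (v, 1)\<bar>" .
    qed
    then show ?thesis unfolding eq G_def by (simp add: sum_distrib_left)
  qed
  \<comment> \<open>Chosen so that at least half of \<open>m c (v, 1)\<close> survives. Adding 1 to
    \<open>G c\<close> avoids division by zero, and the entry 1 covers an empty
    \<open>J\<close>.\<close>
  define \<rho> where "\<rho> = Min (insert 1 ((\<lambda>c. m c (v, 1) / (2 * (1 + G c))) ` J))"
  have "\<rho> > 0" unfolding \<rho>_def using fin m_pole G0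
    by (subst Min_gr_iff) (auto intro!: divide_pos_pos simp: add_pos_nonneg)
  moreover have "0 < m c (x, 1)" if x: "\<And>r. 0 \<le> y r x" and le: "\<sigma> x \<le> \<rho>" and c: "c \<in> J" for x c
  proof -
    have "\<rho> \<le> m c (v, 1) / (2 * (1 + G c))" unfolding \<rho>_def using fin c by (intro Min_le) auto
    then have "\<rho> * (1 + G c) \<le> m c (v, 1) / 2"
      using G0[of c] by (simp add: field_simps add_pos_nonneg)
    moreover have "\<sigma> x * (1 + G c) \<le> \<rho> * (1 + G c)" using le G0[of c] by (intro mult_right_mono) auto
    ultimately have "\<sigma> x * (1 + G c) \<le> m c (v, 1) / 2" by linarith
    moreover have "0 \<le> \<sigma> x" unfolding sum_y[symmetric] using x by (simp add: sum_nonneg)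
    ultimately have "\<sigma> x * G c \<le> m c (v, 1) / 2" by (simp add: algebra_simps)
    then show ?thesis using lower[OF c x] m_pole[OF c] by linarith
  qed
  ultimately show thesis using that by blast
qed

definition bsum :: "'n set \<Rightarrow> real^'n \<Rightarrow> real" where "bsum A x = (\<Sum>r\<in>A. y r x)"

text \<open>Halving the block sum keeps \<open>cutf A x\<close> between \<open>\<sigma> x / 2\<close> and \<open>\<sigma> x\<close>, so that every cut at a small
  level stays close to the pole; for the empty block the cut is the one that removes a vertex.\<close>
definition cutf :: "'n set \<Rightarrow> real^'n \<Rightarrow> real" where "cutf A x = \<sigma> x - bsum A x / 2"

lemma affine_form_\<sigma>: "affine_form \<sigma>"
proof -
  have "affine_form (\<lambda>x. \<Sum>r\<in>UNIV. y r x)" by (rule affine_form_sum) (rule affine_form_y)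
  then show ?thesis by (simp add: sum_y)
qed

lemma affine_form_cut: "affine_form (cutf A)"
proof -
  have "affine_form (\<lambda>x. \<sigma> x - (1/2) * bsum A x)"
    unfolding bsum_def
    by (intro affine_form_diff affine_form_scale affine_form_sum affine_form_y affine_form_\<sigma>)
  then show ?thesis by (simp add: cutf_def[abs_def])
qed

lemma bsum_nonneg: "(\<And>r. 0 \<le> y r x) \<Longrightarrow> 0 \<le> bsum A x"
  unfolding bsum_def by (simp add: sum_nonneg)

lemma bsum_le_\<sigma>: "(\<And>r. 0 \<le> y r x) \<Longrightarrow> bsum A x \<le> \<sigma> x"
  unfolding bsum_def sum_y[symmetric] by (intro sum_mono2) auto

lemma cut_bounds:
  assumes "\<And>r. 0 \<le> y r x"
  shows "\<sigma> x / 2 \<le> cutf A x" "cutf A x \<le> \<sigma> x"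
  using bsum_nonneg[of x A] bsum_le_\<sigma>[of x A] assms unfolding cutf_def by auto

lemma cut_pole: "cutf A v = 0"
  by (simp add: cutf_def bsum_def \<sigma>_pole y_pole)

lemma cut_halfspace:
  obtains a b where "a \<noteq> 0" "\<And>c. {x. c \<le> cutf A x} = {x. a \<bullet> x \<le> b - c}"
    "\<And>c. interior {x. c \<le> cutf A x} = {x. c < cutf A x}"
proof -
  obtain e where e: "\<forall>r. y r e = 1" using coordinates_surj[of "\<lambda>_. 1"] by blast
  then have "\<sigma> e > 0" unfolding sum_y[symmetric] by simp
  then have "cutf A e > 0" using cut_bounds(1)[of e A] e by simp
  then have "cutf A e \<noteq> cutf A v" by (simp add: cut_pole)
  then show thesis using affine_form_halfspace[OF affine_form_cut, of A e v] that by metis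
qed

lemma closed_halfspace_cut: "closed_halfspace {x. c \<le> cutf A x}"
proof -
  obtain a b where "a \<noteq> 0" "{x. c \<le> cutf A x} = {x. a \<bullet> x \<le> b - c}"
    using cut_halfspace[of A] by metis
  then show ?thesis unfolding closed_halfspace_def by blast
qed

lemma interior_cut: "interior {x. c \<le> cutf A x} = {x. c < cutf A x}"
  by (rule cut_halfspace[of A]) blast

lemma cone_point:
  assumes "0 \<le> t"
  shows "\<exists>x. (\<forall>r. 0 \<le> y r x) \<and> \<sigma> x = t"
proof -
  obtain x where x: "\<forall>r. y r x = t / CARD('n)"
    using coordinates_surj[of "\<lambda>_. t / CARD('n)"] by blast
  then have "\<sigma> x = t" unfolding sum_y[symmetric] by simp
  then show ?thesis using x assms by (intro exI[of _ x]) simp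
qed

definition stage :: "(nat \<Rightarrow> 'n set) \<Rightarrow> (nat \<Rightarrow> real) \<Rightarrow> nat \<Rightarrow> (real^'n) set" where
  "stage C l p = {x \<in> P. \<forall>q\<in>{1..p}. l q \<le> cutf (C q) x}"

text \<open>Levels are chosen one after another: between the previous level and \<open>U\<close>
  there are infinitely many values, of which only finitely many violate general position. The point
  \<open>x0\<close> survives all cuts, so the intersections stay nonempty.\<close>

lemma generic_levels:
  fixes C :: "nat \<Rightarrow> 'n set" and k :: nat
  assumes H: "finite H" "\<forall>h\<in>H. closed_halfspace h" "\<Inter>H = P" "general_position H"
    and LU: "L < U" and far: "x0 \<in> P" "\<And>A. U \<le> cutf A x0"
  shows "\<exists>l. (\<forall>q\<in>{1..p}. L < l q \<and> l q < U) \<and> (\<forall>q q'. 1 \<le> q \<and> q < q' \<and> q' \<le> p \<longrightarrow> l q < l q') \<and>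
    general_position (H \<union> (\<lambda>q. {x. l q \<le> cutf (C q) x}) ` {1..p})"
proof (induction p)
  case 0
  then show ?case using H(4) by auto
next
  case (Suc p)
  then obtain l where l: "\<forall>q\<in>{1..p}. L < l q \<and> l q < U"
    "\<forall>q q'. 1 \<le> q \<and> q < q' \<and> q' \<le> p \<longrightarrow> l q < l q'"
    and gp: "general_position (H \<union> (\<lambda>q. {x. l q \<le> cutf (C q) x}) ` {1..p})" by blast
  let ?H = "H \<union> (\<lambda>q. {x. l q \<le> cutf (C q) x}) ` {1..p}"
  obtain a b where ab: "a \<noteq> 0" "\<And>c. {x. c \<le> cutf (C (Suc p)) x} = {x. a \<bullet> x \<le> b - c}"
    using cut_halfspace[of "C (Suc p)"] by metis
  have "x0 \<in> \<Inter>?H"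
  proof
    fix h assume "h \<in> ?H"
    then consider "h \<in> H" | q where "q \<in> {1..p}" "h = {x. l q \<le> cutf (C q) x}" by blast
    then show "x0 \<in> h"
    proof cases
      case 2
      then have "l q < U" using l by blast
      then show ?thesis using 2(2) far(2)[of "C q"] by simp
    qed (use far(1) H(3) in blast)
  qed
  then have ne: "\<Inter>?H \<noteq> {}" by blast
  have "\<Inter>?H \<subseteq> P" using H(3) by blast
  then have bd: "bounded (\<Inter>?H)" using bdP bounded_subset by blast
  have "\<forall>h\<in>?H. closed_halfspace h" using H(2) closed_halfspace_cut by blast
  then have "finite {c. \<not> general_position (insert {x. a \<bullet> x \<le> c} ?H)}"
    using general_position_insert_generic[OF _ gp _ ne bd ab(1)] H(1) by simp
  then have bad: "finite ((\<lambda>c. b - c) ` {c. \<not> general_position (insert {x. a \<bullet> x \<le> c} ?H)})" (is "finite ?bad")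
    by (rule finite_imageI)
  define L' where "L' = (if p = 0 then L else l p)"
  have "L' < U" "L \<le> L'" using LU l(1)[rule_format, of p] by (auto simp: L'_def)
  then have "infinite ({L'<..<U} - ?bad)" using bad by simp
  then have "{L'<..<U} - ?bad \<noteq> {}" by (metis finite.emptyI)
  then obtain c where "c \<in> {L'<..<U} - ?bad" by (meson ex_in_conv)
  then have c: "L' < c" "c < U" "c \<notin> ?bad" by (simp_all only: Diff_iff greaterThanLessThan_iff simp_thms)
  have "general_position (insert {x. a \<bullet> x \<le> b - c} ?H)"
  proof (rule ccontr)
    assume "\<not> general_position (insert {x. a \<bullet> x \<le> b - c} ?H)"
    then have "b - (b - c) \<in> ?bad" by (intro imageI CollectI)
    moreover have "b - (b - c) = c" by simp
    ultimately show False using c(3) by (simp only: simp_thms)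
  qed
  then have gpc: "general_position (insert {x. c \<le> cutf (C (Suc p)) x} ?H)" unfolding ab(2) .
  define l' where "l' = l(Suc p := c)"
  have l'q: "l' q = l q" if "q \<in> {1..p}" for q using that by (simp add: l'_def)
  have "(\<lambda>q. {x. l' q \<le> cutf (C q) x}) ` {1..p} = (\<lambda>q. {x. l q \<le> cutf (C q) x}) ` {1..p}"
    using l'q by (intro image_cong) auto
  moreover have "{1..Suc p} = insert (Suc p) {1..p}" by auto
  ultimately have "H \<union> (\<lambda>q. {x. l' q \<le> cutf (C q) x}) ` {1..Suc p} = insert {x. c \<le> cutf (C (Suc p)) x} ?H"
    by (simp add: l'_def)
  then have "general_position (H \<union> (\<lambda>q. {x. l' q \<le> cutf (C q) x}) ` {1..Suc p})" using gpc by simp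
  moreover have "\<forall>q\<in>{1..Suc p}. L < l' q \<and> l' q < U"
    using l(1) c \<open>L \<le> L'\<close> by (auto simp: l'_def)
  moreover have "l' q < l' q'" if "1 \<le> q" "q < q'" "q' \<le> Suc p" for q q'
  proof (cases "q' = Suc p")
    case True
    then have "q \<le> p" "p \<noteq> 0" using that by auto
    then have "l q \<le> l p" using l(2) that(1) by (metis le_neq_implies_less less_eq_real_def order_refl)
    then show ?thesis using True c(1) \<open>q \<le> p\<close> \<open>p \<noteq> 0\<close> by (simp add: l'_def L'_def)
  next
    case False
    then show ?thesis using that l(2) by (simp add: l'_def)
  qed
  ultimately show ?case by blast
qed

end

text \<open>\<open>l_upper\<close> puts each level below (1 + 1/(2k)) L. By \<open>l_margin\<close>,
  a point of \<open>P\<close> on a cut has \<sigma> \<le> 2 l q < \<rho> and is near the pole.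
  \<open>Ck\<close> leaves coordinates outside the first p blocks for every p < k; without them the
  later pruned faces would be empty.\<close>

locale truncation = polar_polytope i S D \<beta> s P v E T J m
  for i :: "'n::finite" and S :: "(real^'n) set" and D :: "'n \<Rightarrow> (real^'n) set"
    and \<beta> :: "'n \<Rightarrow> (real^'n) \<times> real \<Rightarrow> real" and s :: real
    and P :: "(real^'n) set" and v :: "real^'n" and E :: "'n \<Rightarrow> (real^'n) set"
    and T :: "(real^'n) \<times> real \<Rightarrow> (real^'n) \<times> real"
    and J :: "'c set" and m :: "'c \<Rightarrow> (real^'n) \<times> real \<Rightarrow> real" +
  fixes k :: nat and C :: "nat \<Rightarrow> 'n set" and \<rho> L :: real and l :: "nat \<Rightarrow> real"
  assumes finJ: "finite J" and k1: "1 \<le> k" and disC: "disjoint_family_on C {1..k}"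
    and cover: "(\<Union>q\<in>{1..k}. C q) = UNIV" and Ck: "C k \<noteq> {}"
    and margin: "\<And>x c. (\<And>r. 0 \<le> y r x) \<Longrightarrow> \<sigma> x \<le> \<rho> \<Longrightarrow> c \<in> J \<Longrightarrow> 0 < m c (x, 1)"
    and L0: "0 < L" and l_lower: "\<And>q. q \<in> {1..k} \<Longrightarrow> L < l q"
    and l_upper: "\<And>q. q \<in> {1..k} \<Longrightarrow> 2 * k * l q < (2 * k + 1) * L"
    and l_mono: "\<And>q q'. 1 \<le> q \<Longrightarrow> q < q' \<Longrightarrow> q' \<le> k \<Longrightarrow> l q < l q'"
    and l_margin: "\<And>q. q \<in> {1..k} \<Longrightarrow> 2 * l q < \<rho>"
    and simple_stage: "\<And>p. p \<le> k \<Longrightarrow> simple_polytope (stage C l p)"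
begin

lemma \<rho>0: "0 < \<rho>"
  using l_margin[of 1] l_lower[of 1] L0 k1 by simp

lemma bsum_cover: "(\<Sum>q\<in>{1..k}. bsum (C q) x) = \<sigma> x"
proof -
  have "(\<Sum>q\<in>{1..k}. bsum (C q) x) = (\<Sum>r\<in>(\<Union>q\<in>{1..k}. C q). y r x)"
    unfolding bsum_def using disC
    by (intro sum.UNION_disjoint[symmetric]) (auto simp: disjoint_family_on_def)
  then show ?thesis unfolding cover sum_y .
qed

lemma mem_P: "x \<in> P \<longleftrightarrow> (\<forall>r. 0 \<le> y r x) \<and> (\<forall>c\<in>J. 0 \<le> m c (x, 1))"
  by (subst P_eq) simp

lemma mem_P_cone: "(\<And>r. 0 \<le> y r x) \<Longrightarrow> \<sigma> x \<le> \<rho> \<Longrightarrow> x \<in> P"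
  unfolding mem_P using margin[of x] by (simp add: less_imp_le)

lemma far_from_pole:
  assumes "x \<in> P" "c \<in> J" "m c (x, 1) = 0"
  shows "\<rho> < \<sigma> x"
  using margin[of x c] y_nonneg[OF assms(1)] assms(2,3) by force

lemma far_slack:
  assumes x: "x \<in> P" and far: "\<rho> \<le> \<sigma> x" and q: "q \<in> {1..k}"
  shows "l q < cutf A x"
  using cut_bounds(1)[of x A] y_nonneg[OF x] l_margin[OF q] far by auto

lemma stage_eq_polyh:
  "stage C l p = polyh UNIV (UNIV <+> ({1..p} <+> J))
    (join_form y (\<lambda>q x. cutf (C q) x - l q) (\<lambda>c x. m c (x, 1)))"
  unfolding stage_def polyh_join_form mem_P by auto

lemma polyhedral_stage:
  "polyhedral UNIV (UNIV <+> ({1..p} <+> J))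
    (join_form y (\<lambda>q x. cutf (C q) x - l q) (\<lambda>c x. m c (x, 1)))"
  by (intro polyhedral_join_form affine_form_y affine_form_diff affine_form_cut affine_form_const
      affine_form_homogeneous linm) (auto simp: finJ)

text \<open>On the hyperplane of cut p, \<sigma> is at least l p, and this face is where the minimum
  is attained. The next cut function does not exceed \<sigma> and has a higher level, so the whole
  face is removed.\<close>

definition pruned_face :: "nat \<Rightarrow> (real^'n) set" where
  "pruned_face p = (if p = 0 then {v}
     else {x \<in> stage C l p. cutf (C p) x = l p \<and> (\<forall>r\<in>C p. y r x = 0)})"

lemma pruned_face_\<sigma>:
  assumes "x \<in> pruned_face p" "p \<noteq> 0"
  shows "\<sigma> x = l p"
proof -
  have "bsum (C p) x = 0" "cutf (C p) x = l p"
    using assms by (auto simp: pruned_face_def bsum_def)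
  then show ?thesis by (simp add: cutf_def)
qed

lemma pruned_face_face: "pruned_face p face_of stage C l p"
proof -
  let ?I = "UNIV <+> ({1..p} <+> J)"
  let ?f = "join_form y (\<lambda>q x. cutf (C q) x - l q) (\<lambda>c x. m c (x, 1))"
  interpret F: polyhedral UNIV ?I ?f by (rule polyhedral_stage)
  let ?K = "if p = 0 then UNIV <+> ({} <+> {}) else C p <+> ({p} <+> {})"
  have KI: "?K \<subseteq> ?I" by auto
  have eq: "pruned_face p = {x \<in> stage C l p. ?K \<subseteq> tight ?I ?f x}"
  proof (cases "p = 0")
    case True
    have "x \<in> pruned_face p \<longleftrightarrow> x \<in> stage C l p \<and> ?K \<subseteq> tight ?I ?f x" for x
    proof
      assume "x \<in> pruned_face p"
      then have "x = v" using True by (simp add: pruned_face_def)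
      then show "x \<in> stage C l p \<and> ?K \<subseteq> tight ?I ?f x"
        using True vP y_pole by (auto simp: stage_def tight_join_form)
    next
      assume "x \<in> stage C l p \<and> ?K \<subseteq> tight ?I ?f x"
      then have "\<forall>r. y r x = 0" using True by (auto simp: tight_join_form)
      then have "x = v" using y_pole by (intro coordinates_eqI) simp
      then show "x \<in> pruned_face p" using True by (simp add: pruned_face_def)
    qed
    then show ?thesis by blast
  next
    case False
    have "?K \<subseteq> tight ?I ?f x \<longleftrightarrow> cutf (C p) x = l p \<and> (\<forall>r\<in>C p. y r x = 0)" for x
      using False by (auto simp: tight_join_form)
    then show ?thesis using False by (simp add: pruned_face_def)
  qed
  show ?thesis unfolding eq using F.tight_face[OF KI] unfolding stage_eq_polyh[symmetric] .
qed

lemma block_disjoint: "q \<in> {1..k} \<Longrightarrow> q' \<in> {1..k} \<Longrightarrow> q \<noteq> q' \<Longrightarrow> C q \<inter> C q' = {}"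
  using disC unfolding disjoint_family_on_def by blast

lemma pruned_face_nonempty:
  assumes p: "p < k"
  shows "pruned_face p \<noteq> {}"
proof (cases "p = 0")
  case False
  then have pk: "p \<in> {1..k}" using p by auto
  \<comment> \<open>All weight is put on block \<open>k\<close>, which is disjoint from the earlier
    ones, so each of the cuts 1, ..., p takes the value \<sigma> = l p.\<close>
  obtain x where x: "\<forall>r. y r x = (if r \<in> C k then l p / card (C k) else 0)"
    using coordinates_surj[of "\<lambda>r. if r \<in> C k then l p / card (C k) else 0"] by blast
  have lp: "0 < l p" using l_lower[OF pk] L0 by simp
  have y0: "0 \<le> y r x" for r using x lp by simp
  have "\<sigma> x = (\<Sum>r\<in>C k. l p / card (C k))"
    unfolding sum_y[symmetric] using x by (simp add: sum.If_cases)
  also have "\<dots> = l p" using Ck by simp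
  finally have \<sigma>: "\<sigma> x = l p" .
  have xP: "x \<in> P" using y0 \<sigma> l_margin[OF pk] lp by (intro mem_P_cone) auto
  have b0: "bsum (C q) x = 0 \<and> (\<forall>r\<in>C q. y r x = 0)" if "q \<in> {1..p}" for q
  proof -
    have "C q \<inter> C k = {}" using that p by (intro block_disjoint) auto
    then have "\<forall>r\<in>C q. y r x = 0" using x by auto
    then show ?thesis by (simp add: bsum_def)
  qed
  have "l q \<le> l p" if "q \<in> {1..p}" for q
    using l_mono[of q p] that p by (cases "q = p") (auto intro: less_imp_le)
  then have "x \<in> stage C l p" using xP b0 \<sigma> by (simp add: stage_def cutf_def)
  then have "x \<in> pruned_face p" using False b0[of p] \<sigma> by (simp add: pruned_face_def cutf_def)
  then show ?thesis by blast
qed (simp add: pruned_face_def)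

lemma far_point: obtains x where "\<And>p. p \<le> k \<Longrightarrow> x \<in> stage C l p" "\<sigma> x = \<rho>"
proof -
  obtain x where x: "\<forall>r. 0 \<le> y r x" "\<sigma> x = \<rho>" using cone_point[of \<rho>] \<rho>0 by auto
  then have xP: "x \<in> P" by (intro mem_P_cone) auto
  have "x \<in> stage C l p" if "p \<le> k" for p
    unfolding stage_def using xP far_slack[OF xP, of _ "C _"] x(2) that by (auto intro: less_imp_le)
  then show thesis using that x(2) by blast
qed

lemma pruned_face_proper:
  assumes p: "p < k"
  shows "pruned_face p \<noteq> stage C l p"
proof -
  obtain x where x: "x \<in> stage C l p" "\<sigma> x = \<rho>" using far_point p by (metis less_imp_le)
  have "x \<notin> pruned_face p"
  proof (cases "p = 0")
    case True
    then show ?thesis using x(2) \<rho>0 \<sigma>_pole by (auto simp: pruned_face_def)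
  next
    case False
    then show ?thesis
      using pruned_face_\<sigma>[of x p] x(2) l_margin[of p] l_lower[of p] L0 p by auto
  qed
  then show ?thesis using x(1) by blast
qed

text \<open>Up to the factor 2n - 1, a level is compared with 2n L / (2n - 1), a lower bound for
  \<sigma> where n cuts are tight and the other blocks vanish. The reason is that (2n - 1)(2k + 1) <
  4nk for n \<le> k.\<close>

lemma level_estimate:
  fixes n :: nat
  assumes n: "1 \<le> n" "n \<le> k" and q: "q \<in> {1..k}"
  shows "(2 * real n - 1) * l q < 2 * real n * L"
proof -
  have "(2 * real n - 1) * (2 * real k * l q) < (2 * real n - 1) * ((2 * real k + 1) * L)"
    using l_upper[OF q] n by (intro mult_strict_left_mono) (auto simp: algebra_simps)
  also have "\<dots> = (4 * real n * real k + (2 * (real n - real k) - 1)) * L"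
    by (simp add: algebra_simps)
  also have "\<dots> \<le> (4 * real n * real k) * L"
    using n L0 by (intro mult_right_mono) auto
  finally have "(2 * real k) * ((2 * real n - 1) * l q) < (2 * real k) * (2 * real n * L)"
    by (simp add: algebra_simps)
  moreover have "0 < 2 * real k" using k1 by simp
  ultimately show ?thesis by (simp only: mult_less_cancel_left_pos)
qed

text \<open>On the hyperplanes avoiding \<open>v\<close> all cuts are slack. At any other vertex,
  rigidity forces every positive coordinate into a block whose cut is tight; block p + 1 is not
  among these, so the next cut takes the value \<sigma>. Adding up the tight block sums determines
  \<sigma>, and \<open>level_estimate\<close> puts it above the next level.\<close>

lemma extreme_point_strict:
  assumes p: "p < k" and u: "u extreme_point_of stage C l p" and nF: "u \<notin> pruned_face p"
  shows "l (Suc p) < cutf (C (Suc p)) u"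
proof (cases "\<exists>c\<in>J. m c (u, 1) = 0")
  case True
  have "u \<in> P" using u unfolding extreme_point_of_def stage_def by blast
  then show ?thesis using True far_from_pole far_slack[of u "Suc p"] p by force
next
  case False
  let ?I = "UNIV <+> ({1..p} <+> J)"
  let ?f = "join_form y (\<lambda>q x. cutf (C q) x - l q) (\<lambda>c x. m c (x, 1))"
  interpret F: polyhedral UNIV ?I ?f by (rule polyhedral_stage)
  have uS: "u \<in> stage C l p" using u unfolding extreme_point_of_def by blast
  then have uP: "u \<in> P" and uq: "\<And>q. q \<in> {1..p} \<Longrightarrow> l q \<le> cutf (C q) u" by (auto simp: stage_def)
  note y0 = y_nonneg[OF uP]
  have rigid: "u' = u" if "\<And>r. y r u = 0 \<Longrightarrow> y r u' = 0"
    "\<And>q. q \<in> {1..p} \<Longrightarrow> cutf (C q) u = l q \<Longrightarrow> cutf (C q) u' = l q" for u'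
  proof (rule F.extreme_point_rigid)
    show "u extreme_point_of polyh UNIV ?I ?f" using u stage_eq_polyh by simp
    fix c assume "c \<in> tight ?I ?f u"
    then have "c \<in> {r. y r u = 0} <+> ({q \<in> {1..p}. cutf (C q) u - l q = 0} <+> {c \<in> J. m c (u, 1) = 0})"
      unfolding tight_join_form by simp
    then show "?f c u' = 0" using that False by (auto simp: join_form_def)
  qed simp
  have "p \<noteq> 0"
  proof
    assume p0: "p = 0"
    have "v = u" by (rule rigid) (use p0 y_pole in auto)
    then have "u \<in> pruned_face p" unfolding pruned_face_def using p0 by simp
    then show False using nF by blast
  qed
  then have p1: "p \<in> {1..p}" "p \<in> {1..k}" using p by auto
  \<comment> \<open>Otherwise cut p would be tight with vanishing block sum, and \<open>u\<close>
    would lie in the pruned face.\<close>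
  have \<sigma>p: "l p < \<sigma> u"
  proof (rule ccontr)
    assume "\<not> l p < \<sigma> u"
    then have "bsum (C p) u = 0" "cutf (C p) u = l p"
      using uq[OF p1(1)] bsum_nonneg[of u "C p"] y0 unfolding cutf_def by auto
    moreover from this(1) have "\<forall>r\<in>C p. y r u = 0"
      unfolding bsum_def using y0 by (simp add: sum_nonneg_eq_0_iff)
    ultimately show False using nF uS \<open>p \<noteq> 0\<close> by (simp add: pruned_face_def)
  qed
  define I where "I = {q \<in> {1..p}. cutf (C q) u = l q}"
  have finI: "finite I" by (simp add: I_def)
  have Ik: "q \<in> {1..k}" if "q \<in> I" for q using that p by (auto simp: I_def)
  have bI: "bsum (C q) u = 2 * (\<sigma> u - l q)" if "q \<in> I" for q
    using that by (simp add: I_def cutf_def)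
  have "\<exists>r\<in>C q. y r u \<noteq> 0" if q: "q \<in> I" for q
  proof (rule ccontr)
    assume "\<not> (\<exists>r\<in>C q. y r u \<noteq> 0)"
    then have "\<sigma> u = l q" using bI[OF q] by (simp add: bsum_def)
    moreover have "l q \<le> l p" using l_mono[of q p] q p by (cases "q = p") (auto simp: I_def intro: less_imp_le)
    ultimately show False using \<sigma>p by simp
  qed
  then obtain j where j: "\<And>q. q \<in> I \<Longrightarrow> j q \<in> C q" "\<And>q. q \<in> I \<Longrightarrow> y (j q) u \<noteq> 0" by metis
  have j_in: "j q \<in> C q' \<longleftrightarrow> q = q'" if "q \<in> I" "q' \<in> {1..k}" for q q'
    using j(1)[OF that(1)] block_disjoint[OF Ik[OF that(1)] that(2)] by blast
  have injj: "inj_on j I"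
    using j_in Ik by (intro inj_onI) metis
  \<comment> \<open>A positive coordinate outside the tight blocks would allow a motion along which \<open>\<sigma>\<close> grows by 1
    and the sum over each tight block by 2, keeping every tight inequality tight.\<close>
  have supp: "y r u = 0" if r: "r \<notin> (\<Union>q\<in>I. C q)" for r
  proof (rule ccontr)
    assume nz: "y r u \<noteq> 0"
    define d where "d q = (if q = r then 1 - 2 * real (card I) else if q \<in> j ` I then 2 else 0)" for q
    have rj: "r \<notin> j ` I" using r j(1) by blast
    obtain u' where u': "\<forall>q. y q u' = y q u + d q" using coordinates_surj[of "\<lambda>q. y q u + d q"] by blast
    have "sum d UNIV = d r + sum d (UNIV - {r})" by (simp add: sum.remove)
    also have "sum d (UNIV - {r}) = (\<Sum>q\<in>j ` I. 2)"
      using rj by (intro sum.mono_neutral_cong_right) (auto simp: d_def)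
    also have "\<dots> = 2 * real (card I)" using injj by (simp add: card_image)
    finally have d1: "sum d UNIV = 1" by (simp add: d_def)
    have \<sigma>': "\<sigma> u' = \<sigma> u + 1"
      unfolding sum_y[symmetric] using u' d1 by (simp add: sum.distrib)
    have "u' = u"
    proof (rule rigid)
      show "y q u' = 0" if "y q u = 0" for q
        using that nz j(2) u' by (auto simp: d_def)
      fix q assume q: "q \<in> {1..p}" "cutf (C q) u = l q"
      then have qI: "q \<in> I" by (simp add: I_def)
      have "sum d (C q) = (\<Sum>t\<in>{j q}. 2)"
      proof (rule sum.mono_neutral_cong_right)
        show "\<forall>t\<in>C q - {j q}. d t = 0"
        proof
          fix t assume t: "t \<in> C q - {j q}"
          then have "t \<notin> j ` I" using j_in Ik[OF qI] by auto
          moreover have "t \<noteq> r" using t r qI by blast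
          ultimately show "d t = 0" by (simp add: d_def)
        qed
      qed (use j(1)[OF qI] qI rj in \<open>auto simp: d_def\<close>)
      then have "bsum (C q) u' = bsum (C q) u + 2"
        unfolding bsum_def using u' by (simp add: sum.distrib)
      then show "cutf (C q) u' = l q" using q(2) \<sigma>' by (simp add: cutf_def add_divide_distrib)
    qed
    then show False using \<sigma>' by simp
  qed
  have "bsum (C (Suc p)) u = 0"
    unfolding bsum_def
  proof (rule sum.neutral, rule ballI)
    fix r assume r: "r \<in> C (Suc p)"
    have "C (Suc p) \<inter> C q = {}" if "q \<in> I" for q
      using that p by (intro block_disjoint) (auto simp: I_def)
    then show "y r u = 0" using r by (intro supp) blast
  qed
  then have cs: "cutf (C (Suc p)) u = \<sigma> u" by (simp add: cutf_def)
  have "\<sigma> u = (\<Sum>q\<in>I. bsum (C q) u)"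
  proof -
    have "\<sigma> u = (\<Sum>r\<in>(\<Union>q\<in>I. C q). y r u)"
      unfolding sum_y[symmetric] using supp by (intro sum.mono_neutral_right) auto
    also have "\<dots> = (\<Sum>q\<in>I. bsum (C q) u)"
      unfolding bsum_def using block_disjoint Ik finI by (intro sum.UNION_disjoint) auto
    finally show ?thesis .
  qed
  also have "\<dots> = (\<Sum>q\<in>I. 2 * \<sigma> u - 2 * l q)" using bI by (intro sum.cong) auto
  finally have eq: "(2 * real (card I) - 1) * \<sigma> u = (\<Sum>q\<in>I. 2 * l q)"
    by (simp add: sum_subtractf algebra_simps)
  have "I \<noteq> {}"
  proof
    assume "I = {}"
    then have "\<sigma> u = 0" using eq by simp
    then show False using \<sigma>p l_lower[OF p1(2)] L0 by simp
  qed
  then have n1: "1 \<le> card I" using finI by (simp add: Suc_leI card_gt_0_iff)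
  have "I \<subseteq> {1..k}" using Ik by blast
  then have n2: "card I \<le> k" using card_mono[of "{1..k}" I] by simp
  have "(\<Sum>q\<in>I. 2 * L) < (\<Sum>q\<in>I. 2 * l q)"
    using l_lower Ik finI \<open>I \<noteq> {}\<close> by (intro sum_strict_mono) auto
  then have "2 * real (card I) * L < (2 * real (card I) - 1) * \<sigma> u" using eq by simp
  moreover have "(2 * real (card I) - 1) * l (Suc p) < 2 * real (card I) * L"
    using n1 n2 p by (intro level_estimate) auto
  ultimately have "(2 * real (card I) - 1) * l (Suc p) < (2 * real (card I) - 1) * \<sigma> u" by linarith
  then have "l (Suc p) < \<sigma> u" using n1 by (simp add: mult_less_cancel_left_pos)
  then show ?thesis using cs by simp
qed

lemma pruned_face_violates:
  assumes p: "p < k" and u: "u \<in> pruned_face p"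
  shows "cutf (C (Suc p)) u < l (Suc p)"
proof (cases "p = 0")
  case True
  then have "u = v" using u by (simp add: pruned_face_def)
  then show ?thesis using l_lower[of "Suc p"] L0 p by (simp add: cut_pole)
next
  case False
  then have "u \<in> P" using u unfolding pruned_face_def stage_def by simp
  then have "cutf (C (Suc p)) u \<le> \<sigma> u" using cut_bounds(2) y_nonneg by blast
  also have "\<sigma> u = l p" using pruned_face_\<sigma> u False by blast
  also have "l p < l (Suc p)" using False p by (intro l_mono) auto
  finally show ?thesis .
qed

lemma pruning_stage:
  assumes p: "p < k"
  shows "pruning (pruned_face p) (stage C l p) (stage C l (Suc p))"
proof -
  let ?h = "{x. l (Suc p) \<le> cutf (C (Suc p)) x}"
  have "stage C l (Suc p) = stage C l p \<inter> ?h"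
    unfolding stage_def by (auto simp: atLeastAtMostSuc_conv)
  moreover have "if u \<in> pruned_face p then u \<notin> ?h else u \<in> interior ?h"
    if "u extreme_point_of stage C l p" for u
    using pruned_face_violates[OF p, of u] extreme_point_strict[OF p that] by (auto simp: interior_cut)
  ultimately have "\<exists>h. closed_halfspace h \<and>
      (\<forall>u. u extreme_point_of stage C l p \<longrightarrow> (if u \<in> pruned_face p then u \<notin> h else u \<in> interior h)) \<and>
      stage C l (Suc p) = stage C l p \<inter> h"
    using closed_halfspace_cut by blast
  then show ?thesis
    unfolding pruning_def using simple_stage[of p] p pruned_face_face pruned_face_nonempty[OF p]
      pruned_face_proper[OF p] by (intro conjI) auto
qed

end

subsection \<open>Pruned faces\<close>

lemma affine_level_set:
  assumes "affine_form f"
  shows "affine {x. f x = c}"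
proof -
  obtain a b where "f = (\<lambda>x. a \<bullet> x + b)" using assms unfolding affine_form_def by auto
  then have "{x. f x = c} = {x. a \<bullet> x = c - b}" by auto
  then show ?thesis by (simp add: affine_hyperplane)
qed

lemma is_simplex_product_singleton: "is_simplex_product {v :: real^'n}"
proof -
  have "polyhedral {v} ({} :: nat set) (\<lambda>_ _. 0)" "polyhedral {0 :: real^'n} ({} :: nat set) (\<lambda>_ _. 0)"
    by unfold_locales auto
  moreover have "tight ({} :: nat set) (\<lambda>_ _. 0) ` polyh {v} {} (\<lambda>_ _. 0)
      = tight ({} :: nat set) (\<lambda>_ _. 0) ` polyh {0 :: real^'n} {} (\<lambda>_ _. 0)"
    by (auto simp: tight_def polyh_def)
  ultimately have "polyh {v} ({} :: nat set) (\<lambda>_ _. 0) \<simeq>\<^sub>c polyh {0 :: real^'n} ({} :: nat set) (\<lambda>_ _. 0)"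
    by (rule combinatorially_equivalent_polyh)
  moreover have "polyh {v} ({} :: nat set) (\<lambda>_ _. 0) = {v}" "polyh {0} ({} :: nat set) (\<lambda>_ _. 0) = {0 :: real^'n}"
    by (auto simp: polyh_def)
  moreover have "simplex_product 0 (\<lambda>_. {}) = {0 :: real^'n}"
    by (auto simp: simplex_product_def vec_eq_iff)
  ultimately show ?thesis
    unfolding is_simplex_product_def
    by (intro exI[of _ 0] exI[of _ "\<lambda>_. {}"]) (auto simp: disjoint_family_on_def)
qed

context truncation
begin

definition rest :: "nat \<Rightarrow> 'n set" where "rest p = - (\<Union>q\<in>{1..p}. C q)"

definition rblock :: "nat \<Rightarrow> nat \<Rightarrow> 'n set" where "rblock p q = (if q = p then rest p else C q)"

lemma rblock_family:
  assumes "1 \<le> p" "p < k"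
  shows "disjoint_family_on (rblock p) {1..p}" "(\<Union>q\<in>{1..p}. rblock p q) = - C p"
proof -
  have dis: "C q \<inter> C q' = {}" if "q \<in> {1..p}" "q' \<in> {1..p}" "q \<noteq> q'" for q q'
    using that assms by (intro block_disjoint) auto
  have rest: "C q \<inter> rest p = {}" if "q \<in> {1..p}" for q using that by (auto simp: rest_def)
  show "disjoint_family_on (rblock p) {1..p}"
    unfolding disjoint_family_on_def
  proof (intro ballI impI)
    fix q q' assume q: "q \<in> {1..p}" "q' \<in> {1..p}" "q \<noteq> q'"
    then show "rblock p q \<inter> rblock p q' = {}"
      using dis[OF q] rest[OF q(1)] rest[OF q(2)] by (auto simp: rblock_def)
  qed
  show "(\<Union>q\<in>{1..p}. rblock p q) = - C p"
  proof (intro equalityI subsetI)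
    fix r assume "r \<in> (\<Union>q\<in>{1..p}. rblock p q)"
    then obtain q where q: "q \<in> {1..p}" "r \<in> rblock p q" by blast
    then show "r \<in> - C p"
      using dis[of q p] rest[of p] assms by (cases "q = p") (auto simp: rblock_def)
  next
    fix r assume r: "r \<in> - C p"
    show "r \<in> (\<Union>q\<in>{1..p}. rblock p q)"
    proof (cases "r \<in> rest p")
      case True
      then have "r \<in> rblock p p" by (simp add: rblock_def)
      then show ?thesis using assms by auto
    next
      case False
      then obtain q where q: "q \<in> {1..p}" "r \<in> C q" by (auto simp: rest_def)
      then have "r \<in> rblock p q" using r by (auto simp: rblock_def)
      then show ?thesis using q by blast
    qed
  qed
qed

lemma rest_nonempty:
  assumes "p < k" shows "rest p \<noteq> {}"
proof -
  have "C k \<inter> C q = {}" if "q \<in> {1..p}" for q using that assms by (intro block_disjoint) auto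
  then show ?thesis using Ck unfolding rest_def by blast
qed

lemma rest_subset: "1 \<le> p \<Longrightarrow> rest p \<subseteq> - C p"
  by (auto simp: rest_def)

lemma sum_rblocks:
  fixes g :: "'n \<Rightarrow> real"
  assumes "1 \<le> p" "p < k"
  shows "(\<Sum>r\<in>- C p. g r) = (\<Sum>r\<in>rest p. g r) + (\<Sum>q\<in>{1..<p}. \<Sum>r\<in>C q. g r)"
proof -
  have "(\<Sum>r\<in>- C p. g r) = (\<Sum>q\<in>{1..p}. \<Sum>r\<in>rblock p q. g r)"
    unfolding rblock_family(2)[OF assms, symmetric] using rblock_family(1)[OF assms]
    by (intro sum.UNION_disjoint) (auto simp: disjoint_family_on_def)
  also have "{1..p} = insert p {1..<p}" using assms by auto
  also have "(\<Sum>q\<in>insert p {1..<p}. \<Sum>r\<in>rblock p q. g r)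
      = (\<Sum>r\<in>rblock p p. g r) + (\<Sum>q\<in>{1..<p}. \<Sum>r\<in>rblock p q. g r)" by simp
  also have "(\<Sum>q\<in>{1..<p}. \<Sum>r\<in>rblock p q. g r) = (\<Sum>q\<in>{1..<p}. \<Sum>r\<in>C q. g r)"
    by (intro sum.cong) (auto simp: rblock_def)
  finally show ?thesis by (simp add: rblock_def)
qed

text \<open>Cut p and the vanishing of \<open>C p\<close> are equations of the flat, so only the
  other coordinates and the earlier cuts are indexed. The empty third part fits the set to
  \<open>join_form\<close>.\<close>

definition face_index :: "nat \<Rightarrow> ('n + (nat + unit)) set" where
  "face_index p = (- C p) <+> ({1..<p} <+> {})"

text \<open>The tight sets of a product of simplices: a nonempty block \<open>C q\<close>
  contributes a simplex whose facets are its coordinates and one more, while the coordinates of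
  \<open>rest p\<close> are barycentric and cannot all vanish.\<close>

definition face_patterns :: "nat \<Rightarrow> ('n + (nat + unit)) set set" where
  "face_patterns p = {Z <+> (I <+> {}) | Z I. Z \<subseteq> - C p \<and> \<not> rest p \<subseteq> Z \<and> I \<subseteq> {1..<p} \<and> (\<forall>q\<in>I. \<not> C q \<subseteq> Z)}"

lemma level_gap:
  assumes "q \<in> {1..k}" "q' \<in> {1..k}"
  shows "2 * (l q - l q') < L / k"
proof -
  have "2 * k * (l q - l q') < L"
  proof -
    have "2 * real k * L < 2 * real k * l q'" using l_lower[OF assms(2)] k1 by simp
    then show ?thesis using l_upper[OF assms(1)] by (simp add: algebra_simps)
  qed
  then show ?thesis using k1 by (simp add: field_simps)
qed

text \<open>The left side bounds the total of the earlier blocks on the pruned face, where \<sigma>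
  = l p; hence some weight always remains for \<open>rest p\<close>. The narrow interval of levels
  makes each term less than L / k.\<close>

lemma level_gaps_sum:
  assumes "1 \<le> p" "p < k"
  shows "(\<Sum>q\<in>{1..<p}. 2 * (l p - l q)) < l p"
proof -
  have "(\<Sum>q\<in>{1..<p}. 2 * (l p - l q)) \<le> real (card {1..<p}) * (L / k)"
    using level_gap[of p] assms by (intro sum_bounded_above) (auto intro: less_imp_le)
  also have "\<dots> \<le> real k * (L / k)" using L0 assms by (intro mult_right_mono) auto
  also have "\<dots> = L" using k1 by simp
  also have "\<dots> < l p" using l_lower assms by simp
  finally show ?thesis .
qed

text \<open>Since \<sigma> is constant on the face, cut q merely bounds the sum over
  \<open>C q\<close> by 2 (l p - l q). The earlier blocks thus vary independently over simplices,
  and the rest block takes what remains, which is always positive.\<close>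

lemma pruned_face_patterns:
  assumes p: "1 \<le> p" "p < k"
  shows "\<exists>V f. polyhedral V (face_index p) f \<and> pruned_face p = polyh V (face_index p) f \<and>
    tight (face_index p) f ` polyh V (face_index p) f = face_patterns p"
proof -
  define V where "V = {x. cutf (C p) x = l p} \<inter> (\<Inter>r\<in>C p. {x. y r x = 0})"
  define f :: "'n + (nat + unit) \<Rightarrow> real^'n \<Rightarrow> real"
    where "f = join_form y (\<lambda>q x. cutf (C q) x - l q) (\<lambda>_ _. 0)"
  have pk: "p \<in> {1..k}" using p by auto
  have V: "x \<in> V \<longleftrightarrow> \<sigma> x = l p \<and> (\<forall>r\<in>C p. y r x = 0)" for x
    unfolding V_def cutf_def bsum_def by auto
  have "affine V"
    unfolding V_def by (intro affine_Int affine_Inter) (auto intro: affine_level_set affine_form_cut affine_form_y)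
  then have poly: "polyhedral V (face_index p) f"
    unfolding face_index_def f_def
    by (intro polyhedral_join_form affine_form_y affine_form_diff affine_form_cut affine_form_const) auto
  have tz: "tight (face_index p) f x = {r \<in> - C p. y r x = 0} <+> ({q \<in> {1..<p}. cutf (C q) x = l q} <+> {})" for x
    unfolding face_index_def f_def tight_join_form by simp
  have mem: "x \<in> polyh V (face_index p) f \<longleftrightarrow>
      x \<in> V \<and> (\<forall>r. 0 \<le> y r x) \<and> (\<forall>q\<in>{1..<p}. l q \<le> cutf (C q) x)" for x
    unfolding face_index_def f_def polyh_join_form using V[of x] by force
  have eq: "pruned_face p = polyh V (face_index p) f"
  proof (intro set_eqI)
    fix x
    have ins: "{1..p} = insert p {1..<p}" using p by auto
    have "x \<in> P" if "x \<in> V" "\<forall>r. 0 \<le> y r x"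
      using that l_margin[OF pk] l_lower[OF pk] L0 V[of x] by (intro mem_P_cone) auto
    then show "x \<in> pruned_face p \<longleftrightarrow> x \<in> polyh V (face_index p) f"
      unfolding mem pruned_face_def stage_def ins using p(1) y_nonneg[of x]
      by (auto simp: V_def)
  qed
  have sum\<sigma>: "bsum (rest p) x + (\<Sum>q\<in>{1..<p}. bsum (C q) x) = \<sigma> x" if "\<forall>r\<in>C p. y r x = 0" for x
  proof -
    have "\<sigma> x = (\<Sum>r\<in>- C p. y r x)"
      unfolding sum_y[symmetric] using that by (intro sum.mono_neutral_right) auto
    then show ?thesis unfolding bsum_def sum_rblocks[OF p] by simp
  qed
  have "tight (face_index p) f ` polyh V (face_index p) f = face_patterns p"
  proof (intro equalityI subsetI)
    fix t assume "t \<in> tight (face_index p) f ` polyh V (face_index p) f"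
    then obtain x where x: "x \<in> polyh V (face_index p) f" "t = tight (face_index p) f x" by blast
    note xm = x(1)[unfolded mem V]
    let ?Z = "{r \<in> - C p. y r x = 0}" and ?I = "{q \<in> {1..<p}. cutf (C q) x = l q}"
    have "(\<Sum>q\<in>{1..<p}. bsum (C q) x) \<le> (\<Sum>q\<in>{1..<p}. 2 * (l p - l q))"
    proof (rule sum_mono)
      fix q assume "q \<in> {1..<p}"
      then have "l q \<le> cutf (C q) x" using xm by blast
      then show "bsum (C q) x \<le> 2 * (l p - l q)" using xm by (simp add: cutf_def)
    qed
    then have rest_pos: "0 < bsum (rest p) x" using sum\<sigma>[of x] xm level_gaps_sum[OF p] by simp
    have "\<not> rest p \<subseteq> ?Z"
    proof
      assume "rest p \<subseteq> ?Z"
      then have "bsum (rest p) x = 0" unfolding bsum_def by (intro sum.neutral) auto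
      then show False using rest_pos by simp
    qed
    moreover have "\<not> C q \<subseteq> ?Z" if "q \<in> ?I" for q
    proof
      assume "C q \<subseteq> ?Z"
      then have "bsum (C q) x = 0" unfolding bsum_def by (intro sum.neutral) auto
      then have "l p = l q" using that xm by (simp add: cutf_def)
      then show False using l_mono[of q p] that p by auto
    qed
    ultimately show "t \<in> face_patterns p"
      unfolding x(2) tz face_patterns_def by (intro CollectI exI[of _ ?Z] exI[of _ ?I]) auto
  next
    fix A assume "A \<in> face_patterns p"
    then obtain Z I where A: "A = Z <+> (I <+> {})" and Z: "Z \<subseteq> - C p" "\<not> rest p \<subseteq> Z"
      and I: "I \<subseteq> {1..<p}" "\<forall>q\<in>I. \<not> C q \<subseteq> Z" unfolding face_patterns_def by blast
    \<comment> \<open>A block sum is 0 when \<open>Z\<close> forces it, at its bound when cut q is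
      to be tight, and halfway otherwise; the remainder of \<open>l p\<close> goes to the rest
      block.\<close>
    define c where "c q = (if C q \<subseteq> Z then 0 else if q \<in> I then 2 * (l p - l q) else l p - l q)" for q
    have cpos: "0 \<le> c q" "c q \<le> 2 * (l p - l q)" "c q = 0 \<longleftrightarrow> C q \<subseteq> Z"
      "c q = 2 * (l p - l q) \<longleftrightarrow> q \<in> I" if "q \<in> {1..<p}" for q
      using l_mono[of q p] that p I(2) by (auto simp: c_def)
    have csum: "(\<Sum>q\<in>{1..<p}. c q) < l p"
      using sum_mono[of "{1..<p}" c "\<lambda>q. 2 * (l p - l q)"] cpos(2) level_gaps_sum[OF p] by simp
    define t where "t q = (if q = p then l p - (\<Sum>q\<in>{1..<p}. c q) else c q)" for q
    have t1: "0 \<le> t q" if "q \<in> {1..p}" for q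
      using that csum cpos(1)[of q] by (auto simp: t_def)
    have t2: "t q = 0 \<longleftrightarrow> rblock p q \<subseteq> Z" if "q \<in> {1..p}" for q
      using that csum cpos(3)[of q] Z(2) by (auto simp: t_def rblock_def)
    obtain \<eta> where \<eta>: "(\<forall>r. 0 \<le> \<eta> r) \<and> (\<forall>r. \<eta> r = 0 \<longleftrightarrow> r \<in> Z \<or> r \<notin> (\<Union>q\<in>{1..p}. rblock p q)) \<and>
        (\<forall>q\<in>{1..p}. (\<Sum>r\<in>rblock p q. \<eta> r / 1) = t q)"
      using block_totals[OF rblock_family(1)[OF p], of "\<lambda>_. 1" t Z] t1 t2 by auto
    obtain x where x: "\<forall>r. y r x = \<eta> r" using coordinates_surj[of \<eta>] by blast
    have x0: "y r x = 0 \<longleftrightarrow> r \<in> Z \<or> r \<in> C p" for r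
      using \<eta> x unfolding rblock_family(2)[OF p] by simp
    have bs: "bsum (rblock p q) x = t q" if "q \<in> {1..p}" for q
      using \<eta> x that unfolding bsum_def by simp
    have bC: "bsum (C q) x = c q" if "q \<in> {1..<p}" for q
      using bs[of q] that by (simp add: rblock_def t_def)
    have "\<sigma> x = l p"
      using sum\<sigma>[of x] x0 bs[of p] bC p by (simp add: rblock_def t_def)
    then have xV: "x \<in> V" unfolding V using x0 by blast
    have ct: "cutf (C q) x = l p - c q / 2" if "q \<in> {1..<p}" for q
      using bC[OF that] \<open>\<sigma> x = l p\<close> by (simp add: cutf_def)
    have "x \<in> polyh V (face_index p) f"
      unfolding mem
    proof (intro conjI ballI)
      show "\<forall>r. 0 \<le> y r x" using \<eta> x by simp
      show "l q \<le> cutf (C q) x" if "q \<in> {1..<p}" for q using ct[OF that] cpos(2)[OF that] by simp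
    qed (rule xV)
    moreover have "tight (face_index p) f x = Z <+> (I <+> {})"
    proof -
      have "{r \<in> - C p. y r x = 0} = Z" using x0 Z(1) by auto
      moreover have "cutf (C q) x = l q \<longleftrightarrow> q \<in> I" if "q \<in> {1..<p}" for q
        using ct[OF that] cpos(4)[OF that] by (auto simp: field_simps)
      then have "{q \<in> {1..<p}. cutf (C q) x = l q} = I" using I(1) by blast
      ultimately show ?thesis unfolding tz by simp
    qed
    ultimately show "A \<in> tight (face_index p) f ` polyh V (face_index p) f"
      using A by blast
  qed
  then show ?thesis using poly eq by blast
qed

text \<open>The simplex on \<open>rest p\<close> has one coordinate less than vertices: the coordinate \<open>j0\<close> is replaced by
  the slack of its sum constraint.\<close>
lemma simplex_product_patterns:
  assumes p: "1 \<le> p" "p < k" and j0: "j0 \<in> rest p"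
  defines "B \<equiv> \<lambda>q. if q = p then rest p - {j0} else C q"
  shows "\<exists>V f. polyhedral V (face_index p) f \<and> simplex_product p B = polyh V (face_index p) f \<and>
    tight (face_index p) f ` polyh V (face_index p) f = face_patterns p"
proof -
  define V :: "(real^'n) set" where "V = (\<Inter>r\<in>insert j0 (C p). {x. x $ r = 0})"
  define a :: "'n \<Rightarrow> real^'n \<Rightarrow> real"
    where "a r x = (if r = j0 then 1 - (\<Sum>j\<in>rest p - {j0}. x $ j) else x $ r)" for r x
  define f :: "'n + (nat + unit) \<Rightarrow> real^'n \<Rightarrow> real"
    where "f = join_form a (\<lambda>q x. 1 - (\<Sum>j\<in>C q. x $ j)) (\<lambda>_ _. 0)"
  have jp: "j0 \<notin> C p" using j0 rest_subset[OF p(1)] by blast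
  have jq: "j0 \<notin> C q" if "q \<in> {1..<p}" for q using j0 that by (auto simp: rest_def)
  have V: "x \<in> V \<longleftrightarrow> x $ j0 = 0 \<and> (\<forall>r\<in>C p. x $ r = 0)" for x
    unfolding V_def by auto
  have "affine V"
    unfolding V_def by (intro affine_Inter) (auto intro: affine_level_set)
  moreover have "affine_form (a r)" for r
    by (cases "r = j0") (auto simp: a_def[abs_def] intro!: affine_form_diff affine_form_sum)
  ultimately have poly: "polyhedral V (face_index p) f"
    unfolding face_index_def f_def
    by (intro polyhedral_join_form affine_form_diff affine_form_sum affine_form_const affine_form_nth) auto
  have tz: "tight (face_index p) f x
      = {r \<in> - C p. a r x = 0} <+> ({q \<in> {1..<p}. (\<Sum>j\<in>C q. x $ j) = 1} <+> {})" for x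
    unfolding face_index_def f_def tight_join_form by auto
  have mem: "x \<in> polyh V (face_index p) f \<longleftrightarrow>
      x \<in> V \<and> (\<forall>r\<in>- C p. 0 \<le> a r x) \<and> (\<forall>q\<in>{1..<p}. (\<Sum>j\<in>C q. x $ j) \<le> 1)" for x
    unfolding face_index_def f_def polyh_join_form by auto
  have BU: "(\<Union>q\<in>{1..p}. B q) = - insert j0 (C p)"
  proof -
    have "(\<Union>q\<in>{1..p}. B q) = (\<Union>q\<in>{1..p}. rblock p q) - {j0}"
      using jq by (auto simp: B_def rblock_def split: if_splits)
    then show ?thesis unfolding rblock_family(2)[OF p] by auto
  qed
  have eq: "simplex_product p B = polyh V (face_index p) f"
  proof (intro set_eqI)
    fix x :: "real^'n"
    have ins: "{1..p} = insert p {1..<p}" using p by auto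
    have "(\<forall>j. 0 \<le> x $ j) \<and> (\<forall>q\<in>{1..p}. (\<Sum>j\<in>B q. x $ j) \<le> 1) \<longleftrightarrow>
        (\<forall>r\<in>- C p. 0 \<le> a r x) \<and> (\<forall>q\<in>{1..<p}. (\<Sum>j\<in>C q. x $ j) \<le> 1)" if xV: "x \<in> V"
    proof -
      have "(\<forall>r\<in>- C p. 0 \<le> a r x) \<longleftrightarrow> (\<forall>j. 0 \<le> x $ j) \<and> (\<Sum>j\<in>rest p - {j0}. x $ j) \<le> 1"
        using xV jp unfolding V a_def by (auto split: if_splits)
      moreover have "(\<forall>q\<in>{1..p}. (\<Sum>j\<in>B q. x $ j) \<le> 1) \<longleftrightarrow>
          (\<Sum>j\<in>rest p - {j0}. x $ j) \<le> 1 \<and> (\<forall>q\<in>{1..<p}. (\<Sum>j\<in>C q. x $ j) \<le> 1)"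
        unfolding ins by (auto simp: B_def)
      ultimately show ?thesis by blast
    qed
    moreover have "(\<forall>j. j \<notin> (\<Union>q\<in>{1..p}. B q) \<longrightarrow> x $ j = 0) \<longleftrightarrow> x \<in> V"
      unfolding BU V by auto
    ultimately show "x \<in> simplex_product p B \<longleftrightarrow> x \<in> polyh V (face_index p) f"
      unfolding simplex_product_def mem by blast
  qed
  have "tight (face_index p) f ` polyh V (face_index p) f = face_patterns p"
  proof (intro equalityI subsetI)
    fix t assume "t \<in> tight (face_index p) f ` polyh V (face_index p) f"
    then obtain x where x: "x \<in> polyh V (face_index p) f" "t = tight (face_index p) f x" by blast
    let ?Z = "{r \<in> - C p. a r x = 0}" and ?I = "{q \<in> {1..<p}. (\<Sum>j\<in>C q. x $ j) = 1}"
    have "\<not> rest p \<subseteq> ?Z"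
    proof
      assume Z: "rest p \<subseteq> ?Z"
      then have "(\<Sum>j\<in>rest p - {j0}. x $ j) = 1" using j0 by (auto simp: a_def)
      moreover have "x $ j = 0" if "j \<in> rest p - {j0}" for j using Z that by (auto simp: a_def)
      ultimately show False by simp
    qed
    moreover have "\<not> C q \<subseteq> ?Z" if "q \<in> ?I" for q
    proof
      assume Z: "C q \<subseteq> ?Z"
      have "x $ j = 0" if "j \<in> C q" for j
        using Z that jq[of q] \<open>q \<in> ?I\<close> by (auto simp: a_def split: if_splits)
      then show False using that by simp
    qed
    ultimately show "t \<in> face_patterns p"
      unfolding x(2) tz face_patterns_def by (intro CollectI exI[of _ ?Z] exI[of _ ?I]) auto
  next
    fix t assume "t \<in> face_patterns p"
    then obtain Z I where t: "t = Z <+> (I <+> {})" and Z: "Z \<subseteq> - C p" "\<not> rest p \<subseteq> Z"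
      and I: "I \<subseteq> {1..<p}" "\<forall>q\<in>I. \<not> C q \<subseteq> Z" unfolding face_patterns_def by blast
    \<comment> \<open>The rest block must have total 1 because its coordinates are barycentric. Any
      other block has total 0 if contained in \<open>Z\<close>, 1 if its sum constraint is to be
      tight, and 1/2 otherwise.\<close>
    define c :: "nat \<Rightarrow> real" where "c q = (if rblock p q \<subseteq> Z then 0 else if q \<in> I \<or> q = p then 1 else 1 / 2)" for q
    have c1: "0 \<le> c q" "c q = 0 \<longleftrightarrow> rblock p q \<subseteq> Z" for q by (auto simp: c_def)
    obtain \<eta> where \<eta>: "(\<forall>r. 0 \<le> \<eta> r) \<and> (\<forall>r. \<eta> r = 0 \<longleftrightarrow> r \<in> Z \<or> r \<notin> (\<Union>q\<in>{1..p}. rblock p q)) \<and>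
        (\<forall>q\<in>{1..p}. (\<Sum>r\<in>rblock p q. \<eta> r / 1) = c q)"
      using block_totals[OF rblock_family(1)[OF p], of "\<lambda>_. 1" c Z] c1 by auto
    define x where "x = (\<chi> r. if r = j0 then 0 else \<eta> r)"
    have \<eta>0: "\<eta> r = 0 \<longleftrightarrow> r \<in> Z \<or> r \<in> C p" for r using \<eta> unfolding rblock_family(2)[OF p] by simp
    have \<eta>s: "(\<Sum>r\<in>rblock p q. \<eta> r) = c q" if "q \<in> {1..p}" for q using \<eta> that by simp
    have "(\<Sum>r\<in>rest p. \<eta> r) = 1"
      using \<eta>s[of p] p Z(2) by (simp add: rblock_def c_def)
    then have "(\<Sum>r\<in>rest p - {j0}. \<eta> r) = 1 - \<eta> j0"
      using sum.remove[of "rest p" j0 \<eta>] j0 by simp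
    moreover have "(\<Sum>r\<in>rest p - {j0}. x $ r) = (\<Sum>r\<in>rest p - {j0}. \<eta> r)"
      by (intro sum.cong) (auto simp: x_def)
    ultimately have ax: "a r x = \<eta> r" for r by (simp add: a_def x_def)
    have sx: "(\<Sum>j\<in>C q. x $ j) = c q" if "q \<in> {1..<p}" for q
    proof -
      have "(\<Sum>j\<in>C q. x $ j) = (\<Sum>j\<in>C q. \<eta> j)" using jq[OF that] by (intro sum.cong) (auto simp: x_def)
      then show ?thesis using \<eta>s[of q] that by (simp add: rblock_def)
    qed
    have "x \<in> V" unfolding V using \<eta>0 by (auto simp: x_def)
    then have "x \<in> polyh V (face_index p) f"
      unfolding mem using \<eta> ax sx by (auto simp: c_def)
    moreover have "tight (face_index p) f x = Z <+> (I <+> {})"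
    proof -
      have "{r \<in> - C p. a r x = 0} = Z" unfolding ax \<eta>0 using Z(1) by auto
      moreover have "c q = 1 \<longleftrightarrow> q \<in> I" if "q \<in> {1..<p}" for q
        using that I(2) by (auto simp: c_def rblock_def)
      then have "{q \<in> {1..<p}. (\<Sum>j\<in>C q. x $ j) = 1} = I" using I(1) sx by auto
      ultimately show ?thesis unfolding tz by simp
    qed
    ultimately show "t \<in> tight (face_index p) f ` polyh V (face_index p) f" using t by blast
  qed
  then show ?thesis using poly eq by blast
qed

lemma is_simplex_product_pruned_face:
  assumes p: "p < k"
  shows "is_simplex_product (pruned_face p)"
proof (cases "p = 0")
  case True
  then show ?thesis by (simp add: pruned_face_def is_simplex_product_singleton)
next
  case False
  then have p1: "1 \<le> p" by simp
  obtain j0 where j0: "j0 \<in> rest p" using rest_nonempty[OF p] by blast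
  define B where "B q = (if q = p then rest p - {j0} else C q)" for q
  obtain V f where 1: "polyhedral V (face_index p) f" "pruned_face p = polyh V (face_index p) f"
    "tight (face_index p) f ` polyh V (face_index p) f = face_patterns p"
    using pruned_face_patterns[OF p1 p] by blast
  obtain W g where 2: "polyhedral W (face_index p) g" "simplex_product p B = polyh W (face_index p) g"
    "tight (face_index p) g ` polyh W (face_index p) g = face_patterns p"
    using simplex_product_patterns[OF p1 p j0] unfolding B_def[abs_def] by blast
  have "pruned_face p \<simeq>\<^sub>c simplex_product p B"
    unfolding 1(2) 2(2) using 1 2 by (intro combinatorially_equivalent_polyh) auto
  moreover have "disjoint_family_on B {1..p}"
    using rblock_family(1)[OF p1 p] unfolding disjoint_family_on_def B_def rblock_def by fastforce
  ultimately show ?thesis unfolding is_simplex_product_def by blast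
qed

end

subsection \<open>Combinatorics of the last truncation\<close>

definition block_patterns :: "(nat \<Rightarrow> 'n set) \<Rightarrow> nat set \<Rightarrow> ('n set \<times> nat set) set" where
  "block_patterns C N = {(Z, I). I \<subseteq> N \<and> I \<noteq> {} \<and> (\<forall>q\<in>I. \<not> C q \<subseteq> Z)}"

text \<open>The blocks of the product are independent: their weighted sums may be prescribed
  separately, and a sum can reach 1 unless its whole block vanishes.\<close>

lemma simplex_block_patterns:
  fixes C :: "nat \<Rightarrow> 'n::finite set" and J :: "nat set"
  assumes polar: "polar_polytope i S D \<beta> s P v E T J m"
    and dis: "disjoint_family_on C {1..k}" and cover: "(\<Union>q\<in>{1..k}. C q) = UNIV"
    and \<kappa>: "\<And>r. \<kappa> r > 0" and J: "J = {q \<in> {1..k}. C q \<noteq> {}}"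
    and m: "\<And>q Z. m q Z = snd Z - (\<Sum>r\<in>C q. \<beta> r (T Z) / \<kappa> r)"
  shows "{(Z, I). (Z, I) \<in> polar_polytope.patterns \<beta> P v T J m \<and> I \<noteq> {}} = block_patterns C J"
proof -
  interpret polar_polytope i S D \<beta> s P v E T J m by fact
  have m1: "m q (x, 1) = 1 - (\<Sum>r\<in>C q. y r x / \<kappa> r)" for q x
    by (simp add: m y_def)
  have "(Z, I) \<in> patterns \<and> I \<noteq> {} \<longleftrightarrow> (Z, I) \<in> block_patterns C J" for Z I
  proof
    assume ZI: "(Z, I) \<in> patterns \<and> I \<noteq> {}"
    then obtain x where x: "Z = {r. y r x = 0}" "I = {q \<in> J. m q (x, 1) = 0}"
      unfolding patterns_def by blast
    have "\<not> C q \<subseteq> Z" if "q \<in> I" for q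
    proof
      assume "C q \<subseteq> Z"
      then have "(\<Sum>r\<in>C q. y r x / \<kappa> r) = 0" using x(1) by (intro sum.neutral) auto
      then show False using that x(2) m1 by simp
    qed
    then show "(Z, I) \<in> block_patterns C J" using ZI x(2) by (auto simp: block_patterns_def)
  next
    assume "(Z, I) \<in> block_patterns C J"
    then have I: "I \<subseteq> J" "I \<noteq> {}" "\<And>q. q \<in> I \<Longrightarrow> \<not> C q \<subseteq> Z" by (auto simp: block_patterns_def)
    define t where "t q = (if C q \<subseteq> Z then 0 else if q \<in> I then 1 else 1 / 2 :: real)" for q
    have t: "0 \<le> t q" "t q = 0 \<longleftrightarrow> C q \<subseteq> Z" "t q \<le> 1" "t q = 1 \<longleftrightarrow> q \<in> I" for q
      using I(3)[of q] by (auto simp: t_def)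
    obtain \<eta> where \<eta>: "(\<forall>r. 0 \<le> \<eta> r) \<and> (\<forall>r. \<eta> r = 0 \<longleftrightarrow> r \<in> Z \<or> r \<notin> (\<Union>q\<in>{1..k}. C q)) \<and>
        (\<forall>q\<in>{1..k}. (\<Sum>r\<in>C q. \<eta> r / \<kappa> r) = t q)"
      using block_totals[OF dis, of \<kappa> t Z] \<kappa> t by auto
    obtain x where x: "\<forall>r. y r x = \<eta> r" using coordinates_surj[of \<eta>] by blast
    have x0: "y r x = 0 \<longleftrightarrow> r \<in> Z" for r using \<eta> x unfolding cover by simp
    have mx: "m q (x, 1) = 1 - t q" if "q \<in> {1..k}" for q
      unfolding m1 using \<eta> x that by simp
    have mJ: "m q (x, 1) = 1 - t q" if "q \<in> J" for q using mx that J by simp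
    have "x \<in> P"
      by (subst P_eq) (use \<eta> x mJ t(3) in auto)
    moreover have "x \<noteq> v"
    proof
      assume "x = v"
      then have "Z = UNIV" using x0 y_pole by auto
      then show False using I(2,3) by blast
    qed
    moreover have "{q \<in> J. m q (x, 1) = 0} = I" using mJ t(4) I(1) by auto
    moreover have "{r. y r x = 0} = Z" using x0 by simp
    ultimately show "(Z, I) \<in> patterns \<and> I \<noteq> {}"
      unfolding patterns_def using I(2) by blast
  qed
  then show ?thesis by auto
qed

context truncation
begin

definition nonempty_blocks :: "nat set" where "nonempty_blocks = {q \<in> {1..k}. C q \<noteq> {}}"

definition last_form :: "'n + (nat + 'c) \<Rightarrow> real^'n \<Rightarrow> real" where
  "last_form = join_form y (\<lambda>q x. cutf (C q) x - l q) (\<lambda>c x. m c (x, 1))"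

lemma polyhedral_last: "polyhedral UNIV (UNIV <+> (nonempty_blocks <+> J)) last_form"
  unfolding last_form_def
  by (intro polyhedral_join_form affine_form_y affine_form_diff affine_form_cut affine_form_const
      affine_form_homogeneous linm) (auto simp: finJ nonempty_blocks_def)

text \<open>The cut of an empty block reads \<sigma> \<ge> l q and follows from cut k, which never
  exceeds \<sigma> and has the highest level. Dropping such cuts leaves the same block indices as
  for the product, which has no hyperplane for an empty block.\<close>

lemma last_stage_eq: "stage C l k = polyh UNIV (UNIV <+> (nonempty_blocks <+> J)) last_form"
proof -
  have "l q \<le> cutf (C q) x" if x: "x \<in> P" "\<forall>q\<in>nonempty_blocks. l q \<le> cutf (C q) x" and q: "q \<in> {1..k}" for q x
  proof (cases "C q = {}")
    case True
    have "k \<in> nonempty_blocks" using Ck k1 by (simp add: nonempty_blocks_def)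
    then have "l k \<le> cutf (C k) x" using x by blast
    also have "\<dots> \<le> \<sigma> x" using cut_bounds(2) y_nonneg[OF x(1)] by blast
    also have "\<dots> = cutf (C q) x" using True by (simp add: cutf_def bsum_def)
    finally show ?thesis using l_mono[of q k] q by (cases "q = k") auto
  qed (use x q in \<open>auto simp: nonempty_blocks_def\<close>)
  then have "x \<in> stage C l k \<longleftrightarrow> x \<in> P \<and> (\<forall>q\<in>nonempty_blocks. l q \<le> cutf (C q) x)" for x
    unfolding stage_def nonempty_blocks_def by blast
  then show ?thesis unfolding last_form_def polyh_join_form mem_P by auto
qed

lemma tight_last:
  "tight (UNIV <+> (nonempty_blocks <+> J)) last_form x
    = {r. y r x = 0} <+> ({q \<in> nonempty_blocks. cutf (C q) x = l q} <+> {c \<in> J. m c (x, 1) = 0})"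
  unfolding last_form_def tight_join_form by simp

text \<open>A tight cut with vanishing block sum would force \<sigma> = l q. Adding all k cuts,
  whose block sums total \<sigma>, would give k L < (k - 1/2) l q, which
  \<open>level_estimate\<close> with n = k excludes. The second claim holds because a tight cut
  keeps \<sigma> below \<rho>.\<close>

lemma last_stage_tight_block:
  assumes x: "x \<in> stage C l k" and q: "q \<in> {1..k}" "cutf (C q) x = l q"
  shows "\<not> C q \<subseteq> {r. y r x = 0}" and "\<And>c. c \<in> J \<Longrightarrow> m c (x, 1) \<noteq> 0"
proof -
  have xP: "x \<in> P" and xq: "\<And>q. q \<in> {1..k} \<Longrightarrow> l q \<le> cutf (C q) x" using x by (auto simp: stage_def)
  have "\<sigma> x \<le> 2 * l q" using cut_bounds(1)[of x "C q"] y_nonneg[OF xP] q(2) by simp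
  then have "\<sigma> x < \<rho>" using l_margin[OF q(1)] by simp
  then show "m c (x, 1) \<noteq> 0" if "c \<in> J" for c using far_from_pole[OF xP that] by auto
  show "\<not> C q \<subseteq> {r. y r x = 0}"
  proof
    assume "C q \<subseteq> {r. y r x = 0}"
    then have "bsum (C q) x = 0" unfolding bsum_def by (intro sum.neutral) auto
    then have \<sigma>: "\<sigma> x = l q" using q(2) by (simp add: cutf_def)
    have "(\<Sum>q\<in>{1..k}. L) < (\<Sum>q\<in>{1..k}. l q)" using k1 l_lower by (intro sum_strict_mono) auto
    also have "\<dots> \<le> (\<Sum>q\<in>{1..k}. \<sigma> x - bsum (C q) x / 2)"
      using xq by (intro sum_mono) (auto simp: cutf_def)
    also have "\<dots> = k * \<sigma> x - \<sigma> x / 2"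
      by (simp add: sum_subtractf sum_divide_distrib[symmetric] bsum_cover[unfolded One_nat_def])
    finally have "2 * real k * L < (2 * real k - 1) * l q" using \<sigma> by (simp add: algebra_simps)
    then show False using level_estimate[OF k1 order_refl q(1)] by simp
  qed
qed

text \<open>\<open>S0\<close> is the value of \<open>\<sigma>\<close> at a point where exactly the cuts in \<open>I\<close> are tight and the blocks in \<open>N\<close>
  have sum \<open>\<delta>\<close>.\<close>
lemma level_exists:
  assumes I: "I \<subseteq> {1..k}" "I \<noteq> {}" and N: "N \<subseteq> {1..k} - I"
  obtains \<delta> S0 where "\<delta> > 0" "\<And>q. q \<in> {1..k} \<Longrightarrow> l q + \<delta> / 2 < S0"
    "(\<Sum>q\<in>I. 2 * (S0 - l q)) + real (card N) * \<delta> = S0"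
proof -
  define n where "n = card I"
  have finI: "finite I" using I finite_subset by blast
  have n: "1 \<le> n" "n \<le> k"
    using I finI card_mono[of "{1..k}" I] by (auto simp: n_def Suc_le_eq card_gt_0_iff)
  \<comment> \<open>The levels leave a reserve of L / (2k) in the estimate below. One half pays for
    the at most k blocks of sum \<delta>, the other for the clearance \<delta> / 2 multiplied by 2n
    - 1.\<close>
  define \<delta> where "\<delta> = L / (4 * k\<^sup>2)"
  have \<delta>: "\<delta> > 0" using L0 k1 by (simp add: \<delta>_def)
  have k\<delta>: "real k * \<delta> = L / (4 * k)" using k1 by (simp add: \<delta>_def power2_eq_square)
  define S0 where "S0 = ((\<Sum>q\<in>I. 2 * l q) - real (card N) * \<delta>) / (2 * real n - 1)"
  have n0: "0 < 2 * real n - 1" using n by simp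
  then have S0: "(2 * real n - 1) * S0 = (\<Sum>q\<in>I. 2 * l q) - real (card N) * \<delta>"
    by (simp add: S0_def)
  have "card N \<le> k" using card_mono[of "{1..k}" N] N by auto
  then have N\<delta>: "real (card N) * \<delta> \<le> L / (4 * k)"
    using \<delta> k\<delta> by (metis less_imp_le mult_right_mono of_nat_le_iff)
  have "(\<Sum>q\<in>I. 2 * L) < (\<Sum>q\<in>I. 2 * l q)"
    using l_lower I finI by (intro sum_strict_mono) auto
  then have sumI: "2 * real n * L < (\<Sum>q\<in>I. 2 * l q)" by (simp add: n_def)
  have "l q + \<delta> / 2 < S0" if q: "q \<in> {1..k}" for q
  proof -
    have "(2 * real n - 1) * (2 * real k * l q) < (2 * real n - 1) * ((2 * real k + 1) * L)"
      using l_upper[OF q] n0 by (intro mult_strict_left_mono) (auto simp: algebra_simps)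
    also have "\<dots> = (4 * real n * real k - 1) * L + 2 * (real n - real k) * L"
      by (simp add: algebra_simps)
    also have "\<dots> \<le> (4 * real n * real k - 1) * L"
      using n L0 by (simp add: mult_nonpos_nonneg)
    finally have "2 * real k * ((2 * real n - 1) * l q) < 2 * real k * (2 * real n * L - L / (2 * k))"
      using k1 by (simp add: algebra_simps)
    moreover have "0 < 2 * real k" using k1 by simp
    ultimately have 1: "(2 * real n - 1) * l q < 2 * real n * L - L / (2 * k)"
      by (simp only: mult_less_cancel_left_pos)
    have "(2 * real n - 1) * (\<delta> / 2) \<le> (2 * real k) * (\<delta> / 2)"
      using n \<delta> by (intro mult_right_mono) auto
    also have "\<dots> = L / (4 * k)" using k\<delta> by simp
    finally have 2: "(2 * real n - 1) * (\<delta> / 2) \<le> L / (4 * k)" .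
    have "L / (2 * k) = L / (4 * k) + L / (4 * k)" using k1 by (simp add: field_simps)
    then have "(2 * real n - 1) * l q + (2 * real n - 1) * (\<delta> / 2) < (2 * real n - 1) * S0"
      using 1 2 S0 N\<delta> sumI by linarith
    then have "(2 * real n - 1) * (l q + \<delta> / 2) < (2 * real n - 1) * S0" by (simp add: distrib_left)
    then show ?thesis using n0 by (simp only: mult_less_cancel_left_pos)
  qed
  moreover have "(\<Sum>q\<in>I. 2 * (S0 - l q)) + real (card N) * \<delta> = S0"
    using S0 by (simp add: right_diff_distrib sum_subtractf n_def algebra_simps)
  ultimately show thesis using that \<delta> by blast
qed

text \<open>Tight blocks must have sum 2 (\<sigma> - l q), with \<sigma> itself the total of all
  blocks; \<open>level_exists\<close> resolves this circular condition. Blocks neither tight nor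
  contained in \<open>Z\<close> receive the small sum \<delta>, which leaves their cuts
  slack.\<close>

lemma last_stage_realize:
  assumes "(Z, I) \<in> block_patterns C nonempty_blocks"
  shows "\<exists>x\<in>stage C l k. {r. y r x = 0} = Z \<and> {q \<in> nonempty_blocks. cutf (C q) x = l q} = I
    \<and> {c \<in> J. m c (x, 1) = 0} = {}"
proof -
  have I: "I \<subseteq> nonempty_blocks" "I \<noteq> {}" "\<And>q. q \<in> I \<Longrightarrow> \<not> C q \<subseteq> Z"
    using assms by (auto simp: block_patterns_def)
  have Ik: "I \<subseteq> {1..k}" using I(1) by (auto simp: nonempty_blocks_def)
  define N where "N = {q \<in> {1..k} - I. \<not> C q \<subseteq> Z}"
  have Nk: "N \<subseteq> {1..k} - I" by (auto simp: N_def)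
  obtain \<delta> S0 where \<delta>: "\<delta> > 0" and S0: "\<And>q. q \<in> {1..k} \<Longrightarrow> l q + \<delta> / 2 < S0"
    and tot: "(\<Sum>q\<in>I. 2 * (S0 - l q)) + real (card N) * \<delta> = S0"
    using level_exists[OF Ik I(2) Nk] by metis
  define t where "t q = (if q \<in> I then 2 * (S0 - l q) else if q \<in> N then \<delta> else 0)" for q
  have t: "0 \<le> t q" "t q = 0 \<longleftrightarrow> C q \<subseteq> Z" if "q \<in> {1..k}" for q
    using S0[OF that] \<delta> I(3)[of q] that by (auto simp: t_def N_def)
  obtain \<eta> where \<eta>: "(\<forall>r. 0 \<le> \<eta> r) \<and> (\<forall>r. \<eta> r = 0 \<longleftrightarrow> r \<in> Z \<or> r \<notin> (\<Union>q\<in>{1..k}. C q)) \<and>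
      (\<forall>q\<in>{1..k}. (\<Sum>r\<in>C q. \<eta> r / 1) = t q)"
    using block_totals[OF disC, of "\<lambda>_. 1" t Z] t by auto
  obtain x where x: "\<forall>r. y r x = \<eta> r" using coordinates_surj[of \<eta>] by blast
  have y0: "0 \<le> y r x" for r using \<eta> x by simp
  have x0: "y r x = 0 \<longleftrightarrow> r \<in> Z" for r using \<eta> x unfolding cover by simp
  have bs: "bsum (C q) x = t q" if "q \<in> {1..k}" for q using \<eta> x that unfolding bsum_def by simp
  have "\<sigma> x = (\<Sum>q\<in>{1..k}. t q)" unfolding bsum_cover[symmetric] using bs by (intro sum.cong) auto
  also have "\<dots> = (\<Sum>q\<in>I \<union> N. t q)"
    using Ik Nk by (intro sum.mono_neutral_right) (auto simp: t_def)
  also have "\<dots> = (\<Sum>q\<in>I. t q) + (\<Sum>q\<in>N. t q)"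
    using Ik Nk by (intro sum.union_disjoint) (auto intro: finite_subset)
  also have "(\<Sum>q\<in>I. t q) = (\<Sum>q\<in>I. 2 * (S0 - l q))" by (intro sum.cong) (auto simp: t_def)
  also have "(\<Sum>q\<in>N. t q) = (\<Sum>q\<in>N. \<delta>)" using Nk by (intro sum.cong) (auto simp: t_def)
  also have "(\<Sum>q\<in>I. 2 * (S0 - l q)) + (\<Sum>q\<in>N. \<delta>) = S0" using tot by simp
  finally have \<sigma>: "\<sigma> x = S0" .
  have ct: "cutf (C q) x = S0 - t q / 2" if "q \<in> {1..k}" for q
    using bs[OF that] \<sigma> by (simp add: cutf_def)
  have ctI: "cutf (C q) x = l q" if "q \<in> I" for q
    using ct[of q] that Ik by (auto simp: t_def diff_divide_distrib)
  have ctN: "l q < cutf (C q) x" if "q \<in> {1..k}" "q \<notin> I" for q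
    using ct[OF that(1)] S0[OF that(1)] \<delta> that(2) by (auto simp: t_def)
  obtain q0 where q0: "q0 \<in> I" using I(2) by blast
  then have q0k: "q0 \<in> {1..k}" using Ik by blast
  have "\<sigma> x \<le> 2 * l q0" using cut_bounds(1)[OF y0, of "C q0"] ctI[OF q0] by simp
  then have "\<sigma> x \<le> \<rho>" using l_margin[OF q0k] by simp
  then have xP: "x \<in> P" using y0 by (intro mem_P_cone)
  have st: "x \<in> stage C l k"
    unfolding stage_def using xP ctI ctN by (auto intro: less_imp_le) (metis less_imp_le order_refl atLeastAtMost_iff One_nat_def)
  have "{q \<in> nonempty_blocks. cutf (C q) x = l q} = I"
    using I(1) ctI ctN by (force simp: nonempty_blocks_def)
  moreover have "{c \<in> J. m c (x, 1) = 0} = {}"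
    using last_stage_tight_block(2)[OF st q0k ctI[OF q0]] by blast
  ultimately show ?thesis using st x0 by blast
qed

text \<open>A tight cut places the point near the pole, off the hyperplanes avoiding
  \<open>v\<close>; a point without one shows a pattern of the untruncated polytope minus
  \<open>v\<close>.\<close>

lemma last_stage_patterns:
  "tight (UNIV <+> (nonempty_blocks <+> J)) last_form ` stage C l k
    = {Z <+> (I <+> {}) | Z I. (Z, I) \<in> block_patterns C nonempty_blocks}
    \<union> {Z <+> ({} <+> K) | Z K. (Z, K) \<in> patterns}" (is "?t ` _ = ?L1 \<union> ?L2")
proof (intro equalityI subsetI)
  fix A assume "A \<in> ?t ` stage C l k"
  then obtain x where x: "x \<in> stage C l k" "A = ?t x" by blast
  let ?Z = "{r. y r x = 0}" and ?I = "{q \<in> nonempty_blocks. cutf (C q) x = l q}" and ?K = "{c \<in> J. m c (x, 1) = 0}"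
  have xP: "x \<in> P" and xq: "\<And>q. q \<in> {1..k} \<Longrightarrow> l q \<le> cutf (C q) x" using x by (auto simp: stage_def)
  show "A \<in> ?L1 \<union> ?L2"
  proof (cases "?I = {}")
    case True
    have "x \<noteq> v"
    proof
      assume "x = v"
      then show False using xq[of 1] l_lower[of 1] L0 k1 by (simp add: cut_pole)
    qed
    then have "(?Z, ?K) \<in> patterns" unfolding patterns_def using xP by blast
    then have "A \<in> ?L2" unfolding x(2) tight_last True by blast
    then show ?thesis by blast
  next
    case False
    then obtain q0 where q0: "q0 \<in> {1..k}" "cutf (C q0) x = l q0" by (auto simp: nonempty_blocks_def)
    have K: "?K = {}" using last_stage_tight_block(2)[OF x(1) q0] by blast
    have "\<not> C q \<subseteq> ?Z" if "q \<in> ?I" for q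
      using last_stage_tight_block(1)[OF x(1), of q] that by (simp add: nonempty_blocks_def)
    then have "(?Z, ?I) \<in> block_patterns C nonempty_blocks"
      unfolding block_patterns_def using False by blast
    then have "A \<in> ?L1" unfolding x(2) tight_last K by blast
    then show ?thesis by blast
  qed
next
  fix A assume "A \<in> ?L1 \<union> ?L2"
  then consider (1) Z I where "A = Z <+> (I <+> {})" "(Z, I) \<in> block_patterns C nonempty_blocks"
    | (2) Z K where "A = Z <+> ({} <+> K)" "(Z, K) \<in> patterns" by blast
  then show "A \<in> ?t ` stage C l k"
  proof cases
    case 1
    obtain x where x: "x \<in> stage C l k" "{r. y r x = 0} = Z" "{q \<in> nonempty_blocks. cutf (C q) x = l q} = I"
      "{c \<in> J. m c (x, 1) = 0} = {}" using last_stage_realize[OF 1(2)] by blast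
    have "A = ?t x" unfolding 1(1) tight_last x(2-4) ..
    then show ?thesis using x(1) by blast
  next
    case 2
    then obtain x where x: "x \<in> P" "x \<noteq> v" "Z = {r. y r x = 0}" "K = {c \<in> J. m c (x, 1) = 0}"
      unfolding patterns_def by blast
    have far: "A \<in> ?t ` stage C l k"
      if z: "z \<in> P" "\<rho> \<le> \<sigma> z" "{r. y r z = 0} = Z" "{c \<in> J. m c (z, 1) = 0} = K" for z
    proof -
      have sl: "l q < cutf (C q) z" if "q \<in> {1..k}" for q using far_slack[OF z(1,2) that] .
      have "z \<in> stage C l k" unfolding stage_def using z(1) sl by (auto intro: less_imp_le)
      moreover have e: "{q \<in> nonempty_blocks. cutf (C q) z = l q} = {}"
        using sl by (force simp: nonempty_blocks_def)
      have "A = ?t z" unfolding 2(1) tight_last z(3,4) e ..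
      ultimately show ?thesis by blast
    qed
    show ?thesis
    proof (cases "K = {}")
      case False
      then obtain c where "c \<in> J" "m c (x, 1) = 0" using x(4) by blast
      then have "\<rho> \<le> \<sigma> x" using far_from_pole[OF x(1)] by (auto intro: less_imp_le)
      then show ?thesis using far x by blast
    next
      case True
      have \<sigma>: "0 < \<sigma> x" using \<sigma>_pos x by blast
      \<comment> \<open>No hyperplane avoiding \<open>v\<close> is tight, so the point can be moved
        along its ray from \<open>v\<close> to \<sigma> = \<rho>. The vanishing coordinates stay the
        same, and there all cuts and hyperplanes avoiding \<open>v\<close> are slack.\<close>
      obtain z where z: "\<forall>r. y r z = \<rho> / \<sigma> x * y r x"
        using coordinates_surj[of "\<lambda>r. \<rho> / \<sigma> x * y r x"] by blast
      have z0: "0 \<le> y r z" for r using z \<rho>0 \<sigma> y_nonneg[OF x(1)] by simp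
      have "\<sigma> z = (\<Sum>r\<in>UNIV. \<rho> / \<sigma> x * y r x)" unfolding sum_y[symmetric, of z] using z by simp
      also have "\<dots> = \<rho> / \<sigma> x * \<sigma> x" unfolding sum_distrib_left[symmetric] sum_y ..
      also have "\<dots> = \<rho>" using \<sigma> by simp
      finally have \<sigma>z: "\<sigma> z = \<rho>" .
      have "{r. y r z = 0} = Z" using z x(3) \<rho>0 \<sigma> by simp
      moreover have "{c \<in> J. m c (z, 1) = 0} = K"
        unfolding True using margin[OF z0, of _] \<sigma>z by force
      moreover have "z \<in> P" using z0 \<sigma>z by (intro mem_P_cone) auto
      ultimately show ?thesis using far \<sigma>z by auto
    qed
  qed
qed

end

section \<open>Existence of the truncation and conclusion\<close>

lemma simplex_product_reindex:
  fixes B :: "nat \<Rightarrow> 'a::finite set"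
  assumes "bij_betw e {1..k} {1..k}"
  shows "simplex_product k (B \<circ> e) = simplex_product k B"
proof -
  have e: "e ` {1..k} = {1..k}" using assms by (simp add: bij_betw_def)
  have 1: "(\<forall>i\<in>{1..k}. (\<Sum>j\<in>(B \<circ> e) i. x $ j) \<le> 1) \<longleftrightarrow>
      (\<forall>i\<in>{1..k}. (\<Sum>j\<in>B i. x $ j) \<le> 1)" for x :: "real^'a"
  proof -
    have "(\<forall>i\<in>{1..k}. (\<Sum>j\<in>B i. x $ j) \<le> 1) \<longleftrightarrow> (\<forall>i\<in>e ` {1..k}. (\<Sum>j\<in>B i. x $ j) \<le> 1)"
      unfolding e ..
    then show ?thesis by simp
  qed
  have "(\<Union>i\<in>{1..k}. (B \<circ> e) i) = (\<Union>i\<in>e ` {1..k}. B i)" by auto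
  then have 2: "(\<Union>i\<in>{1..k}. (B \<circ> e) i) = (\<Union>i\<in>{1..k}. B i)" unfolding e .
  show ?thesis unfolding simplex_product_def 1 2 ..
qed

lemma (in polar_polytope) truncation_exists:
  fixes C :: "nat \<Rightarrow> 'n set" and k :: nat
  assumes finJ: "finite J" and k1: "1 \<le> k" and C: "disjoint_family_on C {1..k}"
    "(\<Union>q\<in>{1..k}. C q) = UNIV" "C k \<noteq> {}"
    and H: "finite H" "\<forall>h\<in>H. closed_halfspace h" "\<Inter>H = P" "general_position H"
  shows "\<exists>\<rho> L l. truncation i S D \<beta> s P v E T J m k C \<rho> L l"
proof -
  obtain \<rho> where \<rho>: "\<rho> > 0"
    "\<And>x c. (\<And>r. 0 \<le> y r x) \<Longrightarrow> \<sigma> x \<le> \<rho> \<Longrightarrow> c \<in> J \<Longrightarrow> 0 < m c (x, 1)"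
    using pole_margin[OF finJ] by blast
  \<comment> \<open>With this choice \<open>U\<close> is at most 3\<rho>/8, so that 2U < \<rho> and
    all cuts stay within the margin.\<close>
  define L where "L = \<rho> / 4"
  define U where "U = (2 * real k + 1) * L / (2 * real k)"
  have L0: "0 < L" using \<rho>(1) by (simp add: L_def)
  have LU: "L < U" using L0 k1 by (simp add: U_def field_simps)
  have "U \<le> 3 / 2 * L" using L0 k1 by (simp add: U_def field_simps)
  then have U\<rho>: "2 * U < \<rho>" using \<rho>(1) by (simp add: L_def)
  obtain x0 where x0: "\<forall>r. 0 \<le> y r x0" "\<sigma> x0 = \<rho>" using cone_point[of \<rho>] \<rho>(1) by auto
  have x0P: "x0 \<in> P" by (subst P_eq) (use x0 \<rho>(2)[of x0] in \<open>auto intro: less_imp_le\<close>)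
  have far: "U \<le> cutf A x0" for A using cut_bounds(1)[of x0 A] x0 U\<rho> by simp
  obtain l where l: "\<forall>q\<in>{1..k}. L < l q \<and> l q < U"
    "\<forall>q q'. 1 \<le> q \<and> q < q' \<and> q' \<le> k \<longrightarrow> l q < l q'"
    and gp: "general_position (H \<union> (\<lambda>q. {x. l q \<le> cutf (C q) x}) ` {1..k})"
    using generic_levels[OF H LU x0P far, of k C] by blast
  have "simple_polytope (stage C l p)" if p: "p \<le> k" for p
  proof -
    let ?H = "H \<union> (\<lambda>q. {x. l q \<le> cutf (C q) x}) ` {1..p}"
    have st: "\<Inter>?H = stage C l p" unfolding stage_def Inter_Un_distrib H(3) by auto
    have "x0 \<in> stage C l p"
    proof -
      have "l q \<le> cutf (C q) x0" if "q \<in> {1..p}" for q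
      proof -
        have "l q < U" using l(1) that p by auto
        then show ?thesis using far[of "C q"] by simp
      qed
      then show ?thesis using x0P by (simp add: stage_def)
    qed
    moreover have "bounded (stage C l p)"
      using bdP by (rule bounded_subset) (auto simp: stage_def)
    moreover have "?H \<subseteq> H \<union> (\<lambda>q. {x. l q \<le> cutf (C q) x}) ` {1..k}"
      using p by (intro Un_mono image_mono) auto
    then have "general_position ?H" by (rule general_position_subset[OF gp])
    moreover have "\<forall>h\<in>?H. closed_halfspace h" using H(2) closed_halfspace_cut by blast
    moreover have "finite ?H" using H(1) by simp
    ultimately have "simple_polytope (\<Inter>?H)"
      unfolding st[symmetric] by (intro simple_polytopeI) blast+
    then show ?thesis by (simp only: st)
  qed
  then have "truncation i S D \<beta> s P v E T J m k C \<rho> L l"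
  proof (intro truncation.intro truncation_axioms.intro)
    show "polar_polytope i S D \<beta> s P v E T J m" by (rule polar_polytope_axioms)
    show "real (2 * k) * l q < real (2 * k + 1) * L" if "q \<in> {1..k}" for q
    proof -
      have "l q < U" using l(1) that by blast
      then show ?thesis using k1 by (simp add: U_def field_simps)
    qed
    show "2 * l q < \<rho>" if "q \<in> {1..k}" for q
    proof -
      have "l q < U" using l(1) that by blast
      then show ?thesis using U\<rho> by simp
    qed
    show "l q < l q'" if "1 \<le> q" "q < q'" "q' \<le> k" for q q' using l(2) that by blast
    show "L < l q" if "q \<in> {1..k}" for q using l(1) that by blast
  qed (use finJ k1 C \<rho>(2) L0 in auto)
  then show ?thesis by blast
qed

theorem theorem6p5:
  fixes k :: nat and m :: "nat \<Rightarrow> nat" and B :: "nat \<Rightarrow> 'n::finite set"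
    and Q R :: "(real^'n) set" and v w :: "real^'n" and E F :: "'n \<Rightarrow> (real^'n) set"
  assumes "CARD('n) \<ge> 2"
    and "(\<Sum>i=1..k. m i) = CARD('n)"
    and "disjoint_family_on B {1..k}"
    and "\<And>i. i \<in> {1..k} \<Longrightarrow> card (B i) = m i"
    and "v extreme_point_of simplex_product k B"
    and "bij_betw E UNIV {G. G facet_of simplex_product k B \<and> v \<in> G}"
    and "simple_polytope Q"
    and "w extreme_point_of Q"
    and "bij_betw F UNIV {G. G facet_of Q \<and> w \<in> G}"
    and "connected_sum (simplex_product k B) v E Q w F R"
  shows "\<exists>(A :: nat \<Rightarrow> (real^'n) set) (S :: nat \<Rightarrow> (real^'n) set).
           S k = Q \<and>
           (\<forall>i\<in>{1..k}. is_simplex_product (A i) \<and> pruning (A i) (S i) (S (i - 1))) \<and>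
           R \<simeq>\<^sub>c S 0"
proof -
  let ?P = "simplex_product k B"
  obtain i S D T U where S: "(int CARD('n) - 1) simplex S" "S \<subseteq> {x. x $ i = 0}"
    and D: "bij_betw D UNIV {G. G facet_of S}"
    and PT: "polar_embedding 1 i S D ?P v E T" and QU: "polar_embedding (-1) i S D Q w F U"
    and R: "R = proj_map T ` (?P - {v}) \<inter> proj_map U ` (Q - {w})"
    using assms(10) unfolding connected_sum_def by blast
  obtain \<beta> where "cylinder_frame i S D \<beta>"
    using cylinder_frame_exists[OF assms(1) S D] by blast
  then have pA: "polar i S D \<beta> 1 ?P v E T" and pB: "polar i S D \<beta> (-1) Q w F U"
    using PT QU by (simp_all add: polar_def polar_axioms_def)
  \<comment> \<open>The block sizes add up to n, so the disjoint blocks use every coordinate and the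
    product has full dimension.\<close>
  have cover: "(\<Union>l\<in>{1..k}. B l) = UNIV"
  proof (rule card_subset_eq)
    have "card (\<Union>l\<in>{1..k}. B l) = (\<Sum>l\<in>{1..k}. card (B l))"
      using assms(3) by (intro card_UN_disjoint) (auto simp: disjoint_family_on_def)
    then show "card (\<Union>l\<in>{1..k}. B l) = CARD('n)" using assms(2,4) by simp
  qed auto
  then obtain q0 where q0: "q0 \<in> {1..k}" "B q0 \<noteq> {}" by blast
  then have k1: "1 \<le> k" by simp
  \<comment> \<open>A 0-simplex factor is cut off by pruning a facet, which needs a nonempty block to be left over; so
    a nonempty block is moved to the last place.\<close>
  define e where "e = Transposition.transpose q0 k"
  have e: "bij_betw e {1..k} {1..k}"
    unfolding e_def using q0(1) k1 by (intro bij_betw_transpose_iff) auto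
  have ek: "e k = q0" by (simp add: e_def)
  have eimg: "e ` {1..k} = {1..k}" and einj: "inj_on e {1..k}" using e by (auto simp: bij_betw_def)
  have Be_dis: "disjoint_family_on (B \<circ> e) {1..k}"
    unfolding disjoint_family_on_def
  proof (intro ballI impI)
    fix a b assume ab: "a \<in> {1..k}" "b \<in> {1..k}" "a \<noteq> b"
    then have "e a \<noteq> e b" "e a \<in> {1..k}" "e b \<in> {1..k}"
      using inj_on_eq_iff[OF einj] eimg by blast+
    then show "(B \<circ> e) a \<inter> (B \<circ> e) b = {}" using assms(3) unfolding disjoint_family_on_def by simp
  qed
  have Be_cover: "(\<Union>l\<in>{1..k}. (B \<circ> e) l) = UNIV"
  proof -
    have "(\<Union>l\<in>{1..k}. (B \<circ> e) l) = (\<Union>l\<in>e ` {1..k}. B l)" by auto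
    then show ?thesis unfolding eimg using cover by simp
  qed
  have P_eq: "?P = simplex_product k (B \<circ> e)" by (rule simplex_product_reindex[OF e, symmetric])

  define JA where "JA = {l \<in> {1..k}. (B \<circ> e) l \<noteq> {}}"
  obtain \<pi> \<kappa> where bij: "bij \<pi>" and \<kappa>: "\<forall>r. \<kappa> r > 0"
    and A: "polar_polytope i S D \<beta> 1 ?P v E T JA
      (\<lambda>l Z. snd Z - (\<Sum>r\<in>\<pi> -` (B \<circ> e) l. \<beta> r (T Z) / \<kappa> r))"
    by (rule polar.simplex_product_polar[OF pA refl P_eq Be_dis Be_cover assms(5,6), folded JA_def])
  define mA where "mA = (\<lambda>l Z. snd Z - (\<Sum>r\<in>\<pi> -` (B \<circ> e) l. \<beta> r (T Z) / \<kappa> r))"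
  note A = A[folded mA_def]
  have wQ: "w \<in> Q" using assms(8) by (simp add: extreme_point_of_def)
  obtain H :: "(real^'n) set set" and JB mB where H: "finite H" "\<forall>h\<in>H. closed_halfspace h" "\<Inter>H = Q"
    "general_position H" "JB \<subseteq> H" and Bp: "polar_polytope i S D \<beta> (-1) Q w F U JB mB"
    by (rule polar.simple_polytope_polar[OF pB assms(7) wQ assms(9)])
  have finJ: "finite JA" "finite JB" using H finite_subset by (auto simp: JA_def)

  \<comment> \<open>The gluing identifies the hyperplanes of \<open>E r\<close> and
    \<open>F r\<close> through the common index \<open>r\<close>, so pulling the blocks back along
    \<open>\<pi>\<close> turns them into blocks of coordinates at \<open>w\<close>.\<close>
  define C where "C q = \<pi> -` (B \<circ> e) q" for q
  have surj: "surj \<pi>" using bij by (simp add: bij_def)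
  have C_empty: "C q = {} \<longleftrightarrow> (B \<circ> e) q = {}" for q
    unfolding C_def using surj_vimage_empty[OF surj] .
  have C_dis: "disjoint_family_on C {1..k}"
    using Be_dis unfolding disjoint_family_on_def C_def by blast
  have C_cover: "(\<Union>q\<in>{1..k}. C q) = UNIV"
    using Be_cover unfolding C_def by blast
  have Ck: "C k \<noteq> {}" using C_empty q0(2) ek by simp
  obtain \<rho> L l where "truncation i S D \<beta> (-1) Q w F U JB mB k C \<rho> L l"
    using polar_polytope.truncation_exists[OF Bp finJ(2) k1 C_dis C_cover Ck H(1-4)] by blast
  then interpret t: truncation i S D \<beta> "-1" Q w F U JB mB k C \<rho> L l .
  have JA: "JA = t.nonempty_blocks" unfolding JA_def t.nonempty_blocks_def C_empty by simp

  obtain f where f0: "polyhedral UNIV (UNIV <+> (JA <+> JB)) f \<and> R = polyh UNIV (UNIV <+> (JA <+> JB)) f \<and>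
    tight (UNIV <+> (JA <+> JB)) f ` polyh UNIV (UNIV <+> (JA <+> JB)) f
      = {Z <+> (I <+> {}) | Z I. (Z, I) \<in> polar_polytope.patterns \<beta> ?P v T JA mA \<and> I \<noteq> {}}
      \<union> {Z <+> ({} <+> L) | Z L. (Z, L) \<in> t.patterns}"
    by (rule exE[OF connected_sum_patterns[OF A Bp finJ, folded R]])
  note f = f0[THEN conjunct1] f0[THEN conjunct2, THEN conjunct1] f0[THEN conjunct2, THEN conjunct2]
  have blocks: "{(Z, I). (Z, I) \<in> polar_polytope.patterns \<beta> ?P v T JA mA \<and> I \<noteq> {}} = block_patterns C JA"
  proof (rule simplex_block_patterns[where \<kappa> = \<kappa>, OF A C_dis C_cover])
    show "0 < \<kappa> r" for r using \<kappa> by blast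
    show "JA = {q \<in> {1..k}. C q \<noteq> {}}" unfolding JA_def C_empty ..
    show "mA q Z = snd Z - (\<Sum>r\<in>C q. \<beta> r (T Z) / \<kappa> r)" for q Z by (simp add: mA_def C_def)
  qed
  have pat: "(Z, I) \<in> polar_polytope.patterns \<beta> ?P v T JA mA \<and> I \<noteq> {} \<longleftrightarrow> (Z, I) \<in> block_patterns C JA" for Z I
    unfolding blocks[symmetric] by simp
  have "tight (UNIV <+> (JA <+> JB)) f ` polyh UNIV (UNIV <+> (JA <+> JB)) f
      = tight (UNIV <+> (JA <+> JB)) t.last_form ` polyh UNIV (UNIV <+> (JA <+> JB)) t.last_form"
    unfolding f(3) pat unfolding JA t.last_stage_eq[symmetric] t.last_stage_patterns ..
  then have equiv: "R \<simeq>\<^sub>c t.stage C l k"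
    unfolding f(2) t.last_stage_eq JA[symmetric]
    using f(1) t.polyhedral_last unfolding JA[symmetric] by (intro combinatorially_equivalent_polyh)

  show ?thesis
  \<comment> \<open>Stages count the cuts already made, whereas the faces are numbered so that the
    first pruning comes last; hence \<open>k - j\<close>.\<close>
  proof (rule exI[of _ "\<lambda>j. t.pruned_face (k - j)"], rule exI[of _ "\<lambda>j. t.stage C l (k - j)"],
      intro conjI ballI)
    show "t.stage C l (k - k) = Q" by (simp add: t.stage_def)
    show "R \<simeq>\<^sub>c t.stage C l (k - 0)" using equiv by simp
    fix j assume j: "j \<in> {1..k}"
    then have "k - j < k" "k - (j - 1) = Suc (k - j)" by auto
    then show "is_simplex_product (t.pruned_face (k - j))"
      and "pruning (t.pruned_face (k - j)) (t.stage C l (k - j)) (t.stage C l (k - (j - 1)))"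
      using t.is_simplex_product_pruned_face t.pruning_stage by simp_all
  qed
qed

end
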